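(* Let $T$ be a complete first-order theory with monster model $\mathcal U$, $\phi(x,y)$ an $NIP$ formula, $M\models T$ a (not necessarily countable) model, and $\mu\in\mathfrak M_\phi(\mathcal U)$ a global Keisler $\phi$-measure finitely satisfiable in $M$. Let $\nu$ be any regular Borel probability measure on $S_{\tilde\phi}(M)$ and $\epsilon>0$. (i) There is a measurable set $C\subseteq S_{\tilde\phi}(M)$ with $\nu(C)>1-\epsilon$, and there are $m\in\mathbb N$, $k\le m$, formulas $\theta_1(\bar a_1,y),\dots,\theta_k(\bar a_k,y)$, each of the form $\bigwedge_j\phi(a_j,y)$ with all $a_j\in M$ (so $\bar a_i$ are tuples from $M$), such that for every $b\in\mathcal U$ with $tp_{\tilde\phi}(b/M)\in C$, $$\Big|\frac{\sum_{i=1}^k\theta_i(\bar a_i,b)}{m}-\mu(\phi(x,b))\Big|<\epsilon.$$ (ii) Suppose moreover that $M$ is countable. Then: (a) there are a measurable $C\subseteq S_{\tilde\phi}(M)$ with $\nu(C)>1-\epsilon$ and $a_1,\dots,a_n\in M$ such that for all $b\in\mathcal U$ with $tp_{\tilde\phi}(b/M)\in C$, $\big|\frac1n\sum_{i=1}^n\phi(a_i,b)-\mu(\phi(x,b))\big|<\epsilon$; (b) there are a measurable $E\subseteq S_{\tilde\phi}(M)$ with $\nu(E)>1-\epsilon$ and a Baire-1/2 function $f$ on $S_{\tilde\phi}(M)$ such that $\mu(\phi(x,b))=f(tp_{\tilde\phi}(b/M))$ for all $b\in\mathcal U$ with $tp_{\tilde\phi}(b/M)\in E$.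
   Context: $NIP$: no $(a_i)_{i<\omega}$, $(b_E)_{E\subseteq\omega}$ with $\models\phi(a_i,b_E)\iff i\in E$. $\tilde\phi(y,x)=\phi(x,y)$; $S_{\tilde\phi}(M)$ is the Stone space of complete $\tilde\phi$-types over $M$ and $tp_{\tilde\phi}(b/M)$ the $\tilde\phi$-type of $b$ over $M$. A global Keisler $\phi$-measure is a finitely additive probability measure on Boolean combinations of $\phi(x,b)$, $b\in\mathcal U$; it is finitely satisfiable in $M$ if each formula of positive measure is satisfied by an element of $M$. For a formula $\psi(y)$ and $b$, $\psi(b)$ denotes $1$ if $\models\psi(b)$ and $0$ otherwise. On a compact metric space, a function is $DBSC$ if it is the pointwise limit of continuous $f_n$ ($f_0=0$) with $\sum_n|f_{n+1}-f_n|\le C$ everywhere for some constant $C$, and Baire-1/2 if it is a uniform limit of $DBSC$ functions (for countable $M$, $S_{\tilde\phi}(M)$ is compact metrizable). *)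

theory Defs
  imports "HOL-Probability.Probability"
begin

section \<open>First-order languages, structures and satisfaction\<close>

text \<open>A language is a set of function symbols and a set of relation symbols, each tagged with
  its arity (constants have arity 0); equality is a logical symbol.  Symbols are drawn from the
  arbitrary types \<open>'f\<close> and \<open>'r\<close>.\<close>

record ('f, 'r) language =
  lang_funs :: "('f \<times> nat) set"
  lang_rels :: "('r \<times> nat) set"

datatype 'f fo_term = Var nat | App 'f "'f fo_term list"

datatype ('f, 'r) fo_form =
    Eql "'f fo_term" "'f fo_term"
  | Rel 'r "'f fo_term list"
  | Neg "('f, 'r) fo_form"
  | Conj "('f, 'r) fo_form" "('f, 'r) fo_form"
  | Exi nat "('f, 'r) fo_form"

fun term_vars :: "'f fo_term \<Rightarrow> nat set" where
  "term_vars (Var v) = {v}"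
| "term_vars (App f ts) = (\<Union>t\<in>set ts. term_vars t)"

fun wf_term :: "('f, 'r) language \<Rightarrow> 'f fo_term \<Rightarrow> bool" where
  "wf_term L (Var v) \<longleftrightarrow> True"
| "wf_term L (App f ts) \<longleftrightarrow> (f, length ts) \<in> lang_funs L \<and> (\<forall>t\<in>set ts. wf_term L t)"

fun free_vars :: "('f, 'r) fo_form \<Rightarrow> nat set" where
  "free_vars (Eql s t) = term_vars s \<union> term_vars t"
| "free_vars (Rel r ts) = (\<Union>t\<in>set ts. term_vars t)"
| "free_vars (Neg \<psi>) = free_vars \<psi>"
| "free_vars (Conj \<psi> \<eta>) = free_vars \<psi> \<union> free_vars \<eta>"
| "free_vars (Exi v \<psi>) = free_vars \<psi> - {v}"

fun wf_form :: "('f, 'r) language \<Rightarrow> ('f, 'r) fo_form \<Rightarrow> bool" where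
  "wf_form L (Eql s t) \<longleftrightarrow> wf_term L s \<and> wf_term L t"
| "wf_form L (Rel r ts) \<longleftrightarrow> (r, length ts) \<in> lang_rels L \<and> (\<forall>t\<in>set ts. wf_term L t)"
| "wf_form L (Neg \<psi>) \<longleftrightarrow> wf_form L \<psi>"
| "wf_form L (Conj \<psi> \<eta>) \<longleftrightarrow> wf_form L \<psi> \<and> wf_form L \<eta>"
| "wf_form L (Exi v \<psi>) \<longleftrightarrow> wf_form L \<psi>"

definition sentence :: "('f, 'r) language \<Rightarrow> ('f, 'r) fo_form \<Rightarrow> bool" where
  "sentence L \<sigma> \<longleftrightarrow> wf_form L \<sigma> \<and> free_vars \<sigma> = {}"

record ('f, 'r, 'a) fo_struct =
  univ :: "'a set"
  fun_interp :: "'f \<Rightarrow> 'a list \<Rightarrow> 'a"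
  rel_interp :: "'r \<Rightarrow> 'a list \<Rightarrow> bool"

definition is_struct :: "('f, 'r) language \<Rightarrow> ('f, 'r, 'a) fo_struct \<Rightarrow> bool" where
  "is_struct L \<A> \<longleftrightarrow> univ \<A> \<noteq> {} \<and>
     (\<forall>f as. (f, length as) \<in> lang_funs L \<longrightarrow> set as \<subseteq> univ \<A> \<longrightarrow> fun_interp \<A> f as \<in> univ \<A>)"

fun term_val :: "('f, 'r, 'a) fo_struct \<Rightarrow> (nat \<Rightarrow> 'a) \<Rightarrow> 'f fo_term \<Rightarrow> 'a" where
  "term_val \<A> e (Var v) = e v"
| "term_val \<A> e (App f ts) = fun_interp \<A> f (map (term_val \<A> e) ts)"

fun sat :: "('f, 'r, 'a) fo_struct \<Rightarrow> (nat \<Rightarrow> 'a) \<Rightarrow> ('f, 'r) fo_form \<Rightarrow> bool" where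
  "sat \<A> e (Eql s t) \<longleftrightarrow> term_val \<A> e s = term_val \<A> e t"
| "sat \<A> e (Rel r ts) \<longleftrightarrow> rel_interp \<A> r (map (term_val \<A> e) ts)"
| "sat \<A> e (Neg \<psi>) \<longleftrightarrow> \<not> sat \<A> e \<psi>"
| "sat \<A> e (Conj \<psi> \<eta>) \<longleftrightarrow> sat \<A> e \<psi> \<and> sat \<A> e \<eta>"
| "sat \<A> e (Exi v \<psi>) \<longleftrightarrow> (\<exists>a\<in>univ \<A>. sat \<A> (e(v := a)) \<psi>)"

definition model_of :: "('f, 'r) language \<Rightarrow> ('f, 'r) fo_form set \<Rightarrow> ('f, 'r, 'a) fo_struct \<Rightarrow> bool" where
  "model_of L T \<A> \<longleftrightarrow> is_struct L \<A> \<and>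
     (\<forall>\<sigma>\<in>T. \<forall>e. range e \<subseteq> univ \<A> \<longrightarrow> sat \<A> e \<sigma>)"

text \<open>Theories are taken deductively closed, so that completeness means that exactly one of
  \<open>\<sigma>\<close>, \<open>\<not>\<sigma>\<close> belongs to \<open>T\<close>.  Consistency is not repeated here: wherever this predicate is used,
  a model of \<open>T\<close> (the monster) is given.\<close>

definition complete_theory :: "('f, 'r) language \<Rightarrow> ('f, 'r) fo_form set \<Rightarrow> bool" where
  "complete_theory L T \<longleftrightarrow> (\<forall>\<sigma>\<in>T. sentence L \<sigma>) \<and>
     (\<forall>\<sigma>. sentence L \<sigma> \<longrightarrow> (\<sigma> \<in> T \<longleftrightarrow> Neg \<sigma> \<notin> T))"

definition elementary_submodel ::
  "('f, 'r) language \<Rightarrow> 'a set \<Rightarrow> ('f, 'r, 'a) fo_struct \<Rightarrow> bool" where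
  "elementary_submodel L M \<A> \<longleftrightarrow> M \<subseteq> univ \<A> \<and> is_struct L (\<A>\<lparr>univ := M\<rparr>) \<and>
     (\<forall>\<psi> e. wf_form L \<psi> \<longrightarrow> range e \<subseteq> M \<longrightarrow>
        (sat (\<A>\<lparr>univ := M\<rparr>) e \<psi> \<longleftrightarrow> sat \<A> e \<psi>))"


section \<open>Monster models\<close>

unbundle cardinal_syntax

text \<open>A set of formulas with parameters from \<open>A\<close> in the variable \<open>0\<close> is a set of pairs
  \<open>(\<psi>, e)\<close>, where \<open>e\<close> supplies the parameters for the remaining free variables of \<open>\<psi>\<close>.\<close>

definition saturated :: "('f, 'r) language \<Rightarrow> 'k rel \<Rightarrow> ('f, 'r, 'a) fo_struct \<Rightarrow> bool" where
  "saturated L \<kappa> \<A> \<longleftrightarrow>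
     (\<forall>A \<Gamma>. A \<subseteq> univ \<A> \<longrightarrow> |A| <o \<kappa> \<longrightarrow>
        (\<forall>(\<psi>, e)\<in>\<Gamma>. wf_form L \<psi> \<and> (\<forall>v\<in>free_vars \<psi> - {0}. e v \<in> A)) \<longrightarrow>
        (\<forall>\<Delta>\<subseteq>\<Gamma>. finite \<Delta> \<longrightarrow> (\<exists>c\<in>univ \<A>. \<forall>(\<psi>, e)\<in>\<Delta>. sat \<A> (e(0 := c)) \<psi>)) \<longrightarrow>
        (\<exists>c\<in>univ \<A>. \<forall>(\<psi>, e)\<in>\<Gamma>. sat \<A> (e(0 := c)) \<psi>))"

definition partial_elementary ::
  "('f, 'r) language \<Rightarrow> ('f, 'r, 'a) fo_struct \<Rightarrow> 'a set \<Rightarrow> ('a \<Rightarrow> 'a) \<Rightarrow> bool" where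
  "partial_elementary L \<A> A h \<longleftrightarrow> h ` A \<subseteq> univ \<A> \<and>
     (\<forall>\<psi> e. wf_form L \<psi> \<longrightarrow> (\<forall>v\<in>free_vars \<psi>. e v \<in> A) \<longrightarrow> (sat \<A> e \<psi> \<longleftrightarrow> sat \<A> (h \<circ> e) \<psi>))"

definition automorphism ::
  "('f, 'r) language \<Rightarrow> ('f, 'r, 'a) fo_struct \<Rightarrow> ('a \<Rightarrow> 'a) \<Rightarrow> bool" where
  "automorphism L \<A> g \<longleftrightarrow> bij_betw g (univ \<A>) (univ \<A>) \<and>
     (\<forall>f as. (f, length as) \<in> lang_funs L \<longrightarrow> set as \<subseteq> univ \<A> \<longrightarrow>
        g (fun_interp \<A> f as) = fun_interp \<A> f (map g as)) \<and>
     (\<forall>r as. (r, length as) \<in> lang_rels L \<longrightarrow> set as \<subseteq> univ \<A> \<longrightarrow>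
        (rel_interp \<A> r as \<longleftrightarrow> rel_interp \<A> r (map g as)))"

definition strongly_homogeneous ::
  "('f, 'r) language \<Rightarrow> 'k rel \<Rightarrow> ('f, 'r, 'a) fo_struct \<Rightarrow> bool" where
  "strongly_homogeneous L \<kappa> \<A> \<longleftrightarrow>
     (\<forall>A h. A \<subseteq> univ \<A> \<longrightarrow> |A| <o \<kappa> \<longrightarrow> partial_elementary L \<A> A h \<longrightarrow>
        (\<exists>g. automorphism L \<A> g \<and> (\<forall>a\<in>A. g a = h a)))"

text \<open>The set of formulas of \<open>L\<close> has cardinality \<open>max(|L|, \<aleph>\<^sub>0)\<close>, so \<open>\<kappa>\<close> is uncountable and larger
  than the language.  ``Small'' means of cardinality less than \<open>\<kappa>\<close>.\<close>

definition monster_model ::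
  "('f, 'r) language \<Rightarrow> ('f, 'r) fo_form set \<Rightarrow> 'k rel \<Rightarrow> ('f, 'r, 'a) fo_struct \<Rightarrow> bool" where
  "monster_model L T \<kappa> \<U> \<longleftrightarrow> model_of L T \<U> \<and>
     Card_order \<kappa> \<and> |{\<psi>. wf_form L \<psi>}| <o \<kappa> \<and>
     saturated L \<kappa> \<U> \<and> strongly_homogeneous L \<kappa> \<U>"

text \<open>By the usual convention the models of \<open>T\<close> under consideration are the small elementary
  submodels of the monster model \<open>\<U>\<close>; they are models of \<open>T\<close> by elementarity.\<close>

definition small_model ::
  "('f, 'r) language \<Rightarrow> 'k rel \<Rightarrow> ('f, 'r, 'a) fo_struct \<Rightarrow> 'a set \<Rightarrow> bool" where
  "small_model L \<kappa> \<U> M \<longleftrightarrow> elementary_submodel L M \<U> \<and> |M| <o \<kappa>"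


section \<open>Partitioned formulas, NIP, types and Keisler measures\<close>

text \<open>A formula \<open>\<phi>(x,y)\<close> whose free variables are partitioned into two finite tuples.\<close>

record ('f, 'r) part_form =
  the_form :: "('f, 'r) fo_form"
  xvars :: "nat list"
  yvars :: "nat list"

definition wf_part_form :: "('f, 'r) language \<Rightarrow> ('f, 'r) part_form \<Rightarrow> bool" where
  "wf_part_form L \<phi> \<longleftrightarrow> wf_form L (the_form \<phi>) \<and> distinct (xvars \<phi> @ yvars \<phi>) \<and>
     free_vars (the_form \<phi>) \<subseteq> set (xvars \<phi>) \<union> set (yvars \<phi>)"

definition xtuples :: "('f, 'r) part_form \<Rightarrow> 'a set \<Rightarrow> 'a list set" where
  "xtuples \<phi> A = {a. set a \<subseteq> A \<and> length a = length (xvars \<phi>)}"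

definition ytuples :: "('f, 'r) part_form \<Rightarrow> 'a set \<Rightarrow> 'a list set" where
  "ytuples \<phi> A = {b. set b \<subseteq> A \<and> length b = length (yvars \<phi>)}"

text \<open>\<open>holds_at \<U> \<phi> a b\<close> is \<open>\<Turnstile> \<phi>(a,b)\<close>.  The assignment sends variables outside \<open>x\<close>, \<open>y\<close>
  to an irrelevant value.\<close>

definition holds_at :: "('f, 'r, 'a) fo_struct \<Rightarrow> ('f, 'r) part_form \<Rightarrow> 'a list \<Rightarrow> 'a list \<Rightarrow> bool" where
  "holds_at \<U> \<phi> a b \<longleftrightarrow>
     sat \<U> (\<lambda>v. the (map_of (zip (xvars \<phi> @ yvars \<phi>) (a @ b)) v)) (the_form \<phi>)"

definition NIP :: "('f, 'r, 'a) fo_struct \<Rightarrow> ('f, 'r) part_form \<Rightarrow> bool" where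
  "NIP \<U> \<phi> \<longleftrightarrow>
     (\<nexists>(a :: nat \<Rightarrow> 'a list) (b :: nat set \<Rightarrow> 'a list).
        range a \<subseteq> xtuples \<phi> (univ \<U>) \<and> range b \<subseteq> ytuples \<phi> (univ \<U>) \<and>
        (\<forall>i E. holds_at \<U> \<phi> (a i) (b E) \<longleftrightarrow> i \<in> E))"

text \<open>The literal \<open>(a, True)\<close> stands for the formula \<open>\<phi>(a,y)\<close>, and \<open>(a, False)\<close> for \<open>\<not>\<phi>(a,y)\<close>.
  A complete \<open>\<phi>\<^sup>~\<close>-type over \<open>M\<close> is a maximal consistent set of such literals with \<open>a\<close> in \<open>M\<close>;
  consistency with the elementary diagram of \<open>M\<close> is finite satisfiability in \<open>\<U>\<close>.\<close>

type_synonym 'a opp_type = "('a list \<times> bool) set"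

definition opp_consistent ::
  "('f, 'r, 'a) fo_struct \<Rightarrow> ('f, 'r) part_form \<Rightarrow> 'a opp_type \<Rightarrow> bool" where
  "opp_consistent \<U> \<phi> p \<longleftrightarrow>
     (\<forall>q\<subseteq>p. finite q \<longrightarrow> (\<exists>b\<in>ytuples \<phi> (univ \<U>). \<forall>(a, s)\<in>q. holds_at \<U> \<phi> a b \<longleftrightarrow> s))"

definition opp_types ::
  "('f, 'r, 'a) fo_struct \<Rightarrow> ('f, 'r) part_form \<Rightarrow> 'a set \<Rightarrow> 'a opp_type set" where
  "opp_types \<U> \<phi> M = {p. p \<subseteq> xtuples \<phi> M \<times> UNIV \<and> opp_consistent \<U> \<phi> p \<and>
     (\<forall>q. p \<subseteq> q \<longrightarrow> q \<subseteq> xtuples \<phi> M \<times> UNIV \<longrightarrow> opp_consistent \<U> \<phi> q \<longrightarrow> q = p)}"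

definition opp_tp ::
  "('f, 'r, 'a) fo_struct \<Rightarrow> ('f, 'r) part_form \<Rightarrow> 'a set \<Rightarrow> 'a list \<Rightarrow> 'a opp_type" where
  "opp_tp \<U> \<phi> M b = {(a, s). a \<in> xtuples \<phi> M \<and> (holds_at \<U> \<phi> a b \<longleftrightarrow> s)}"

definition opp_stone ::
  "('f, 'r, 'a) fo_struct \<Rightarrow> ('f, 'r) part_form \<Rightarrow> 'a set \<Rightarrow> 'a opp_type topology" where
  "opp_stone \<U> \<phi> M =
     topology_generated_by {{p \<in> opp_types \<U> \<phi> M. l \<in> p} | l. l \<in> xtuples \<phi> M \<times> UNIV}"

lemma opp_tp_in_opp_types:
  assumes "b \<in> ytuples \<phi> (univ \<U>)"
  shows "opp_tp \<U> \<phi> M b \<in> opp_types \<U> \<phi> M"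
proof -
  have "opp_consistent \<U> \<phi> (opp_tp \<U> \<phi> M b)"
    using assms unfolding opp_consistent_def opp_tp_def by fastforce
  moreover have "q = opp_tp \<U> \<phi> M b"
    if q: "opp_tp \<U> \<phi> M b \<subseteq> q" "q \<subseteq> xtuples \<phi> M \<times> UNIV" "opp_consistent \<U> \<phi> q" for q
  proof (rule ccontr)
    assume "q \<noteq> opp_tp \<U> \<phi> M b"
    then obtain a s where as: "(a, s) \<in> q" "(a, s) \<notin> opp_tp \<U> \<phi> M b" using q(1) by auto
    moreover have "a \<in> xtuples \<phi> M" using as(1) q(2) by auto
    ultimately have "(a, \<not> s) \<in> opp_tp \<U> \<phi> M b" by (auto simp: opp_tp_def)
    then have "(a, \<not> s) \<in> q" using q(1) by blast
    then have "{(a, s), (a, \<not> s)} \<subseteq> q" using as by auto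
    then have "\<exists>c\<in>ytuples \<phi> (univ \<U>). \<forall>(a, s)\<in>{(a, s), (a, \<not> s)}. holds_at \<U> \<phi> a c \<longleftrightarrow> s"
      using q(3) unfolding opp_consistent_def by (metis finite.emptyI finite_insert)
    then show False by auto
  qed
  ultimately show ?thesis unfolding opp_types_def by (auto simp: opp_tp_def)
qed

lemma topspace_opp_stone:
  assumes "M \<noteq> {}" and "univ \<U> \<noteq> {}"
  shows "topspace (opp_stone \<U> \<phi> M) = opp_types \<U> \<phi> M"
proof -
  have "\<exists>l. l \<in> p \<and> l \<in> xtuples \<phi> M \<times> UNIV" if p: "p \<in> opp_types \<U> \<phi> M" for p
  proof (rule ccontr)
    assume "\<nexists>l. l \<in> p \<and> l \<in> xtuples \<phi> M \<times> UNIV"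
    then have "p = {}" using p unfolding opp_types_def by blast
    obtain b where b: "b \<in> univ \<U>" using assms by blast
    obtain a where a: "a \<in> M" using assms by blast
    let ?b = "replicate (length (yvars \<phi>)) b" and ?a = "replicate (length (xvars \<phi>)) a"
    have yb: "?b \<in> ytuples \<phi> (univ \<U>)" and xa: "?a \<in> xtuples \<phi> M"
      using a b by (auto simp: ytuples_def xtuples_def)
    have t: "opp_tp \<U> \<phi> M ?b \<in> opp_types \<U> \<phi> M" by (rule opp_tp_in_opp_types[OF yb])
    then have "opp_tp \<U> \<phi> M ?b = p" using p \<open>p = {}\<close> unfolding opp_types_def by blast
    moreover have "(?a, holds_at \<U> \<phi> ?a ?b) \<in> opp_tp \<U> \<phi> M ?b" using xa by (simp add: opp_tp_def)
    ultimately show False using \<open>p = {}\<close> by blast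
  qed
  then show ?thesis
    unfolding opp_stone_def topology_generated_by_topspace by blast
qed

definition regular_borel_prob :: "'p topology \<Rightarrow> 'p measure \<Rightarrow> bool" where
  "regular_borel_prob X \<nu> \<longleftrightarrow>
     space \<nu> = topspace X \<and> sets \<nu> = sigma_sets (topspace X) {G. openin X G} \<and> prob_space \<nu> \<and>
     (\<forall>A\<in>sets \<nu>.
        emeasure \<nu> A = (SUP K\<in>{K. K \<subseteq> A \<and> compactin X K \<and> closedin X K}. emeasure \<nu> K) \<and>
        emeasure \<nu> A = (INF G\<in>{G. A \<subseteq> G \<and> openin X G}. emeasure \<nu> G))"

text \<open>Boolean combinations of formulas \<open>\<phi>(x,b)\<close>, \<open>b\<close> in \<open>\<U>\<close>, identified with the sets they define.
  The whole space and the empty set arise as \<open>A \<union> -A\<close> and its complement.\<close>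

inductive_set bool_combs ::
  "('f, 'r, 'a) fo_struct \<Rightarrow> ('f, 'r) part_form \<Rightarrow> 'a list set set"
  for \<U> :: "('f, 'r, 'a) fo_struct" and \<phi> :: "('f, 'r) part_form" where
  inst: "b \<in> ytuples \<phi> (univ \<U>) \<Longrightarrow> {a \<in> xtuples \<phi> (univ \<U>). holds_at \<U> \<phi> a b} \<in> bool_combs \<U> \<phi>"
| compl: "A \<in> bool_combs \<U> \<phi> \<Longrightarrow> xtuples \<phi> (univ \<U>) - A \<in> bool_combs \<U> \<phi>"
| union: "A \<in> bool_combs \<U> \<phi> \<Longrightarrow> B \<in> bool_combs \<U> \<phi> \<Longrightarrow> A \<union> B \<in> bool_combs \<U> \<phi>"

definition keisler_measure ::
  "('f, 'r, 'a) fo_struct \<Rightarrow> ('f, 'r) part_form \<Rightarrow> ('a list set \<Rightarrow> real) \<Rightarrow> bool" where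
  "keisler_measure \<U> \<phi> \<mu> \<longleftrightarrow>
     (\<forall>A\<in>bool_combs \<U> \<phi>. 0 \<le> \<mu> A) \<and> \<mu> (xtuples \<phi> (univ \<U>)) = 1 \<and>
     additive (bool_combs \<U> \<phi>) \<mu>"

definition finitely_satisfiable ::
  "('f, 'r, 'a) fo_struct \<Rightarrow> ('f, 'r) part_form \<Rightarrow> 'a set \<Rightarrow> ('a list set \<Rightarrow> real) \<Rightarrow> bool" where
  "finitely_satisfiable \<U> \<phi> M \<mu> \<longleftrightarrow>
     (\<forall>A\<in>bool_combs \<U> \<phi>. \<mu> A > 0 \<longrightarrow> (\<exists>a\<in>xtuples \<phi> M. a \<in> A))"

text \<open>\<open>inst_measure \<U> \<phi> \<mu> b\<close> is \<open>\<mu>(\<phi>(x,b))\<close>.\<close>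

definition inst_measure ::
  "('f, 'r, 'a) fo_struct \<Rightarrow> ('f, 'r) part_form \<Rightarrow> ('a list set \<Rightarrow> real) \<Rightarrow> 'a list \<Rightarrow> real" where
  "inst_measure \<U> \<phi> \<mu> b = \<mu> {a \<in> xtuples \<phi> (univ \<U>). holds_at \<U> \<phi> a b}"

text \<open>Truth of \<open>\<theta>(a\<^sub>1,\<dots>,a\<^sub>l,b)\<close> for \<open>\<theta>(a\<^sub>1,\<dots>,a\<^sub>l,y) = \<phi>(a\<^sub>1,y) \<and> \<dots> \<and> \<phi>(a\<^sub>l,y)\<close>.\<close>

definition holds_conj ::
  "('f, 'r, 'a) fo_struct \<Rightarrow> ('f, 'r) part_form \<Rightarrow> 'a list list \<Rightarrow> 'a list \<Rightarrow> bool" where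
  "holds_conj \<U> \<phi> as b \<longleftrightarrow> (\<forall>a\<in>set as. holds_at \<U> \<phi> a b)"


section \<open>DBSC and Baire-1/2 functions\<close>

definition DBSC :: "'p topology \<Rightarrow> ('p \<Rightarrow> real) \<Rightarrow> bool" where
  "DBSC X f \<longleftrightarrow> (\<exists>(F :: nat \<Rightarrow> 'p \<Rightarrow> real) (C :: real).
     (\<forall>n. continuous_map X euclideanreal (F n)) \<and>
     (\<forall>p\<in>topspace X. F 0 p = 0) \<and>
     (\<forall>p\<in>topspace X. (\<lambda>n. F n p) \<longlonglongrightarrow> f p) \<and>
     (\<forall>p\<in>topspace X. summable (\<lambda>n. \<bar>F (Suc n) p - F n p\<bar>) \<and>
        (\<Sum>n. \<bar>F (Suc n) p - F n p\<bar>) \<le> C))"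

definition baire_half :: "'p topology \<Rightarrow> ('p \<Rightarrow> real) \<Rightarrow> bool" where
  "baire_half X f \<longleftrightarrow> (\<exists>g :: nat \<Rightarrow> 'p \<Rightarrow> real.
     (\<forall>n. DBSC X (g n)) \<and> uniform_limit (topspace X) g f sequentially)"

end

theory Submission
  imports Defs
begin

text \<open>
  Let \<open>f(tp b) = \<mu>(\<phi>(x,b))\<close>. Finite satisfiability makes \<open>f\<close> a pointwise limit, along an ultrafilter, of
  averages \<open>\<psi>\<close> of the continuous functions \<open>\<phi>(a,\<cdot>)\<close>, \<open>a\<close> in \<open>M\<close>. By saturation NIP bounds the size of
  shattered sets, and the Sauer-Shelah lemma together with an exponential moment bound for random
  signs transfers this to averages: for \<open>\<alpha> < \<beta>\<close> no long sequence of averages is independent at the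
  levels \<open>\<alpha>\<close>, \<open>\<beta>\<close>. Hence on a closed set \<open>K\<close> all of whose nonempty relatively open subsets have
  positive measure, there are finitely many cells such that each average is \<open>\<ge> \<alpha>\<close> or \<open>\<le> \<beta>\<close> throughout
  one of them; the ultrafilter selects the cell. Running through a grid of levels leaves a cell of
  positive measure on which \<open>\<psi>\<close> is ultimately uniformly close to \<open>f\<close>. Sets with this property are closed
  under finite unions, so they exhaust the space up to measure \<open>\<epsilon>\<close>. Fast uniform
  approximation off small sets yields a uniform limit of continuous functions, which is Baire-1/2.
\<close>

section \<open>Shattering and independent averages\<close>

text \<open>The obstacle is that \<open>f\<close> is a limit along an ultrafilter: in general such a
  limit need not be measurable, and Egorov's theorem, a fact about sequences, does not apply to it.
  Uniformity has to come from NIP. Finite satisfiability, however, supplies averages and not single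
  instances, so NIP is first made quantitative. From N independent averages at levels with gap
  \<gamma> = \<beta> - \<alpha> one extracts N points whose traces on the 2^N witnesses correlate
  with the prescribed patterns; random signs then force at least exp (N \<gamma>^2 / 16) traces,
  whereas Sauer-Shelah allows only (N + 1)^d. The topological part is relative to a set R, the
  realized types, where \<open>f\<close> is defined. A cell is only known to be nonempty and
  relatively open; self-supporting sets turn this into positive measure. One ultrafilter serves
  throughout, so that what holds ultimately on two sets holds ultimately on their union, and a
  single average can be picked at the end.\<close>

definition shattered :: "('x \<Rightarrow> 'y \<Rightarrow> bool) \<Rightarrow> 'y set \<Rightarrow> nat \<Rightarrow> (nat \<Rightarrow> 'x) \<Rightarrow> bool" where
  "shattered H Y d a \<longleftrightarrow> (\<forall>E\<subseteq>{..<d}. \<exists>b\<in>Y. \<forall>i<d. H (a i) b \<longleftrightarrow> i \<in> E)"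

section \<open>The Sauer-Shelah bound for traces\<close>

definition shatters :: "'v set set \<Rightarrow> 'v set \<Rightarrow> bool" where
  "shatters F S \<longleftrightarrow> (\<forall>E\<subseteq>S. \<exists>t\<in>F. t \<inter> S = E)"

text \<open>Pajor's form of the Sauer-Shelah lemma. Removing x splits F into \<open>F0\<close>
  (members without x) and \<open>F1\<close> (members with x, stripped of it). A set shattered by
  either is shattered by F, and a set S shattered by both yields \<open>insert x S\<close> as well;
  this accounts for both summands of |A F0 \<union> A F1| + |A F0 \<inter> A F1|.\<close>

lemma card_le_card_shattered:
  assumes "finite V" "F \<subseteq> Pow V"
  shows "card F \<le> card {S. S \<subseteq> V \<and> shatters F S}"
  using assms
proof (induction V arbitrary: F rule: finite_induct)
  case empty
  then have "F = {} \<or> F = {{}}" by auto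
  then show ?case
  proof
    assume "F = {{}}"
    then have "{S. S \<subseteq> {} \<and> shatters F S} = {{}}" by (auto simp: shatters_def)
    then show ?thesis using \<open>F = {{}}\<close> by simp
  qed simp
next
  case (insert x V)
  define F0 where "F0 = {t\<in>F. x \<notin> t}"
  define F1 where "F1 = (\<lambda>t. t - {x}) ` {t\<in>F. x \<in> t}"
  define A where "A G = {S. S \<subseteq> V \<and> shatters G S}" for G
  have sub: "F0 \<subseteq> Pow V" "F1 \<subseteq> Pow V" using insert.prems by (auto simp: F0_def F1_def)
  have finF: "finite F" using insert.prems insert.hyps(1) by (meson finite.insertI finite_Pow_iff finite_subset)
  have finA: "finite (A G)" for G using insert.hyps(1) by (auto simp: A_def)
  have inj: "inj_on (\<lambda>t. t - {x}) {t\<in>F. x \<in> t}" by (auto simp: inj_on_def)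
  have "F = F0 \<union> {t\<in>F. x \<in> t}" "F0 \<inter> {t\<in>F. x \<in> t} = {}" by (auto simp: F0_def)
  then have "card F = card F0 + card {t\<in>F. x \<in> t}"
    using finF by (metis card_Un_disjoint finite_Un)
  also have "card {t\<in>F. x \<in> t} = card F1" unfolding F1_def by (rule card_image[OF inj, symmetric])
  also have "card F0 + card F1 \<le> card (A F0) + card (A F1)"
    unfolding A_def by (intro add_mono insert.IH sub)
  also have "\<dots> = card (A F0 \<union> A F1) + card (A F0 \<inter> A F1)" by (rule card_Un_Int[OF finA finA])
  also have "card (A F0 \<inter> A F1) = card (insert x ` (A F0 \<inter> A F1))"
  proof (rule card_image[symmetric])
    show "inj_on (insert x) (A F0 \<inter> A F1)"
      using insert.hyps(2) unfolding A_def inj_on_def by (blast dest: insert_ident)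
  qed
  also have "card (A F0 \<union> A F1) + \<dots> = card ((A F0 \<union> A F1) \<union> insert x ` (A F0 \<inter> A F1))"
    using insert.hyps(2) finA by (intro card_Un_disjoint[symmetric]) (auto simp: A_def)
  also have "\<dots> \<le> card {S. S \<subseteq> insert x V \<and> shatters F S}"
  proof (rule card_mono)
    show "finite {S. S \<subseteq> insert x V \<and> shatters F S}" using insert.hyps(1) by auto
    have up: "shatters F S" if S: "S \<in> A F0 \<or> S \<in> A F1" for S
      unfolding shatters_def
    proof (intro allI impI)
      fix E assume E: "E \<subseteq> S"
      have xS: "x \<notin> S" using S insert.hyps(2) by (auto simp: A_def)
      have "(\<exists>t\<in>F0. t \<inter> S = E) \<or> (\<exists>t\<in>F1. t \<inter> S = E)" using S E by (auto simp: A_def shatters_def)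
      then show "\<exists>t\<in>F. t \<inter> S = E"
      proof
        assume "\<exists>t\<in>F1. t \<inter> S = E"
        then obtain t where "t \<in> F" "(t - {x}) \<inter> S = E" by (auto simp: F1_def)
        then show ?thesis using xS by (intro bexI[of _ t]) auto
      qed (auto simp: F0_def)
    qed
    have both: "shatters F (insert x S)" if S: "S \<in> A F0" "S \<in> A F1" for S
      unfolding shatters_def
    proof (intro allI impI)
      fix E assume E: "E \<subseteq> insert x S"
      have xS: "x \<notin> S" using S insert.hyps(2) by (auto simp: A_def)
      show "\<exists>t\<in>F. t \<inter> insert x S = E"
      proof (cases "x \<in> E")
        case True
        obtain t where t: "t \<in> F" "x \<in> t" "(t - {x}) \<inter> S = E - {x}"
        proof -
          have "E - {x} \<subseteq> S" using E by auto
          moreover have "shatters F1 S" using S(2) by (simp add: A_def)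
          ultimately obtain u where "u \<in> F1" "u \<inter> S = E - {x}" unfolding shatters_def by meson
          moreover from this obtain t where "t \<in> F" "x \<in> t" "u = t - {x}" unfolding F1_def by blast
          ultimately show ?thesis using that by blast
        qed
        then show ?thesis using xS True by (intro bexI[of _ t]) auto
      next
        case False
        then have "E \<subseteq> S" using E by auto
        moreover have "shatters F0 S" using S(1) by (simp add: A_def)
        ultimately obtain t where "t \<in> F0" "t \<inter> S = E" unfolding shatters_def by meson
        then show ?thesis using False by (intro bexI[of _ t]) (auto simp: F0_def)
      qed
    qed
    show "(A F0 \<union> A F1) \<union> insert x ` (A F0 \<inter> A F1) \<subseteq> {S. S \<subseteq> insert x V \<and> shatters F S}"
      using up both by (auto simp: A_def)
  qed
  finally show ?case .
qed

text \<open>A set of fewer than d elements is coded as a word of length d over V with one padding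
  letter \<open>None\<close>; this gives a polynomial bound without binomial sums.\<close>

lemma card_small_subsets_le:
  assumes V: "finite V"
  shows "card {S. S \<subseteq> V \<and> card S < d} \<le> (card V + 1) ^ d"
proof -
  let ?A = "insert None (Some ` V)"
  let ?g = "\<lambda>xs. {x. Some x \<in> set xs}"
  have "{S. S \<subseteq> V \<and> card S < d} \<subseteq> ?g ` {xs. set xs \<subseteq> ?A \<and> length xs = d}"
  proof
    fix S assume "S \<in> {S. S \<subseteq> V \<and> card S < d}"
    then have S: "S \<subseteq> V" "card S < d" "finite S" using V finite_subset by auto
    obtain ys where "set ys = S" "distinct ys" using finite_distinct_list[OF S(3)] by blast
    then have ys: "set ys = S" "length ys = card S" using distinct_card[of ys] by auto
    let ?xs = "map Some ys @ replicate (d - card S) None"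
    have "S = ?g ?xs" using ys by auto
    moreover have "?xs \<in> {xs. set xs \<subseteq> ?A \<and> length xs = d}" using ys S by auto
    ultimately show "S \<in> ?g ` {xs. set xs \<subseteq> ?A \<and> length xs = d}" by (rule image_eqI)
  qed
  then have "card {S. S \<subseteq> V \<and> card S < d} \<le> card {xs. set xs \<subseteq> ?A \<and> length xs = d}"
    using V by (intro surj_card_le finite_lists_length_eq) auto
  also have "\<dots> = (card V + 1) ^ d"
    using V by (subst card_lists_length_eq) (auto simp: card_image)
  finally show ?thesis .
qed

text \<open>By Sauer-Shelah it suffices that a shattered set S of indices has fewer than d elements.
  Otherwise d of its indices pick out points \<open>c (s i)\<close> that realize every pattern,
  because every subset of the smaller index set is a subset of S too.\<close>

lemma card_traces_le:
  assumes nosh: "\<And>a. (\<forall>i<d. a i \<in> X) \<Longrightarrow> \<not> shattered H Y d a"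
    and c: "\<And>i. i < N \<Longrightarrow> c i \<in> X"
  shows "card ((\<lambda>b. {i. i < N \<and> H (c i) b}) ` Y) \<le> (N + 1) ^ d"
proof -
  let ?F = "(\<lambda>b. {i. i < N \<and> H (c i) b}) ` Y"
  have "card ?F \<le> card {S. S \<subseteq> {..<N} \<and> shatters ?F S}"
    by (rule card_le_card_shattered) auto
  also have "\<dots> \<le> card {S. S \<subseteq> {..<N} \<and> card S < d}"
  proof (rule card_mono)
    have "card S < d" if S: "S \<subseteq> {..<N}" "shatters ?F S" for S
    proof (rule ccontr)
      assume "\<not> card S < d"
      then obtain S' where S': "S' \<subseteq> S" "card S' = d" by (meson not_less obtain_subset_with_card_n)
      have finS': "finite S'" using finite_subset[OF order_trans[OF S'(1) S(1)]] by simp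
      obtain s where s: "bij_betw s {..<d} S'"
        using ex_bij_betw_nat_finite[OF finS'] unfolding S'(2) atLeast0LessThan by blast
      have sS: "s i \<in> S'" "s i < N" if "i < d" for i
        using s that S S' by (auto simp: bij_betw_def)
      have "shattered H Y d (\<lambda>i. c (s i))"
        unfolding shattered_def
      proof (intro allI impI)
        fix E assume E: "E \<subseteq> {..<d}"
        have "s ` E \<subseteq> S" using E sS S' by auto
        then have "\<exists>u\<in>?F. u \<inter> S = s ` E" using S(2) unfolding shatters_def by meson
        then obtain b where b: "b \<in> Y" "{i. i < N \<and> H (c i) b} \<inter> S = s ` E" by auto
        have "H (c (s i)) b \<longleftrightarrow> i \<in> E" if i: "i < d" for i
        proof -
          have "H (c (s i)) b \<longleftrightarrow> s i \<in> {i. i < N \<and> H (c i) b} \<inter> S"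
            using sS[OF i] S' by auto
          also have "\<dots> \<longleftrightarrow> s i \<in> s ` E" by (simp only: b)
          also have "\<dots> \<longleftrightarrow> i \<in> E"
            using s E i unfolding bij_betw_def by (intro inj_on_image_mem_iff[of s "{..<d}"]) auto
          finally show ?thesis .
        qed
        then show "\<exists>b\<in>Y. \<forall>i<d. H (c (s i)) b \<longleftrightarrow> i \<in> E" using b by blast
      qed
      then show False using nosh[of "\<lambda>i. c (s i)"] c sS by auto
    qed
    then show "{S. S \<subseteq> {..<N} \<and> shatters ?F S} \<subseteq> {S. S \<subseteq> {..<N} \<and> card S < d}" by blast
  qed auto
  also have "\<dots> \<le> (N + 1) ^ d" using card_small_subsets_le[of "{..<N}" d] by simp
  finally show ?thesis .
qed

section \<open>Exponential moments of random signs\<close>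

text \<open>A weak form of cosh y \<le> exp (y^2 / 2), by quadratic bounds for both exponentials.
  The one for exp (- y) comes from exp (- y) \<le> 1 / (1 + y) and (1 - y + y^2) (1 + y) = 1 +
  y^3.\<close>

lemma exp_add_exp_minus_le:
  fixes y :: real
  assumes "0 \<le> y" "y \<le> 1"
  shows "exp y + exp (- y) \<le> 2 * exp (y\<^sup>2)"
proof -
  have "exp (- y) \<le> 1 - y + y\<^sup>2"
  proof -
    have "exp (- y) \<le> 1 / (1 + y)"
      using exp_ge_add_one_self[of y] assms by (simp add: exp_minus divide_simps)
    also have "\<dots> \<le> 1 - y + y\<^sup>2"
    proof -
      have "(1 - y + y\<^sup>2) * (1 + y) = 1 + y ^ 3" by (simp add: power2_eq_square power3_eq_cube algebra_simps)
      then have "1 \<le> (1 - y + y\<^sup>2) * (1 + y)" using assms by simp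
      then show ?thesis using assms by (simp add: divide_le_eq)
    qed
    finally show ?thesis .
  qed
  moreover have "exp y \<le> 1 + y + y\<^sup>2" by (rule exp_bound[OF assms])
  moreover have "1 + y\<^sup>2 \<le> exp (y\<^sup>2)" by (rule exp_ge_add_one_self)
  ultimately show ?thesis by linarith
qed

text \<open>Rademacher signs: a subset E of {..<N} is a point of the sign cube, and expectations
  appear as sums over \<open>Pow {..<N}\<close>. The same E is the pattern that a witness has to
  realize.\<close>

definition sgn_of :: "nat set \<Rightarrow> nat \<Rightarrow> real" where
  "sgn_of E i = (if i \<in> E then 1 else - 1)"

text \<open>The moment generating function of a Rademacher sum factors over the coordinates: the
  factor is 2 cosh s at coordinates in t and 2 elsewhere.\<close>

lemma sum_exp_signs_le:
  fixes s :: real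
  assumes s: "0 \<le> s" "s \<le> 1"
  shows "(\<Sum>E\<in>Pow {..<N}. exp (s * (\<Sum>i<N. sgn_of E i * of_bool (i \<in> t)))) \<le> 2 ^ N * exp (s\<^sup>2 * N)"
proof -
  let ?x = "\<lambda>i. s * of_bool (i \<in> t)"
  have "exp (s * (\<Sum>i<N. sgn_of E i * of_bool (i \<in> t)))
      = (\<Prod>i\<in>E. exp (?x i)) * (\<Prod>i\<in>{..<N} - E. exp (- ?x i))" if E: "E \<in> Pow {..<N}" for E
  proof -
    have "exp (s * (\<Sum>i<N. sgn_of E i * of_bool (i \<in> t))) = (\<Prod>i<N. exp (sgn_of E i * ?x i))"
      by (simp only: sum_distrib_left exp_sum finite_lessThan mult.left_commute)
    also have "\<dots> = (\<Prod>i\<in>{..<N} - E. exp (sgn_of E i * ?x i)) * (\<Prod>i\<in>E. exp (sgn_of E i * ?x i))"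
      using E by (intro prod.subset_diff) auto
    also have "(\<Prod>i\<in>E. exp (sgn_of E i * ?x i)) = (\<Prod>i\<in>E. exp (?x i))"
      by (intro prod.cong) (auto simp: sgn_of_def)
    also have "(\<Prod>i\<in>{..<N} - E. exp (sgn_of E i * ?x i)) = (\<Prod>i\<in>{..<N} - E. exp (- ?x i))"
      by (intro prod.cong) (auto simp: sgn_of_def)
    finally show ?thesis by (simp only: mult.commute)
  qed
  then have "(\<Sum>E\<in>Pow {..<N}. exp (s * (\<Sum>i<N. sgn_of E i * of_bool (i \<in> t))))
     = (\<Sum>E\<in>Pow {..<N}. (\<Prod>i\<in>E. exp (?x i)) * (\<Prod>i\<in>{..<N} - E. exp (- ?x i)))"
    by (intro sum.cong refl)
  \<comment> \<open>Expanding the product gives one summand for each set E of coordinates with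
    positive sign.\<close>
  also have "\<dots> = (\<Prod>i<N. exp (?x i) + exp (- ?x i))" by (rule prod_add[symmetric]) simp
  also have "\<dots> \<le> (\<Prod>i<N. 2 * exp (s\<^sup>2))"
  proof (rule prod_mono)
    fix i
    have "1 \<le> exp (s\<^sup>2)" by simp
    then have "exp (?x i) + exp (- ?x i) \<le> 2 * exp (s\<^sup>2)"
      using exp_add_exp_minus_le[OF s] by (cases "i \<in> t") auto
    then show "0 \<le> exp (?x i) + exp (- ?x i) \<and> exp (?x i) + exp (- ?x i) \<le> 2 * exp (s\<^sup>2)"
      by (simp add: add_nonneg_nonneg)
  qed
  also have "\<dots> = 2 ^ N * exp (s\<^sup>2 * N)" by (simp add: power_mult_distrib exp_of_nat2_mult)
  finally show ?thesis .
qed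

text \<open>Massart's finite class lemma, read backwards: a large correlation with random signs forces
  many traces.\<close>

lemma exp_le_card_traces:
  fixes \<gamma> :: real
  assumes fin: "finite F" and t: "\<And>E. E \<subseteq> {..<N} \<Longrightarrow> t E \<in> F"
    and \<gamma>: "0 < \<gamma>" "\<gamma> \<le> 1"
    and corr: "2 ^ N * (N * \<gamma> / 2) \<le> (\<Sum>E\<in>Pow {..<N}. \<Sum>i<N. sgn_of E i * of_bool (i \<in> t E))"
  shows "exp (N * \<gamma>\<^sup>2 / 16) \<le> card F"
proof -
  \<comment> \<open>This s minimizes s^2 N - s N \<gamma> / 2, with minimum - N \<gamma>^2 / 16; m
    is the assumed lower bound for the mean correlation.\<close>
  define s where "s = \<gamma> / 4"
  define m where "m = N * \<gamma> / 2"
  define Z where "Z E u = (\<Sum>i<N. sgn_of E i * of_bool (i \<in> u))" for E u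
  have s: "0 \<le> s" "s \<le> 1" using \<gamma> by (auto simp: s_def)
  have cP: "card (Pow {..<N}) = 2 ^ N" by (simp add: card_Pow)
  have "(\<Sum>E\<in>Pow {..<N}. 1 - s * m) = 2 ^ N * (1 - s * m)" by (simp only: sum_constant cP) simp
  then have "2 ^ N = (\<Sum>E\<in>Pow {..<N}. 1 - s * m) + s * (2 ^ N * m)" by (simp only: algebra_simps)
  also have "\<dots> \<le> (\<Sum>E\<in>Pow {..<N}. 1 - s * m) + s * (\<Sum>E\<in>Pow {..<N}. Z E (t E))"
    using corr s by (intro add_left_mono mult_left_mono) (auto simp: m_def Z_def)
  also have "\<dots> = (\<Sum>E\<in>Pow {..<N}. 1 + (s * Z E (t E) - s * m))"
    by (simp add: sum.distrib sum_distrib_left sum_subtractf right_diff_distrib)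
  \<comment> \<open>The bound 1 + x \<le> exp x, centred at m, takes the place of Jensen's
    inequality.\<close>
  also have "\<dots> \<le> (\<Sum>E\<in>Pow {..<N}. exp (s * Z E (t E) - s * m))"
    by (intro sum_mono exp_ge_add_one_self)
  \<comment> \<open>A union bound: summing over all u in F removes the dependence of the trace on
    the signs, so each u can be treated by the moment bound.\<close>
  also have "\<dots> \<le> (\<Sum>E\<in>Pow {..<N}. \<Sum>u\<in>F. exp (s * Z E u - s * m))"
    using t fin by (intro sum_mono member_le_sum) auto
  also have "\<dots> = exp (- s * m) * (\<Sum>u\<in>F. \<Sum>E\<in>Pow {..<N}. exp (s * Z E u))"
    by (subst sum.swap) (simp add: sum_distrib_left mult_exp_exp)
  also have "\<dots> \<le> exp (- s * m) * (\<Sum>u\<in>F. 2 ^ N * exp (s\<^sup>2 * N))"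
    unfolding Z_def using sum_exp_signs_le[OF s] by (intro mult_left_mono sum_mono) auto
  also have "\<dots> = 2 ^ N * (card F * exp (s\<^sup>2 * N - s * m))"
    by (simp add: mult_exp_exp algebra_simps exp_diff exp_minus divide_simps)
  also have "s\<^sup>2 * N - s * m = - (N * \<gamma>\<^sup>2 / 16)"
    by (simp add: s_def m_def power2_eq_square field_simps)
  finally have "1 \<le> card F * exp (- (N * \<gamma>\<^sup>2 / 16))" by simp
  then show ?thesis by (simp add: exp_minus divide_simps)
qed

section \<open>From shattered points to independent averages\<close>

text \<open>Lists allow repetition and hence arbitrary rational weights. The empty list has average
  0 because x / 0 = 0, so the bounds below hold for every list.\<close>

definition avg :: "('x \<Rightarrow> bool) \<Rightarrow> 'x list \<Rightarrow> real" where
  "avg P l = (\<Sum>a\<leftarrow>l. of_bool (P a)) / length l"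

lemma avg_nonneg: "0 \<le> avg P l"
  unfolding avg_def by (intro divide_nonneg_nonneg sum_list_nonneg) auto

lemma avg_le_1: "avg P l \<le> 1"
proof -
  have "(\<Sum>a\<leftarrow>l. of_bool (P a) :: real) \<le> (\<Sum>a\<leftarrow>l. 1)" by (intro sum_list_mono) auto
  then show ?thesis by (simp add: avg_def sum_list_triv divide_le_eq_1)
qed

text \<open>The mean over l of the right-hand sides is the left-hand side, so some entry reaches it.
  This replaces an average by a single point without loss of correlation with the weights.\<close>

lemma exists_ge_avg_sum:
  fixes w :: "'e \<Rightarrow> real"
  assumes "l \<noteq> []"
  shows "\<exists>x\<in>set l. (\<Sum>e\<in>A. w e * avg (P e) l) \<le> (\<Sum>e\<in>A. w e * of_bool (P e x))"
proof (rule ccontr)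
  let ?g = "\<lambda>x. \<Sum>e\<in>A. w e * of_bool (P e x)"
  let ?m = "\<Sum>e\<in>A. w e * avg (P e) l"
  assume "\<not> ?thesis"
  then have lt: "\<And>x. x \<in> set l \<Longrightarrow> ?g x < ?m" by force
  have swap: "(\<Sum>x\<leftarrow>l. ?g x) = (\<Sum>e\<in>A. w e * (\<Sum>x\<leftarrow>l. of_bool (P e x)))"
    by (induction l) (simp_all add: sum.distrib distrib_left)
  have "(\<Sum>x\<leftarrow>l. ?g x) < (\<Sum>x\<leftarrow>l. ?m)"
    using assms lt by (intro sum_list_strict_mono) auto
  also have "\<dots> = length l * ?m" by (simp add: sum_list_triv)
  also have "\<dots> = (\<Sum>x\<leftarrow>l. ?g x)"
    using assms unfolding swap by (simp add: avg_def sum_distrib_left)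
  finally show False by simp
qed

text \<open>Averages are not two-valued; a gap between two levels stands in for truth and
  falsity.\<close>

definition indep_averages :: "('x \<Rightarrow> 'y \<Rightarrow> bool) \<Rightarrow> 'y set \<Rightarrow> nat \<Rightarrow> real \<Rightarrow> real \<Rightarrow> (nat \<Rightarrow> 'x list) \<Rightarrow> bool" where
  "indep_averages H Y N \<alpha> \<beta> l \<longleftrightarrow> (\<forall>E\<subseteq>{..<N}. \<exists>b\<in>Y. \<forall>i<N.
     if i \<in> E then \<beta> < avg (\<lambda>a. H a b) (l i) else avg (\<lambda>a. H a b) (l i) < \<alpha>)"

text \<open>Each average is replaced by one of its points \<open>c i\<close> that correlates with
  the signs at least as well. The trace of c at the witness of E then correlates with E, which
  forces exponentially many traces, while the absence of shattered d-tuples leaves at most (N +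
  1)^d.\<close>

lemma exp_le_if_indep_averages:
  assumes nosh: "\<And>a. (\<forall>i<d. a i \<in> X) \<Longrightarrow> \<not> shattered H Y d a"
    and ab: "\<alpha> < \<beta>" "\<beta> \<le> \<alpha> + 1"
    and l: "\<And>i. i < N \<Longrightarrow> l i \<noteq> [] \<and> set (l i) \<subseteq> X"
    and indep: "indep_averages H Y N \<alpha> \<beta> l"
  shows "exp (N * (\<beta> - \<alpha>)\<^sup>2 / 16) \<le> (real N + 1) ^ d"
proof -
  obtain b where b: "\<And>E. E \<subseteq> {..<N} \<Longrightarrow> b E \<in> Y"
    "\<And>E i. E \<subseteq> {..<N} \<Longrightarrow> i < N \<Longrightarrow>
      (if i \<in> E then \<beta> < avg (\<lambda>a. H a (b E)) (l i) else avg (\<lambda>a. H a (b E)) (l i) < \<alpha>)"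
    using indep unfolding indep_averages_def by metis
  let ?P = "Pow {..<N}"
  have "\<forall>i\<in>{..<N}. \<exists>x. x \<in> set (l i) \<and>
      (\<Sum>E\<in>?P. sgn_of E i * avg (\<lambda>a. H a (b E)) (l i)) \<le> (\<Sum>E\<in>?P. sgn_of E i * of_bool (H x (b E)))"
  proof
    fix i assume "i \<in> {..<N}"
    then have "l i \<noteq> []" using l by blast
    from exists_ge_avg_sum[OF this, where A = ?P and w = "\<lambda>E. sgn_of E i" and P = "\<lambda>E a. H a (b E)"]
    show "\<exists>x. x \<in> set (l i) \<and>
      (\<Sum>E\<in>?P. sgn_of E i * avg (\<lambda>a. H a (b E)) (l i)) \<le> (\<Sum>E\<in>?P. sgn_of E i * of_bool (H x (b E)))"
      by (simp only: Bex_def)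
  qed
  from bchoice[OF this] obtain c where c: "\<And>i. i < N \<Longrightarrow> c i \<in> set (l i)"
    "\<And>i. i < N \<Longrightarrow> (\<Sum>E\<in>?P. sgn_of E i * avg (\<lambda>a. H a (b E)) (l i))
       \<le> (\<Sum>E\<in>?P. sgn_of E i * of_bool (H (c i) (b E)))" by (auto simp only: lessThan_iff)
  define t where "t E = {i. i < N \<and> H (c i) (b E)}" for E
  let ?F = "(\<lambda>b. {i. i < N \<and> H (c i) b}) ` Y"
  have cX: "c i \<in> X" if "i < N" for i using c(1) l that by blast
  have half: "2 ^ N * ((\<beta> - \<alpha>) / 2) \<le> (\<Sum>E\<in>?P. sgn_of E i * avg (\<lambda>a. H a (b E)) (l i))" if i: "i < N" for i
  proof -
    \<comment> \<open>The levels are written as midpoint plus or minus half the gap. The midpoint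
      drops out because the i-th signs sum to zero; half the gap remains.\<close>
    have "(\<Sum>E\<in>?P. sgn_of E i * ((\<beta> - \<alpha>) / 2 * sgn_of E i + (\<alpha> + \<beta>) / 2))
        \<le> (\<Sum>E\<in>?P. sgn_of E i * avg (\<lambda>a. H a (b E)) (l i))"
    proof (rule sum_mono)
      fix E assume "E \<in> ?P"
      then show "sgn_of E i * ((\<beta> - \<alpha>) / 2 * sgn_of E i + (\<alpha> + \<beta>) / 2) \<le> sgn_of E i * avg (\<lambda>a. H a (b E)) (l i)"
        using b(2)[of E i] i by (auto simp: sgn_of_def field_simps split: if_splits)
    qed
    also have "(\<Sum>E\<in>?P. sgn_of E i * ((\<beta> - \<alpha>) / 2 * sgn_of E i + (\<alpha> + \<beta>) / 2))
        = (\<Sum>E\<in>?P. (\<beta> - \<alpha>) / 2) + (\<Sum>E\<in>?P. sgn_of E i) * ((\<alpha> + \<beta>) / 2)"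
      unfolding sum_distrib_right sum.distrib[symmetric]
      by (intro sum.cong) (auto simp: sgn_of_def field_simps)
    also have "(\<Sum>E\<in>?P. sgn_of E i) = 0"
    proof -
      \<comment> \<open>Toggling i is an involution of the sign cube that reverses the i-th
        sign.\<close>
      let ?c = "\<lambda>E. if i \<in> E then E - {i} else insert i E"
      have "(\<Sum>E\<in>?P. sgn_of E i) = (\<Sum>E\<in>?P. sgn_of (?c E) i)"
        using i by (intro sum.reindex_bij_witness[of _ ?c ?c]) (auto simp: sgn_of_def)
      also have "\<dots> = - (\<Sum>E\<in>?P. sgn_of E i)"
        unfolding sum_negf[symmetric] by (intro sum.cong) (auto simp: sgn_of_def)
      finally show ?thesis by simp
    qed
    finally show ?thesis by (simp add: card_Pow)
  qed
  have "exp (N * (\<beta> - \<alpha>)\<^sup>2 / 16) \<le> card ?F"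
  proof (rule exp_le_card_traces)
    show "finite ?F" by (rule finite_subset[of _ "Pow {..<N}"]) auto
    show "t E \<in> ?F" if "E \<subseteq> {..<N}" for E using b(1) that by (auto simp: t_def)
    show "0 < \<beta> - \<alpha>" "\<beta> - \<alpha> \<le> 1" using ab by auto
    have "2 ^ N * (N * (\<beta> - \<alpha>) / 2) = (\<Sum>i<N. 2 ^ N * ((\<beta> - \<alpha>) / 2))" by simp
    also have "\<dots> \<le> (\<Sum>i<N. \<Sum>E\<in>?P. sgn_of E i * of_bool (H (c i) (b E)))"
      using half c(2) by (intro sum_mono) (meson lessThan_iff order_trans)
    also have "\<dots> = (\<Sum>E\<in>?P. \<Sum>i<N. sgn_of E i * of_bool (i \<in> t E))"
      by (subst sum.swap) (intro sum.cong, auto simp: t_def)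
    finally show "2 ^ N * (N * (\<beta> - \<alpha>) / 2) \<le> (\<Sum>E\<in>?P. \<Sum>i<N. sgn_of E i * of_bool (i \<in> t E))" .
  qed
  also have "real (card ?F) \<le> real ((N + 1) ^ d)"
    using card_traces_le[OF nosh cX] by (simp only: of_nat_le_iff)
  finally show ?thesis by (simp add: add.commute)
qed

text \<open>Independent averages of every length N would give exp (c N) \<le> (N + 1)^d for all N,
  but an exponential outgrows a polynomial.\<close>

theorem bounded_indep_averages:
  assumes nosh: "\<And>a. (\<forall>i<d. a i \<in> X) \<Longrightarrow> \<not> shattered H Y d a"
    and ab: "\<alpha> < \<beta>" "\<beta> \<le> \<alpha> + 1"
  shows "\<exists>N. \<forall>l. (\<forall>i<N. l i \<noteq> [] \<and> set (l i) \<subseteq> X) \<longrightarrow> \<not> indep_averages H Y N \<alpha> \<beta> l"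
proof (rule ccontr)
  assume contra: "\<not> ?thesis"
  define c where "c = (\<beta> - \<alpha>)\<^sup>2 / 16"
  have c: "0 < c" using ab by (auto simp: c_def)
  have le: "exp (c * N) \<le> (real N + 1) ^ d" for N
  proof -
    obtain l where "\<And>i. i < N \<Longrightarrow> l i \<noteq> [] \<and> set (l i) \<subseteq> X" "indep_averages H Y N \<alpha> \<beta> l"
      using contra by blast
    from exp_le_if_indep_averages[OF nosh ab this] show ?thesis
      by (simp add: c_def mult.commute)
  qed
  have "((\<lambda>x. x ^ d / exp x) \<longlongrightarrow> (0::real)) at_top" by (rule tendsto_power_div_exp_0)
  \<comment> \<open>Along c (1 + N) the power becomes c^d (1 + N)^d, so the constant c^d / exp c
    cancels against the threshold chosen below.\<close>
  moreover have "filterlim (\<lambda>N. c * (1 + real N)) at_top sequentially"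
    by (rule filterlim_tendsto_pos_mult_at_top[OF tendsto_const c
        filterlim_tendsto_add_at_top[OF tendsto_const filterlim_real_sequentially]])
  ultimately have "((\<lambda>N. (c * (1 + real N)) ^ d / exp (c * (1 + real N))) \<longlongrightarrow> 0) sequentially"
    by (rule filterlim_compose)
  moreover have "0 < c ^ d / exp c" using c by simp
  ultimately have "\<forall>\<^sub>F N in sequentially. (c * (1 + real N)) ^ d / exp (c * (1 + real N)) < c ^ d / exp c"
    by (rule order_tendstoD)
  then obtain N where "(c * (1 + real N)) ^ d / exp (c * (1 + real N)) < c ^ d / exp c"
    by (auto simp: eventually_sequentially)
  also have "(c * (1 + real N)) ^ d / exp (c * (1 + real N)) = c ^ d / exp c * ((1 + real N) ^ d / exp (c * N))"
  proof -
    have "exp (c * (1 + real N)) = exp c * exp (c * N)" by (simp add: distrib_left exp_add)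
    then show ?thesis by (simp only: power_mult_distrib times_divide_times_eq)
  qed
  finally have "(1 + real N) ^ d / exp (c * N) < 1"
    using c by (simp add: divide_simps mult_less_cancel_left_pos)
  then show False using le[of N] by (simp add: divide_less_eq add.commute)
qed

section \<open>Uniform approximation along an ultrafilter\<close>

definition ultrafilter :: "'i filter \<Rightarrow> bool" where
  "ultrafilter F \<longleftrightarrow> F \<noteq> bot \<and> (\<forall>P. eventually P F \<or> eventually (\<lambda>x. \<not> P x) F)"

text \<open>Zorn's lemma in the reversed order: a minimal filter among those below F and different
  from \<open>bot\<close> is an ultrafilter. A chain is bounded by its infimum, which is not
  \<open>bot\<close> because a finite part of a chain has a least member.\<close>

lemma exists_ultrafilter_le:
  fixes F :: "'i filter"
  assumes "F \<noteq> bot"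
  shows "\<exists>U\<le>F. ultrafilter U"
proof -
  have nonbot_mono: "H \<noteq> bot" if "G \<le> H" "G \<noteq> bot" for G H :: "'i filter"
    using that by (auto simp: bot_unique)
  let ?A = "{G. G \<noteq> bot \<and> G \<le> F}" and ?P = "\<lambda>G H. H \<le> G"
  have "\<exists>m\<in>?A. \<forall>a\<in>?A. ?P m a \<longrightarrow> a = m"
  proof (rule predicate_Zorn)
    show "partial_order_on ?A (relation_of ?P ?A)"
      by (intro partial_order_on_relation_ofI) auto
    fix C assume C: "C \<in> Chains (relation_of ?P ?A)"
    then have CA: "C \<subseteq> ?A" and tot: "\<And>x y. x \<in> C \<Longrightarrow> y \<in> C \<Longrightarrow> x \<le> y \<or> y \<le> x"
      by (auto simp: Chains_def relation_of_def)
    show "\<exists>u\<in>?A. \<forall>a\<in>C. u \<le> a"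
    proof (cases "C = {}")
      case True
      then show ?thesis using assms by auto
    next
      case False
      have "Inf C \<noteq> bot"
      proof (rule Inf_filter_not_bot)
        fix X assume "X \<subseteq> C" "finite X"
        show "Inf X \<noteq> bot"
        proof (cases "X = {}")
          case True
          then have "F \<le> Inf X" by simp
          then show ?thesis using assms by (rule nonbot_mono)
        next
          case False
          have "\<exists>x\<in>X. \<forall>y\<in>X. x \<le> y"
            using \<open>finite X\<close> False \<open>X \<subseteq> C\<close>
          proof (induction X rule: finite_ne_induct)
            case (insert z X)
            then obtain x where x: "x \<in> X" "\<forall>y\<in>X. x \<le> y" by auto
            then have "x \<le> z \<or> z \<le> x" using insert.prems tot by blast
            then show ?case
            proof
              assume "x \<le> z"
              then show ?thesis using x by (intro bexI[of _ x]) auto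
            next
              assume "z \<le> x"
              then show ?thesis using x by (intro bexI[of _ z]) (auto intro: order_trans)
            qed
          qed auto
          then obtain x where x: "x \<in> X" "\<forall>y\<in>X. x \<le> y" by blast
          then have "x \<le> Inf X" by (simp add: le_Inf_iff)
          moreover have "x \<noteq> bot" using x(1) \<open>X \<subseteq> C\<close> CA by blast
          ultimately show ?thesis by (rule nonbot_mono)
        qed
      qed
      moreover obtain c where "c \<in> C" using False by blast
      moreover have "Inf C \<le> F"
        using Inf_lower[OF \<open>c \<in> C\<close>] CA \<open>c \<in> C\<close> by (auto intro: order_trans)
      ultimately show ?thesis by (intro bexI[of _ "Inf C"]) (auto intro: Inf_lower)
    qed
  qed
  then obtain m where m: "m \<noteq> bot" "m \<le> F" "\<And>a. a \<noteq> bot \<Longrightarrow> a \<le> m \<Longrightarrow> a = m"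
    by (auto intro: order_trans)
  have "eventually (\<lambda>x. \<not> P x) m" if P: "\<not> eventually P m" for P
  proof -
    \<comment> \<open>If P does not hold eventually, restricting m to the complement of P leaves a
      proper filter; by minimality the restriction is m itself.\<close>
    have "inf m (principal {x. \<not> P x}) \<noteq> bot"
      using P by (auto simp: trivial_limit_def eventually_inf_principal)
    then have "inf m (principal {x. \<not> P x}) = m" by (intro m(3)) auto
    then have "m \<le> principal {x. \<not> P x}" by (metis inf.cobounded2)
    then show ?thesis by (simp add: le_principal)
  qed
  then show ?thesis using m(1,2) unfolding ultrafilter_def by blast
qed

text \<open>Pigeonhole: when the valid alternative depends on the index, one fixed alternative is
  still valid for almost all indices.\<close>

lemma ultrafilter_finite_disj:
  assumes "ultrafilter U" "finite A" "eventually (\<lambda>x. \<exists>a\<in>A. Q a x) U"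
  shows "\<exists>a\<in>A. eventually (Q a) U"
proof (rule ccontr)
  assume "\<not> ?thesis"
  have "\<forall>a\<in>A. eventually (\<lambda>x. \<not> Q a x) U"
  proof
    fix a assume "a \<in> A"
    then have "\<not> eventually (Q a) U" using \<open>\<not> (\<exists>a\<in>A. eventually (Q a) U)\<close> by blast
    moreover have "eventually (Q a) U \<or> eventually (\<lambda>x. \<not> Q a x) U"
      using assms(1) unfolding ultrafilter_def by (elim conjE spec)
    ultimately show "eventually (\<lambda>x. \<not> Q a x) U" by simp
  qed
  then have "eventually (\<lambda>x. \<forall>a\<in>A. \<not> Q a x) U" using assms(2) by (simp add: eventually_ball_finite)
  with assms(3) have "eventually (\<lambda>x. False) U" by eventually_elim auto
  then show False using assms(1) by (simp add: ultrafilter_def trivial_limit_def)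
qed

section \<open>Dichotomies on relatively open cells\<close>

text \<open>The analogue of \<open>indep_averages\<close> for real functions, free of logic, so that
  the point set can be cut down to parts of a topological space.\<close>

definition indep_levels :: "('i \<Rightarrow> 'p \<Rightarrow> real) \<Rightarrow> 'p set \<Rightarrow> nat \<Rightarrow> real \<Rightarrow> real \<Rightarrow> (nat \<Rightarrow> 'i) \<Rightarrow> bool" where
  "indep_levels \<psi> S N \<alpha> \<beta> i \<longleftrightarrow>
     (\<forall>E\<subseteq>{..<N}. \<exists>p\<in>S. \<forall>j<N. if j \<in> E then \<beta> < \<psi> (i j) p else \<psi> (i j) p < \<alpha>)"

lemma openin_Collect_ball_lessThan:
  assumes "\<And>j. j < (n::nat) \<Longrightarrow> openin X {p\<in>topspace X. P j p}"
  shows "openin X {p\<in>topspace X. \<forall>j<n. P j p}"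
  using assms
proof (induction n)
  case (Suc n)
  have "{p\<in>topspace X. \<forall>j<Suc n. P j p} = {p\<in>topspace X. \<forall>j<n. P j p} \<inter> {p\<in>topspace X. P n p}"
    by (auto simp: less_Suc_eq)
  then show ?case using Suc by (auto intro: openin_Int)
qed simp

text \<open>If no finite family of cells worked, one could keep splitting every cell by a further
  \<open>\<psi> i\<close> and reach arbitrarily long independent sequences.\<close>

lemma homogeneous_cells:
  fixes \<psi> :: "'i \<Rightarrow> 'p \<Rightarrow> real"
  assumes op: "\<And>i r. i \<in> I \<Longrightarrow> openin X {p\<in>topspace X. r < \<psi> i p}"
      "\<And>i r. i \<in> I \<Longrightarrow> openin X {p\<in>topspace X. \<psi> i p < r}"
    and K: "K \<subseteq> topspace X" "K \<noteq> {}"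
    and no: "\<And>i. (\<forall>j<N. i j \<in> I) \<Longrightarrow> \<not> indep_levels \<psi> (K \<inter> R) N \<alpha> \<beta> i"
  shows "\<exists>\<C>. finite \<C> \<and> (\<forall>G\<in>\<C>. openin X G \<and> G \<inter> K \<noteq> {}) \<and>
     (\<forall>i\<in>I. \<exists>G\<in>\<C>. (\<forall>p\<in>G \<inter> K \<inter> R. \<alpha> \<le> \<psi> i p) \<or> (\<forall>p\<in>G \<inter> K \<inter> R. \<psi> i p \<le> \<beta>))"
proof (rule ccontr)
  assume contra: "\<not> ?thesis"
  have split: "\<exists>i\<in>I. \<forall>G\<in>\<C>. (\<exists>p\<in>G \<inter> K \<inter> R. \<psi> i p < \<alpha>) \<and> (\<exists>p\<in>G \<inter> K \<inter> R. \<beta> < \<psi> i p)"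
    if "finite \<C>" "\<And>G. G \<in> \<C> \<Longrightarrow> openin X G \<and> G \<inter> K \<noteq> {}" for \<C>
  proof (rule ccontr)
    assume "\<not> ?thesis"
    then have "\<forall>i\<in>I. \<exists>G\<in>\<C>. (\<forall>p\<in>G \<inter> K \<inter> R. \<alpha> \<le> \<psi> i p) \<or> (\<forall>p\<in>G \<inter> K \<inter> R. \<psi> i p \<le> \<beta>)"
      by (meson not_less)
    then show False using contra that by blast
  qed
  have "\<exists>i. (\<forall>j<n. i j \<in> I) \<and> indep_levels \<psi> (K \<inter> R) n \<alpha> \<beta> i" for n
  proof (induction n)
    case 0
    have "topspace X \<inter> K \<noteq> {}" using K by blast
    \<comment> \<open>Splitting the whole space is used here only to find a point of K \<inter>
      R.\<close>
    then have "\<exists>i\<in>I. \<forall>G\<in>{topspace X}. (\<exists>p\<in>G \<inter> K \<inter> R. \<psi> i p < \<alpha>) \<and> (\<exists>p\<in>G \<inter> K \<inter> R. \<beta> < \<psi> i p)"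
      by (intro split) auto
    then have "\<exists>p. p \<in> K \<inter> R" by blast
    then show ?case by (auto simp: indep_levels_def)
  next
    case (Suc n)
    then obtain i where i: "\<And>j. j < n \<Longrightarrow> i j \<in> I" "indep_levels \<psi> (K \<inter> R) n \<alpha> \<beta> i" by blast
    \<comment> \<open>All 2^n cells are open and, by independence of \<open>i\<close>, meet K; the
      index k that splits all of them at once extends the sequence.\<close>
    let ?cell = "\<lambda>E. {p\<in>topspace X. \<forall>j<n. if j \<in> E then \<beta> < \<psi> (i j) p else \<psi> (i j) p < \<alpha>}"
    have "\<exists>k\<in>I. \<forall>G\<in>?cell ` Pow {..<n}.
      (\<exists>p\<in>G \<inter> K \<inter> R. \<psi> k p < \<alpha>) \<and> (\<exists>p\<in>G \<inter> K \<inter> R. \<beta> < \<psi> k p)"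
    proof (rule split)
      fix G assume "G \<in> ?cell ` Pow {..<n}"
      then obtain E where E: "E \<subseteq> {..<n}" "G = ?cell E" by blast
      have "openin X G"
        unfolding E
      proof (rule openin_Collect_ball_lessThan)
        show "openin X {p\<in>topspace X. if j \<in> E then \<beta> < \<psi> (i j) p else \<psi> (i j) p < \<alpha>}" if "j < n" for j
          using op[OF i(1)[OF that]] by (cases "j \<in> E") simp_all
      qed
      moreover obtain p where "p \<in> K \<inter> R" "\<forall>j<n. if j \<in> E then \<beta> < \<psi> (i j) p else \<psi> (i j) p < \<alpha>"
        using i(2) E unfolding indep_levels_def by blast
      then have "p \<in> G \<inter> K" using E K by blast
      ultimately show "openin X G \<and> G \<inter> K \<noteq> {}" by blast
    qed simp
    then obtain k where k: "k \<in> I" "\<forall>G\<in>?cell ` Pow {..<n}.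
      (\<exists>p\<in>G \<inter> K \<inter> R. \<psi> k p < \<alpha>) \<and> (\<exists>p\<in>G \<inter> K \<inter> R. \<beta> < \<psi> k p)"
      by (rule bexE)
    have "indep_levels \<psi> (K \<inter> R) (Suc n) \<alpha> \<beta> (i(n := k))"
      unfolding indep_levels_def
    proof (intro allI impI)
      fix E assume "E \<subseteq> {..<Suc n}"
      have "\<exists>p\<in>?cell (E \<inter> {..<n}) \<inter> K \<inter> R. if n \<in> E then \<beta> < \<psi> k p else \<psi> k p < \<alpha>"
        using bspec[OF k(2) imageI[of "E \<inter> {..<n}"]] by (cases "n \<in> E") simp_all
      then obtain p where p: "p \<in> K \<inter> R" "p \<in> ?cell (E \<inter> {..<n})" "if n \<in> E then \<beta> < \<psi> k p else \<psi> k p < \<alpha>"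
        by blast
      show "\<exists>p\<in>K \<inter> R. \<forall>j<Suc n. if j \<in> E then \<beta> < \<psi> ((i(n := k)) j) p else \<psi> ((i(n := k)) j) p < \<alpha>"
        using p by (intro bexI[of _ p]) (auto simp: less_Suc_eq)
    qed
    moreover have "\<forall>j<Suc n. (i(n := k)) j \<in> I" using i(1) k(1) by (auto simp: less_Suc_eq)
    ultimately show ?case by blast
  qed
  then show False using no by blast
qed

text \<open>Induction over the levels: for each pair j / n < (j + 1) / n the cell is shrunk by the
  dichotomy, and earlier bounds survive on smaller cells. The ultrafilter decides twice, first which
  cell and then which side. Non-strict bounds on \<psi> i pass to the limit
  \<open>f\<close>.\<close>

lemma locally_uniform_cell:
  fixes \<psi> :: "'i \<Rightarrow> 'p \<Rightarrow> real"
  assumes op: "\<And>i r. i \<in> I \<Longrightarrow> openin X {p\<in>topspace X. r < \<psi> i p}"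
      "\<And>i r. i \<in> I \<Longrightarrow> openin X {p\<in>topspace X. \<psi> i p < r}"
    and K: "K \<subseteq> topspace X" "K \<noteq> {}"
    and no: "\<And>\<alpha> \<beta>. \<alpha> < \<beta> \<Longrightarrow> \<beta> \<le> \<alpha> + 1 \<Longrightarrow>
      \<exists>N. \<forall>i. (\<forall>j<N. i j \<in> I) \<longrightarrow> \<not> indep_levels \<psi> R N \<alpha> \<beta> i"
    and U: "ultrafilter U" "eventually (\<lambda>i. i \<in> I) U"
    and lim: "\<And>p. p \<in> R \<Longrightarrow> ((\<lambda>i. \<psi> i p) \<longlongrightarrow> f p) U"
    and n: "0 < (n::nat)"
  shows "\<exists>G. openin X G \<and> G \<inter> K \<noteq> {} \<and>
    (\<forall>j<m::nat. (\<forall>\<^sub>F i in U. \<forall>p\<in>G \<inter> K \<inter> R. j / n \<le> \<psi> i p \<and> j / n \<le> f p) \<or>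
      (\<forall>\<^sub>F i in U. \<forall>p\<in>G \<inter> K \<inter> R. \<psi> i p \<le> (real j + 1) / n \<and> f p \<le> (real j + 1) / n))"
proof (induction m)
  case 0
  show ?case using K by (intro exI[of _ "topspace X"]) auto
next
  case (Suc m)
  then obtain G where G: "openin X G" "G \<inter> K \<noteq> {}"
    "\<And>j. j < m \<Longrightarrow> (\<forall>\<^sub>F i in U. \<forall>p\<in>G \<inter> K \<inter> R. j / n \<le> \<psi> i p \<and> j / n \<le> f p) \<or>
      (\<forall>\<^sub>F i in U. \<forall>p\<in>G \<inter> K \<inter> R. \<psi> i p \<le> (real j + 1) / n \<and> f p \<le> (real j + 1) / n)" by blast
  let ?a = "real m / n" and ?b = "(real m + 1) / n"
  have nb: "U \<noteq> bot" using U by (simp add: ultrafilter_def)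
  have "?a < ?b" "?b \<le> ?a + 1" using n by (auto simp: field_simps)
  from no[OF this] obtain N where N: "\<And>i. (\<forall>j<N. i j \<in> I) \<Longrightarrow> \<not> indep_levels \<psi> R N ?a ?b i" by blast
  have "\<not> indep_levels \<psi> ((G \<inter> K) \<inter> R) N ?a ?b i" if "\<forall>j<N. i j \<in> I" for i
    using N[OF that] unfolding indep_levels_def by (meson IntD2)
  then have "\<exists>\<C>. finite \<C> \<and> (\<forall>G'\<in>\<C>. openin X G' \<and> G' \<inter> (G \<inter> K) \<noteq> {}) \<and>
     (\<forall>i\<in>I. \<exists>G'\<in>\<C>. (\<forall>p\<in>G' \<inter> (G \<inter> K) \<inter> R. ?a \<le> \<psi> i p) \<or> (\<forall>p\<in>G' \<inter> (G \<inter> K) \<inter> R. \<psi> i p \<le> ?b))"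
    using K G(2) by (intro homogeneous_cells[where N = N, OF op]) auto
  then obtain \<C> where C: "finite \<C>" "\<forall>G'\<in>\<C>. openin X G' \<and> G' \<inter> (G \<inter> K) \<noteq> {}"
    "\<forall>i\<in>I. \<exists>G'\<in>\<C>. (\<forall>p\<in>G' \<inter> (G \<inter> K) \<inter> R. ?a \<le> \<psi> i p) \<or> (\<forall>p\<in>G' \<inter> (G \<inter> K) \<inter> R. \<psi> i p \<le> ?b)"
    by (elim exE conjE)
  have "\<exists>G'\<in>\<C>. \<forall>\<^sub>F i in U. (\<forall>p\<in>G' \<inter> (G \<inter> K) \<inter> R. ?a \<le> \<psi> i p) \<or> (\<forall>p\<in>G' \<inter> (G \<inter> K) \<inter> R. \<psi> i p \<le> ?b)"
    by (rule ultrafilter_finite_disj[OF U(1) C(1)]) (use U(2) C(3) in \<open>auto elim: eventually_mono\<close>)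
  then obtain G' where G': "G' \<in> \<C>"
    "\<forall>\<^sub>F i in U. (\<forall>p\<in>G' \<inter> (G \<inter> K) \<inter> R. ?a \<le> \<psi> i p) \<or> (\<forall>p\<in>G' \<inter> (G \<inter> K) \<inter> R. \<psi> i p \<le> ?b)" by blast
  let ?H = "G' \<inter> G"
  \<comment> \<open>The second pigeonhole; \<open>u\<close> names the side.\<close>
  have "\<exists>u\<in>UNIV. \<forall>\<^sub>F i in U. if u then \<forall>p\<in>?H \<inter> K \<inter> R. ?a \<le> \<psi> i p else \<forall>p\<in>?H \<inter> K \<inter> R. \<psi> i p \<le> ?b"
    by (rule ultrafilter_finite_disj[OF U(1)]) (use G'(2) in \<open>auto elim: eventually_mono simp: UNIV_bool Int_assoc\<close>)
  then have disj: "(\<forall>\<^sub>F i in U. \<forall>p\<in>?H \<inter> K \<inter> R. ?a \<le> \<psi> i p) \<or> (\<forall>\<^sub>F i in U. \<forall>p\<in>?H \<inter> K \<inter> R. \<psi> i p \<le> ?b)"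
    by (auto simp: UNIV_bool)
  have new: "(\<forall>\<^sub>F i in U. \<forall>p\<in>?H \<inter> K \<inter> R. ?a \<le> \<psi> i p \<and> ?a \<le> f p) \<or>
      (\<forall>\<^sub>F i in U. \<forall>p\<in>?H \<inter> K \<inter> R. \<psi> i p \<le> ?b \<and> f p \<le> ?b)"
    using disj
  proof
    assume ev: "\<forall>\<^sub>F i in U. \<forall>p\<in>?H \<inter> K \<inter> R. ?a \<le> \<psi> i p"
    have "?a \<le> f p" if p: "p \<in> ?H \<inter> K \<inter> R" for p
      using p ev by (intro tendsto_lowerbound[OF lim _ nb]) (auto elim: eventually_mono)
    then show ?thesis using ev by (auto elim: eventually_mono)
  next
    assume ev: "\<forall>\<^sub>F i in U. \<forall>p\<in>?H \<inter> K \<inter> R. \<psi> i p \<le> ?b"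
    have "f p \<le> ?b" if p: "p \<in> ?H \<inter> K \<inter> R" for p
      using p ev by (intro tendsto_upperbound[OF lim _ nb]) (auto elim: eventually_mono)
    then show ?thesis using ev by (auto elim: eventually_mono)
  qed
  have old: "(\<forall>\<^sub>F i in U. \<forall>p\<in>?H \<inter> K \<inter> R. j / n \<le> \<psi> i p \<and> j / n \<le> f p) \<or>
      (\<forall>\<^sub>F i in U. \<forall>p\<in>?H \<inter> K \<inter> R. \<psi> i p \<le> (real j + 1) / n \<and> f p \<le> (real j + 1) / n)" if "j < m" for j
    using G(3)[OF that] by (elim disjE) (rule disjI1 disjI2, erule eventually_mono, blast)+
  have "openin X ?H" "?H \<inter> K \<noteq> {}" using bspec[OF C(2) G'(1)] G(1) by (auto intro: openin_Int)
  then show ?case using new old by (intro exI[of _ ?H]) (auto simp: less_Suc_eq add.commute)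
qed

section \<open>Exhaustion and self-supporting sets\<close>

text \<open>Let V n be members of nearly maximal measure. If the claim failed, the complement of
  their union would have positive measure and contain a member A of positive measure; A \<union> V n
  would then exceed the supremum for large n. The countable union need not be a member, so its
  measure is bounded through the finite unions P n.\<close>

lemma exhaustion:
  fixes \<nu> :: "'p measure"
  assumes "prob_space \<nu>" and W: "\<W> \<subseteq> sets \<nu>" "{} \<in> \<W>" "\<And>A B. A \<in> \<W> \<Longrightarrow> B \<in> \<W> \<Longrightarrow> A \<union> B \<in> \<W>"
    and ex: "\<And>D. D \<in> sets \<nu> \<Longrightarrow> 0 < measure \<nu> D \<Longrightarrow> \<exists>A\<in>\<W>. A \<subseteq> D \<and> 0 < measure \<nu> A"
    and \<delta>: "0 < \<delta>"
  shows "\<exists>A\<in>\<W>. 1 - \<delta> < measure \<nu> A"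
proof (rule ccontr)
  interpret prob_space \<nu> by fact
  assume "\<not> ?thesis"
  then have le: "\<And>A. A \<in> \<W> \<Longrightarrow> measure \<nu> A \<le> 1 - \<delta>" by force
  let ?S = "measure \<nu> ` \<W>"
  have bdd: "bdd_above ?S" by (auto intro: bdd_aboveI2)
  have ne: "?S \<noteq> {}" using W(2) by blast
  have "\<exists>A\<in>\<W>. Sup ?S - 1 / (n + 1) < measure \<nu> A" for n :: nat
  proof -
    have "Sup ?S - 1 / (n + 1) < Sup ?S" by simp
    from less_cSupD[OF ne this] show ?thesis by blast
  qed
  then obtain V :: "nat \<Rightarrow> 'p set" where V: "\<And>n. V n \<in> \<W>" "\<And>n::nat. Sup ?S - 1 / (n + 1) < measure \<nu> (V n)" by metis
  define P where "P n = (\<Union>i\<le>n. V i)" for n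
  have PW: "P n \<in> \<W>" for n
    by (induction n) (auto simp: P_def atMost_Suc V(1) intro: W(3))
  have PS: "range P \<subseteq> sets \<nu>" using PW W(1) by blast
  have "incseq P" by (auto simp: P_def incseq_def intro: order_trans)
  then have "(\<lambda>n. measure \<nu> (P n)) \<longlonglongrightarrow> measure \<nu> (\<Union>n. P n)"
    by (rule finite_Lim_measure_incseq[OF PS])
  then have lim: "measure \<nu> (\<Union>n. P n) \<le> 1 - \<delta>"
    by (rule LIMSEQ_le_const2) (use le PW in auto)
  have meas: "(\<Union>n. P n) \<in> sets \<nu>" using PS by blast
  let ?D = "space \<nu> - (\<Union>n. P n)"
  have "0 < measure \<nu> ?D" using prob_compl[OF meas] lim \<delta> by simp
  then obtain A where A: "A \<in> \<W>" "A \<subseteq> ?D" "0 < measure \<nu> A" using ex[of ?D] meas by auto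
  have "measure \<nu> A < 1 / (n + 1)" for n :: nat
  proof -
    have "A \<inter> V n = {}" using A(2) by (auto simp: P_def)
    then have "measure \<nu> (A \<union> V n) = measure \<nu> A + measure \<nu> (V n)"
      using A(1) V(1) W(1) by (intro finite_measure_Union) auto
    moreover have "measure \<nu> (A \<union> V n) \<le> Sup ?S"
      using A(1) V(1) W(3) bdd by (intro cSup_upper) auto
    ultimately show ?thesis using V(2)[of n] by linarith
  qed
  moreover obtain n :: nat where "1 / (n + 1) < measure \<nu> A"
    using A(3) by (metis Suc_eq_plus1 nat_approx_posE)
  ultimately show False by (metis less_asym)
qed

text \<open>K is the full support of the measure restricted to it. Cells arise only as nonempty
  relatively open sets; this property makes them count in the exhaustion.\<close>

definition self_supporting :: "'p topology \<Rightarrow> 'p measure \<Rightarrow> 'p set \<Rightarrow> bool" where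
  "self_supporting X \<nu> K \<longleftrightarrow> K \<in> sets \<nu> \<and> K \<noteq> {} \<and>
     (\<forall>G. openin X G \<longrightarrow> G \<inter> K \<noteq> {} \<longrightarrow> 0 < emeasure \<nu> (G \<inter> K))"

lemma sets_regular_borel_openin:
  assumes "regular_borel_prob X \<nu>" "openin X G"
  shows "G \<in> sets \<nu>"
  using assms by (auto simp: regular_borel_prob_def intro: sigma_sets.Basic)

lemma sets_regular_borel_closedin:
  assumes "regular_borel_prob X \<nu>" "closedin X K"
  shows "K \<in> sets \<nu>"
proof -
  have "topspace X - K \<in> sets \<nu>" using assms by (auto intro: sets_regular_borel_openin)
  then have "space \<nu> - (topspace X - K) \<in> sets \<nu>" by (rule sets.compl_sets)
  moreover have "space \<nu> - (topspace X - K) = K"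
    using assms closedin_subset by (fastforce simp: regular_borel_prob_def)
  ultimately show ?thesis by simp
qed

text \<open>All relatively open null parts are removed from a compact closed subset
  \<open>K0\<close> of positive measure. There may be uncountably many of them; their union is still
  null by inner regularity, since a compact subset of it is covered by finitely many.\<close>

lemma exists_self_supporting:
  assumes reg: "regular_borel_prob X \<nu>" and D: "D \<in> sets \<nu>" "0 < emeasure \<nu> D"
  shows "\<exists>K\<subseteq>D. self_supporting X \<nu> K"
proof -
  have inner: "emeasure \<nu> A = (SUP K\<in>{K. K \<subseteq> A \<and> compactin X K \<and> closedin X K}. emeasure \<nu> K)"
    if "A \<in> sets \<nu>" for A
    using reg that by (auto simp: regular_borel_prob_def)
  note meas = sets_regular_borel_openin[OF reg] sets_regular_borel_closedin[OF reg]
  have pos: "\<exists>K\<subseteq>A. compactin X K \<and> closedin X K \<and> 0 < emeasure \<nu> K"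
    if "A \<in> sets \<nu>" "0 < emeasure \<nu> A" for A
    using that(2) unfolding inner[OF that(1)] less_SUP_iff by blast
  from pos[OF D] obtain K0 where K0: "K0 \<subseteq> D" "closedin X K0" "0 < emeasure \<nu> K0" by blast
  define N where "N = {G. openin X G \<and> emeasure \<nu> (G \<inter> K0) = 0}"
  have opN: "openin X (\<Union>N)" by (auto simp: N_def)
  have null: "emeasure \<nu> (\<Union>N \<inter> K0) = 0"
  proof (rule ccontr)
    assume "emeasure \<nu> (\<Union>N \<inter> K0) \<noteq> 0"
    then have "0 < emeasure \<nu> (\<Union>N \<inter> K0)" by (simp add: zero_less_iff_neq_zero)
    from pos[OF _ this] obtain C where C: "C \<subseteq> \<Union>N \<inter> K0" "compactin X C" "closedin X C" "0 < emeasure \<nu> C"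
      using meas(1)[OF opN] meas(2)[OF K0(2)] by blast
    have "\<exists>F. finite F \<and> F \<subseteq> N \<and> C \<subseteq> \<Union>F"
      using C by (intro compactinD[OF C(2)]) (auto simp: N_def)
    then obtain F where F: "finite F" "F \<subseteq> N" "C \<subseteq> \<Union>F" by blast
    have "(\<Union>G\<in>F. G \<inter> K0) \<in> null_sets \<nu>"
      using F meas K0(2) by (intro null_sets_UN') (auto simp: N_def countable_finite null_sets_def)
    then have "C \<in> null_sets \<nu>"
      by (rule null_sets_subset[OF _ meas(2)[OF C(3)]]) (use C(1) F(3) in blast)
    then show False using C(4) by auto
  qed
  let ?K = "K0 - \<Union>N"
  have mK: "?K \<in> sets \<nu>" using meas(2)[OF K0(2)] meas(1)[OF opN] by blast
  have mN: "\<Union>N \<inter> K0 \<in> null_sets \<nu>"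
    using null meas(2)[OF K0(2)] meas(1)[OF opN] by (auto simp: null_sets_def)
  have "K0 - (\<Union>N \<inter> K0) = ?K" by blast
  then have "emeasure \<nu> ?K = emeasure \<nu> K0"
    using emeasure_Diff_null_set[OF mN meas(2)[OF K0(2)]] by simp
  then have "?K \<noteq> {}" using K0(3) by force
  moreover have "0 < emeasure \<nu> (G \<inter> ?K)" if G: "openin X G" "G \<inter> ?K \<noteq> {}" for G
  proof (rule ccontr)
    assume "\<not> 0 < emeasure \<nu> (G \<inter> ?K)"
    then have "G \<inter> ?K \<in> null_sets \<nu>" using meas(1)[OF G(1)] mK by (auto simp: null_sets_def)
    then have "(G \<inter> ?K) \<union> (\<Union>N \<inter> K0) \<in> null_sets \<nu>" using mN by (rule null_sets.Un)
    then have "G \<inter> K0 \<in> null_sets \<nu>"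
      by (rule null_sets_subset[OF _ sets.Int[OF meas(1)[OF G(1)] meas(2)[OF K0(2)]]]) blast
    then have "G \<in> N" using G(1) by (auto simp: N_def)
    then show False using G(2) by blast
  qed
  ultimately show ?thesis using K0(1) mK by (intro exI[of _ ?K]) (auto simp: self_supporting_def)
qed

text \<open>The exhaustion runs over the measurable sets on which \<psi> is ultimately within 2 / n
  of \<open>f\<close>. A set of positive measure contains a self-supporting K, and a cell of K for
  the grid of mesh 1 / n is such a set, of positive measure.\<close>

theorem uniform_approximation_off_small_set:
  fixes \<psi> :: "'i \<Rightarrow> 'p \<Rightarrow> real"
  assumes reg: "regular_borel_prob X \<nu>"
    and op: "\<And>i r. i \<in> I \<Longrightarrow> openin X {p\<in>topspace X. r < \<psi> i p}"
      "\<And>i r. i \<in> I \<Longrightarrow> openin X {p\<in>topspace X. \<psi> i p < r}"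
    and no: "\<And>\<alpha> \<beta>. \<alpha> < \<beta> \<Longrightarrow> \<beta> \<le> \<alpha> + 1 \<Longrightarrow>
      \<exists>N. \<forall>i. (\<forall>j<N. i j \<in> I) \<longrightarrow> \<not> indep_levels \<psi> R N \<alpha> \<beta> i"
    and U: "ultrafilter U" "eventually (\<lambda>i. i \<in> I) U"
    and lim: "\<And>p. p \<in> R \<Longrightarrow> ((\<lambda>i. \<psi> i p) \<longlongrightarrow> f p) U"
    and bd: "\<And>i p. i \<in> I \<Longrightarrow> 0 \<le> \<psi> i p \<and> \<psi> i p \<le> 1"
    and \<epsilon>: "0 < \<epsilon>"
  shows "\<exists>C\<in>sets \<nu>. 1 - \<epsilon> < measure \<nu> C \<and> (\<exists>i\<in>I. \<forall>p\<in>C \<inter> R. \<bar>\<psi> i p - f p\<bar> < \<epsilon>)"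
proof -
  interpret prob_space \<nu> using reg by (simp add: regular_borel_prob_def)
  have nb: "U \<noteq> bot" using U by (simp add: ultrafilter_def)
  have fbd: "0 \<le> f p" "f p \<le> 1" if "p \<in> R" for p
    using U(2) bd
    by (auto intro!: tendsto_lowerbound[OF lim[OF that] _ nb] tendsto_upperbound[OF lim[OF that] _ nb]
        elim!: eventually_mono)
  obtain n :: nat where n: "0 < n" "2 / n < \<epsilon>"
  proof -
    obtain n :: nat where "2 / \<epsilon> < n" using reals_Archimedean2 by blast
    then show thesis using \<epsilon> that[of "n"] by (cases "n = 0") (auto simp: field_simps)
  qed
  define \<W> where "\<W> = {A\<in>sets \<nu>. \<forall>\<^sub>F i in U. \<forall>p\<in>A \<inter> R. \<bar>\<psi> i p - f p\<bar> \<le> 2 / n}"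
  have "\<exists>A\<in>\<W>. 1 - \<epsilon> < measure \<nu> A"
  proof (rule exhaustion[OF prob_space_axioms _ _ _ _ \<epsilon>])
    show "A \<union> B \<in> \<W>" if "A \<in> \<W>" "B \<in> \<W>" for A B
      using that by (auto simp: \<W>_def elim: eventually_elim2)
    fix D assume D: "D \<in> sets \<nu>" "0 < measure \<nu> D"
    then have "0 < emeasure \<nu> D" by (simp add: emeasure_eq_measure)
    from exists_self_supporting[OF reg D(1) this] obtain K where K: "K \<subseteq> D" "self_supporting X \<nu> K" by blast
    have "space \<nu> = topspace X" using reg by (simp add: regular_borel_prob_def)
    then have Ks: "K \<subseteq> topspace X" "K \<noteq> {}"
      using K(2) sets.sets_into_space[of K \<nu>] by (auto simp: self_supporting_def)
    have "\<exists>G. openin X G \<and> G \<inter> K \<noteq> {} \<and>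
      (\<forall>j<n. (\<forall>\<^sub>F i in U. \<forall>p\<in>G \<inter> K \<inter> R. j / n \<le> \<psi> i p \<and> j / n \<le> f p) \<or>
        (\<forall>\<^sub>F i in U. \<forall>p\<in>G \<inter> K \<inter> R. \<psi> i p \<le> (real j + 1) / n \<and> f p \<le> (real j + 1) / n))"
      by (rule locally_uniform_cell[OF _ _ Ks _ U _ n(1)]) (fact op no lim)+
    then obtain G where G: "openin X G" "G \<inter> K \<noteq> {}"
      "\<forall>j<n. (\<forall>\<^sub>F i in U. \<forall>p\<in>G \<inter> K \<inter> R. j / n \<le> \<psi> i p \<and> j / n \<le> f p) \<or>
        (\<forall>\<^sub>F i in U. \<forall>p\<in>G \<inter> K \<inter> R. \<psi> i p \<le> (real j + 1) / n \<and> f p \<le> (real j + 1) / n)" by blast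
    \<comment> \<open>Two numbers of the unit interval that lie on a common side at every level
      differ by at most two meshes.\<close>
    have close: "\<bar>x - y\<bar> \<le> 2 / n"
      if xy: "0 \<le> x" "x \<le> 1" "0 \<le> y" "y \<le> 1"
        "\<forall>j<n. (j / n \<le> x \<and> j / n \<le> y) \<or> (x \<le> (real j + 1) / n \<and> y \<le> (real j + 1) / n)" for x y :: real
    proof -
      have *: "v \<le> u + 2 / n" if uv: "0 \<le> u" "v \<le> 1"
        "\<forall>j<n. (j / n \<le> u \<and> j / n \<le> v) \<or> (u \<le> (real j + 1) / n \<and> v \<le> (real j + 1) / n)" for u v :: real
      proof (rule ccontr)
        assume neg: "\<not> v \<le> u + 2 / n"
        \<comment> \<open>The first grid point beyond u. If v > u + 2 / n, then u < j / n and (j +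
          1) / n < v, so both alternatives fail at j; v \<le> 1 gives j < n.\<close>
        define j where "j = Suc (nat \<lfloor>n * u\<rfloor>)"
        have fl: "real (nat \<lfloor>n * u\<rfloor>) = of_int \<lfloor>n * u\<rfloor>" using uv n by simp
        have j: "n * u < j" "real j \<le> n * u + 1" unfolding j_def of_nat_Suc fl by linarith+
        have "n * u + 2 < n * v" using neg n by (simp add: field_simps)
        moreover have "n * v \<le> n" using uv n by simp
        ultimately have "j < n" using j by linarith
        then have "j / n \<le> u \<or> v \<le> (real j + 1) / n" using uv(3) by blast
        then show False using j \<open>n * u + 2 < n * v\<close> n by (auto simp: field_simps)
      qed
      have "y \<le> x + 2 / n" by (rule *) (use xy in auto)
      moreover have "x \<le> y + 2 / n" by (rule *) (use xy in auto)
      ultimately show ?thesis by (simp add: abs_le_iff)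
    qed
    have "\<forall>\<^sub>F i in U. \<forall>j\<in>{..<n}. (\<forall>p\<in>G \<inter> K \<inter> R. j / n \<le> \<psi> i p \<and> j / n \<le> f p) \<or>
        (\<forall>p\<in>G \<inter> K \<inter> R. \<psi> i p \<le> (real j + 1) / n \<and> f p \<le> (real j + 1) / n)"
      using G(3) by (intro eventually_ball_finite) (auto elim: eventually_mono)
    with U(2) have "\<forall>\<^sub>F i in U. \<forall>p\<in>(G \<inter> K) \<inter> R. \<bar>\<psi> i p - f p\<bar> \<le> 2 / n"
    proof eventually_elim
      case (elim i)
      show ?case
      proof
        fix p assume p: "p \<in> (G \<inter> K) \<inter> R"
        show "\<bar>\<psi> i p - f p\<bar> \<le> 2 / n"
        proof (rule close)
          show "0 \<le> \<psi> i p" "\<psi> i p \<le> 1" using bd[OF elim(1)] by auto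
          show "0 \<le> f p" "f p \<le> 1" using p fbd by auto
          show "\<forall>j<n. (j / n \<le> \<psi> i p \<and> j / n \<le> f p) \<or> (\<psi> i p \<le> (real j + 1) / n \<and> f p \<le> (real j + 1) / n)"
            using elim(2) p by blast
        qed
      qed
    qed
    moreover have "G \<inter> K \<in> sets \<nu>"
      using K(2) sets_regular_borel_openin[OF reg G(1)] by (auto simp: self_supporting_def)
    ultimately have "G \<inter> K \<in> \<W>" by (simp add: \<W>_def)
    moreover have "0 < measure \<nu> (G \<inter> K)"
      using K(2) G(1,2) by (auto simp: self_supporting_def emeasure_eq_measure)
    ultimately show "\<exists>A\<in>\<W>. A \<subseteq> D \<and> 0 < measure \<nu> A" using K(1) by blast
  qed (auto simp: \<W>_def)
  then obtain C where C: "C \<in> sets \<nu>" "1 - \<epsilon> < measure \<nu> C"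
    "\<forall>\<^sub>F i in U. \<forall>p\<in>C \<inter> R. \<bar>\<psi> i p - f p\<bar> \<le> 2 / n" by (auto simp: \<W>_def)
  have "\<exists>i. i \<in> I \<and> (\<forall>p\<in>C \<inter> R. \<bar>\<psi> i p - f p\<bar> \<le> 2 / n)"
    by (rule eventually_happens'[OF nb eventually_conj[OF U(2) C(3)]])
  then obtain i where "i \<in> I" "\<forall>p\<in>C \<inter> R. \<bar>\<psi> i p - f p\<bar> < \<epsilon>" using n(2) by force
  then show ?thesis using C(1,2) by (intro bexI[of _ C] conjI bexI[of _ i])
qed

section \<open>Bounded shattering from saturation\<close>

lemma term_val_cong: "(\<And>v. v \<in> term_vars t \<Longrightarrow> e v = e' v) \<Longrightarrow> term_val \<A> e t = term_val \<A> e' t"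
proof (induction t)
  case (App f ts)
  then have "map (term_val \<A> e) ts = map (term_val \<A> e') ts" by auto
  then show ?case by (simp only: term_val.simps)
qed simp

lemma sat_cong: "(\<And>v. v \<in> free_vars \<psi> \<Longrightarrow> e v = e' v) \<Longrightarrow> sat \<A> e \<psi> \<longleftrightarrow> sat \<A> e' \<psi>"
proof (induction \<psi> arbitrary: e e')
  case (Eql s t)
  then have "term_val \<A> e s = term_val \<A> e' s" "term_val \<A> e t = term_val \<A> e' t"
    by (auto intro!: term_val_cong)
  then show ?case by simp
next
  case (Rel r ts)
  then have "map (term_val \<A> e) ts = map (term_val \<A> e') ts" by (auto intro!: term_val_cong)
  then show ?case by (simp only: sat.simps)
next
  case (Neg \<psi>)
  from Neg.IH[of e e'] Neg.prems show ?case by simp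
next
  case (Conj \<psi> \<eta>)
  from Conj.IH[of e e'] Conj.prems show ?case by simp
next
  case (Exi v \<psi>)
  have "sat \<A> (e(v := a)) \<psi> \<longleftrightarrow> sat \<A> (e'(v := a)) \<psi>" for a
  proof (rule Exi.IH)
    fix w assume "w \<in> free_vars \<psi>"
    then show "(e(v := a)) w = (e'(v := a)) w" using Exi.prems[of w] by (cases "w = v") auto
  qed
  then show ?case by simp
qed

lemma finite_term_vars: "finite (term_vars t)"
  by (induction t) auto

lemma finite_free_vars: "finite (free_vars \<psi>)"
  by (induction \<psi>) (auto simp: finite_term_vars)

text \<open>A sentence, so that the empty conjunction adds no free variable; it is true in every
  structure with nonempty universe.\<close>

definition true_form :: "('f, 'r) fo_form" where
  "true_form = Exi 0 (Eql (Var 0) (Var 0))"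

definition conj_list :: "('f, 'r) fo_form list \<Rightarrow> ('f, 'r) fo_form" where
  "conj_list \<psi>s = foldr Conj \<psi>s true_form"

definition exi_list :: "nat list \<Rightarrow> ('f, 'r) fo_form \<Rightarrow> ('f, 'r) fo_form" where
  "exi_list vs \<psi> = foldr Exi vs \<psi>"

lemma wf_conj_list [simp]: "wf_form L (conj_list \<psi>s) \<longleftrightarrow> (\<forall>\<psi>\<in>set \<psi>s. wf_form L \<psi>)"
  by (induction \<psi>s) (auto simp: conj_list_def true_form_def)

lemma free_vars_conj_list [simp]: "free_vars (conj_list \<psi>s) = (\<Union>\<psi>\<in>set \<psi>s. free_vars \<psi>)"
  by (induction \<psi>s) (auto simp: conj_list_def true_form_def)

lemma sat_conj_list:
  "univ \<A> \<noteq> {} \<Longrightarrow> sat \<A> e (conj_list \<psi>s) \<longleftrightarrow> (\<forall>\<psi>\<in>set \<psi>s. sat \<A> e \<psi>)"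
  by (induction \<psi>s) (auto simp: conj_list_def true_form_def)

lemma wf_exi_list [simp]: "wf_form L (exi_list vs \<psi>) \<longleftrightarrow> wf_form L \<psi>"
  by (induction vs) (auto simp: exi_list_def)

lemma free_vars_exi_list [simp]: "free_vars (exi_list vs \<psi>) = free_vars \<psi> - set vs"
  by (induction vs) (auto simp: exi_list_def)

lemma sat_exi_list:
  "sat \<A> e (exi_list vs \<psi>) \<longleftrightarrow>
    (\<exists>h. (\<forall>v\<in>set vs. h v \<in> univ \<A>) \<and> (\<forall>v. v \<notin> set vs \<longrightarrow> h v = e v) \<and> sat \<A> h \<psi>)"
proof (induction vs arbitrary: e)
  case Nil
  have "(\<forall>v. h v = e v) \<longleftrightarrow> h = e" for h by auto
  then show ?case by (simp add: exi_list_def)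
next
  case (Cons w vs)
  have "sat \<A> e (exi_list (w # vs) \<psi>) \<longleftrightarrow> (\<exists>c\<in>univ \<A>. sat \<A> (e(w := c)) (exi_list vs \<psi>))"
    by (simp add: exi_list_def)
  also have "\<dots> \<longleftrightarrow> (\<exists>c\<in>univ \<A>. \<exists>h. (\<forall>v\<in>set vs. h v \<in> univ \<A>) \<and>
      (\<forall>v. v \<notin> set vs \<longrightarrow> h v = (e(w := c)) v) \<and> sat \<A> h \<psi>)"
    by (simp only: Cons.IH)
  also have "\<dots> \<longleftrightarrow> (\<exists>h. (\<forall>v\<in>set (w # vs). h v \<in> univ \<A>) \<and>
      (\<forall>v. v \<notin> set (w # vs) \<longrightarrow> h v = e v) \<and> sat \<A> h \<psi>)" (is "?l \<longleftrightarrow> ?r")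
  proof
    assume ?l
    then obtain c h where ch: "c \<in> univ \<A>" "\<forall>v\<in>set vs. h v \<in> univ \<A>"
      "\<forall>v. v \<notin> set vs \<longrightarrow> h v = (e(w := c)) v" "sat \<A> h \<psi>" by blast
    then have "h w \<in> univ \<A>" by (cases "w \<in> set vs") auto
    with ch show ?r by (intro exI[of _ h]) auto
  next
    assume ?r
    then obtain h where h: "\<forall>v\<in>set (w # vs). h v \<in> univ \<A>"
      "\<forall>v. v \<notin> set (w # vs) \<longrightarrow> h v = e v" "sat \<A> h \<psi>" by blast
    then show ?l by (intro bexI[of _ "h w"] exI[of _ h]) auto
  qed
  finally show ?case .
qed

section \<open>Realizing countable types in infinitely many variables\<close>

lemma saturatedD:
  assumes "saturated L \<kappa> \<U>" "A \<subseteq> univ \<U>" "|A| <o \<kappa>"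
    and "\<forall>(\<psi>, e)\<in>\<Gamma>. wf_form L \<psi> \<and> (\<forall>v\<in>free_vars \<psi> - {0}. e v \<in> A)"
    and "\<And>\<Delta>. \<Delta> \<subseteq> \<Gamma> \<Longrightarrow> finite \<Delta> \<Longrightarrow> \<exists>c\<in>univ \<U>. \<forall>(\<psi>, e)\<in>\<Delta>. sat \<U> (e(0 := c)) \<psi>"
  shows "\<exists>c\<in>univ \<U>. \<forall>(\<psi>, e)\<in>\<Gamma>. sat \<U> (e(0 := c)) \<psi>"
proof -
  have fin: "\<forall>\<Delta>\<subseteq>\<Gamma>. finite \<Delta> \<longrightarrow> (\<exists>c\<in>univ \<U>. \<forall>(\<psi>, e)\<in>\<Delta>. sat \<U> (e(0 := c)) \<psi>)"
    using assms(5) by (intro allI impI)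
  show ?thesis
    by (rule assms(1)[unfolded saturated_def, THEN spec[of _ A], THEN spec[of _ \<Gamma>],
      THEN mp, THEN mp, THEN mp, THEN mp, OF assms(2-4) fin])
qed

text \<open>A value for variable j is chosen so that every finite part of \<Gamma> stays solvable.
  It realizes the 1-type that says, for each finite part, that the later variables of V can be
  filled in; the variables outside V or below j keep their values and serve as parameters.\<close>

lemma saturated_step:
  fixes \<U> :: "('f, 'r, 'a) fo_struct"
  assumes sat: "saturated L \<kappa> \<U>" and ne: "univ \<U> \<noteq> {}"
    and small: "|range (e :: nat \<Rightarrow> 'a)| <o \<kappa>" and e: "range e \<subseteq> univ \<U>"
    and wf: "\<And>\<psi>. \<psi> \<in> \<Gamma> \<Longrightarrow> wf_form L \<psi>" and zero: "\<And>\<psi>. \<psi> \<in> \<Gamma> \<Longrightarrow> 0 \<notin> free_vars \<psi>"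
    and j: "j \<in> V" "0 \<notin> V"
    and fin: "\<And>\<Delta>. \<Delta> \<subseteq> \<Gamma> \<Longrightarrow> finite \<Delta> \<Longrightarrow>
      \<exists>h. range h \<subseteq> univ \<U> \<and> (\<forall>v. v \<notin> V \<or> v < j \<longrightarrow> h v = e v) \<and> (\<forall>\<psi>\<in>\<Delta>. sat \<U> h \<psi>)"
  shows "\<exists>c\<in>univ \<U>. \<forall>\<Delta>\<subseteq>\<Gamma>. finite \<Delta> \<longrightarrow>
      (\<exists>h. range h \<subseteq> univ \<U> \<and> (\<forall>v. v \<notin> V \<or> v < Suc j \<longrightarrow> h v = (e(j := c)) v) \<and> (\<forall>\<psi>\<in>\<Delta>. sat \<U> h \<psi>))"
proof -
  \<comment> \<open>Types for \<open>saturated\<close> use variable 0, while \<Gamma> uses j. The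
    equation under the quantifier puts the value of 0 in place of j without substitution.\<close>
  define ex where "ex \<psi>s vs = Exi j (Conj (Eql (Var j) (Var 0)) (exi_list vs (conj_list \<psi>s)))"
    for \<psi>s :: "('f, 'r) fo_form list" and vs
  define vars where "vars \<psi>s = sorted_list_of_set ((\<Union>\<psi>\<in>set \<psi>s. free_vars \<psi>) \<inter> V \<inter> {j<..})"
    for \<psi>s :: "('f, 'r) fo_form list"
  have set_vars: "set (vars \<psi>s) = (\<Union>\<psi>\<in>set \<psi>s. free_vars \<psi>) \<inter> V \<inter> {j<..}" for \<psi>s
    unfolding vars_def by (subst set_sorted_list_of_set) (auto intro: finite_free_vars)
  define \<Gamma>' where "\<Gamma>' = {(ex \<psi>s (vars \<psi>s), e) | \<psi>s. set \<psi>s \<subseteq> \<Gamma>}"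
  have j0: "j \<noteq> 0" using j by metis
  have sat_ex: "sat \<U> (e(0 := c)) (ex \<psi>s (vars \<psi>s)) \<longleftrightarrow>
      (\<exists>h. (\<forall>v\<in>set (vars \<psi>s). h v \<in> univ \<U>) \<and>
        (\<forall>v. v \<notin> set (vars \<psi>s) \<longrightarrow> h v = (e(0 := c, j := c)) v) \<and> (\<forall>\<psi>\<in>set \<psi>s. sat \<U> h \<psi>))"
    if "c \<in> univ \<U>" for c \<psi>s
    using that j0 by (simp add: ex_def sat_exi_list sat_conj_list[OF ne])
  have "\<exists>c\<in>univ \<U>. \<forall>(\<psi>, e')\<in>\<Gamma>'. sat \<U> (e'(0 := c)) \<psi>"
  proof (rule saturatedD[OF sat])
    show "range e \<subseteq> univ \<U>" by (rule e)
    show "|range e| <o \<kappa>" by (rule small)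
    show "\<forall>(\<psi>, e')\<in>\<Gamma>'. wf_form L \<psi> \<and> (\<forall>v\<in>free_vars \<psi> - {0}. e' v \<in> range e)"
      using wf by (fastforce simp: \<Gamma>'_def ex_def)
    fix \<Delta> assume \<Delta>: "\<Delta> \<subseteq> \<Gamma>'" "finite \<Delta>"
    have "\<forall>x\<in>\<Delta>. \<exists>\<psi>s. x = (ex \<psi>s (vars \<psi>s), e) \<and> set \<psi>s \<subseteq> \<Gamma>" using \<Delta> by (auto simp: \<Gamma>'_def)
    then obtain l where l: "\<forall>x\<in>\<Delta>. x = (ex (l x) (vars (l x)), e) \<and> set (l x) \<subseteq> \<Gamma>" by metis
    \<comment> \<open>The finite parts behind the formulas of \<Delta> are solved together by one h,
      and its value at j satisfies \<Delta>.\<close>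
    have "(\<Union>x\<in>\<Delta>. set (l x)) \<subseteq> \<Gamma>" "finite (\<Union>x\<in>\<Delta>. set (l x))" using l \<Delta> by auto
    from fin[OF this] obtain h where h: "range h \<subseteq> univ \<U>" "\<forall>v. v \<notin> V \<or> v < j \<longrightarrow> h v = e v"
      "\<forall>x\<in>\<Delta>. \<forall>\<psi>\<in>set (l x). sat \<U> h \<psi>" by blast
    show "\<exists>c\<in>univ \<U>. \<forall>(\<psi>, e')\<in>\<Delta>. sat \<U> (e'(0 := c)) \<psi>"
    proof (intro bexI[of _ "h j"] ballI)
      show hj: "h j \<in> univ \<U>" using h(1) by blast
      fix x assume x: "x \<in> \<Delta>"
      let ?g = "\<lambda>v. if v \<in> set (vars (l x)) then h v else (e(0 := h j, j := h j)) v"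
      have "sat \<U> ?g \<psi>" if \<psi>: "\<psi> \<in> set (l x)" for \<psi>
      proof -
        have "\<psi> \<in> \<Gamma>" using l x \<psi> by blast
        then have "sat \<U> ?g \<psi> \<longleftrightarrow> sat \<U> h \<psi>"
          using h(2) \<psi> zero[of \<psi>] by (intro sat_cong) (auto simp: set_vars)
        then show ?thesis using h(3) x \<psi> by blast
      qed
      then have "sat \<U> (e(0 := h j)) (ex (l x) (vars (l x)))"
        unfolding sat_ex[OF hj] using h(1) by (intro exI[of _ ?g]) auto
      then show "case x of (\<psi>, e') \<Rightarrow> sat \<U> (e'(0 := h j)) \<psi>" using l x by (metis case_prod_conv)
    qed
  qed
  then obtain c where c: "c \<in> univ \<U>" "\<forall>(\<psi>, e')\<in>\<Gamma>'. sat \<U> (e'(0 := c)) \<psi>" by blast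
  have "\<exists>h. range h \<subseteq> univ \<U> \<and> (\<forall>v. v \<notin> V \<or> v < Suc j \<longrightarrow> h v = (e(j := c)) v) \<and> (\<forall>\<psi>\<in>\<Delta>. sat \<U> h \<psi>)"
    if \<Delta>: "\<Delta> \<subseteq> \<Gamma>" "finite \<Delta>" for \<Delta>
  proof -
    obtain \<psi>s where \<psi>s: "set \<psi>s = \<Delta>" using \<Delta>(2) finite_list by blast
    have "(ex \<psi>s (vars \<psi>s), e) \<in> \<Gamma>'" using \<psi>s \<Delta> by (auto simp: \<Gamma>'_def)
    then have "sat \<U> (e(0 := c)) (ex \<psi>s (vars \<psi>s))" using c by blast
    then obtain h where h: "\<forall>v\<in>set (vars \<psi>s). h v \<in> univ \<U>"
      "\<forall>v. v \<notin> set (vars \<psi>s) \<longrightarrow> h v = (e(0 := c, j := c)) v" "\<forall>\<psi>\<in>set \<psi>s. sat \<U> h \<psi>"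
      unfolding sat_ex[OF c(1)] by blast
    \<comment> \<open>The solution carries c at variable 0. Resetting it restores agreement with
      \<open>e\<close> and is harmless because 0 is not free in \<Gamma>.\<close>
    have "sat \<U> (h(0 := e 0)) \<psi> \<longleftrightarrow> sat \<U> h \<psi>" if "\<psi> \<in> \<Delta>" for \<psi>
      using zero[of \<psi>] that \<Delta> by (intro sat_cong) auto
    moreover have "(h(0 := e 0)) v \<in> univ \<U>" for v
      using h(1,2) e c(1) by (cases "v \<in> set (vars \<psi>s)"; cases "v = 0") auto
    moreover have "(h(0 := e 0)) v = (e(j := c)) v" if "v \<notin> V \<or> v < Suc j" for v
      using h(2) that j0 by (auto simp: set_vars)
    ultimately show ?thesis using h(3) \<psi>s by (intro exI[of _ "h(0 := e 0)"]) blast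
  qed
  then show ?thesis using c(1) by blast
qed

text \<open>Variable \<open>0\<close> is kept free because 1-types in \<open>saturated\<close> are types in that variable.\<close>

lemma saturated_countably_many_variables:
  fixes \<U> :: "('f, 'r, 'a) fo_struct"
  assumes sat: "saturated L \<kappa> \<U>" and ne: "univ \<U> \<noteq> {}"
    and small: "|UNIV :: nat set| <o \<kappa>" and e: "range e \<subseteq> univ \<U>"
    and wf: "\<And>\<psi>. \<psi> \<in> \<Gamma> \<Longrightarrow> wf_form L \<psi>" and zero: "\<And>\<psi>. \<psi> \<in> \<Gamma> \<Longrightarrow> 0 \<notin> free_vars \<psi>"
    and V: "0 \<notin> V"
    and fin: "\<And>\<Delta>. \<Delta> \<subseteq> \<Gamma> \<Longrightarrow> finite \<Delta> \<Longrightarrow>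
      \<exists>h. range h \<subseteq> univ \<U> \<and> (\<forall>v. v \<notin> V \<longrightarrow> h v = e v) \<and> (\<forall>\<psi>\<in>\<Delta>. sat \<U> h \<psi>)"
  shows "\<exists>h. range h \<subseteq> univ \<U> \<and> (\<forall>v. v \<notin> V \<longrightarrow> h v = e v) \<and> (\<forall>\<psi>\<in>\<Gamma>. sat \<U> h \<psi>)"
proof -
  \<comment> \<open>At stage j the values below j are final, and each finite part of \<Gamma> can be
    solved by changing only variables of V from j on.\<close>
  define ok where "ok j g \<longleftrightarrow> range g \<subseteq> univ \<U> \<and> (\<forall>v. v \<notin> V \<longrightarrow> g v = e v) \<and>
     (\<forall>\<Delta>\<subseteq>\<Gamma>. finite \<Delta> \<longrightarrow>
      (\<exists>h. range h \<subseteq> univ \<U> \<and> (\<forall>v. v \<notin> V \<or> v < j \<longrightarrow> h v = g v) \<and> (\<forall>\<psi>\<in>\<Delta>. sat \<U> h \<psi>)))"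
    for j :: nat and g :: "nat \<Rightarrow> 'a"
  have "\<exists>g. \<forall>j. ok j (g j) \<and> (\<forall>v. v \<noteq> j \<longrightarrow> g (Suc j) v = g j v)"
  proof (rule dependent_nat_choice[where P = ok and Q = "\<lambda>j g g'. \<forall>v. v \<noteq> j \<longrightarrow> g' v = g v"])
    show "\<exists>g. ok 0 g" using e fin unfolding ok_def by (intro exI[of _ e]) (simp only: not_less_zero simp_thms, blast)
    fix g j assume ok: "ok j g"
    have *: "\<Delta> \<subseteq> \<Gamma> \<Longrightarrow> finite \<Delta> \<Longrightarrow>
      \<exists>h. range h \<subseteq> univ \<U> \<and> (\<forall>v. v \<notin> V \<or> v < j \<longrightarrow> h v = g v) \<and> (\<forall>\<psi>\<in>\<Delta>. sat \<U> h \<psi>)" for \<Delta>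
      using ok unfolding ok_def by blast
    show "\<exists>g'. ok (Suc j) g' \<and> (\<forall>v. v \<noteq> j \<longrightarrow> g' v = g v)"
    proof (cases "j \<in> V")
      case True
      have small': "|range g| <o \<kappa>"
        using card_of_image small ordLeq_ordLess_trans by blast
      have rg: "range g \<subseteq> univ \<U>" using ok unfolding ok_def by blast
      have "\<exists>c\<in>univ \<U>. \<forall>\<Delta>\<subseteq>\<Gamma>. finite \<Delta> \<longrightarrow>
        (\<exists>h. range h \<subseteq> univ \<U> \<and> (\<forall>v. v \<notin> V \<or> v < Suc j \<longrightarrow> h v = (g(j := c)) v) \<and> (\<forall>\<psi>\<in>\<Delta>. sat \<U> h \<psi>))"
        by (rule saturated_step[OF sat ne small' rg]) (fact wf zero True V *)+
      then obtain c where "c \<in> univ \<U>" "\<forall>\<Delta>\<subseteq>\<Gamma>. finite \<Delta> \<longrightarrow>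
        (\<exists>h. range h \<subseteq> univ \<U> \<and> (\<forall>v. v \<notin> V \<or> v < Suc j \<longrightarrow> h v = (g(j := c)) v) \<and> (\<forall>\<psi>\<in>\<Delta>. sat \<U> h \<psi>))"
        by blast
      moreover from this ok True have "range (g(j := c)) \<subseteq> univ \<U>" "\<forall>v. v \<notin> V \<longrightarrow> (g(j := c)) v = e v"
        unfolding ok_def by auto
      ultimately show ?thesis unfolding ok_def by (intro exI[of _ "g(j := c)"]) simp
    next
      case False
      then have "v \<notin> V \<or> v < Suc j \<longleftrightarrow> v \<notin> V \<or> v < j" for v by (auto simp: less_Suc_eq)
      then have "ok (Suc j) g" using ok unfolding ok_def by simp
      then show ?thesis by auto
    qed
  qed
  then obtain g where g: "\<And>j. ok j (g j)" "\<And>j v. v \<noteq> j \<Longrightarrow> g (Suc j) v = g j v" by blast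
  have stable: "g k v = g (Suc v) v" if "v < k" for k v
    using that
  proof (induction k)
    case (Suc k)
    then show ?case using g(2)[of v k] by (cases "v = k") auto
  qed simp
  \<comment> \<open>Variable v is settled in the step from stage v to v + 1 and never changed later,
    so the result is read off the diagonal.\<close>
  define h where "h v = g (Suc v) v" for v
  have "sat \<U> h \<psi>" if \<psi>: "\<psi> \<in> \<Gamma>" for \<psi>
  proof -
    obtain k where k: "\<forall>v\<in>free_vars \<psi>. v < k"
      using finite_free_vars finite_nat_set_iff_bounded by blast
    obtain h' where h': "\<forall>v. v \<notin> V \<or> v < k \<longrightarrow> h' v = g k v" "sat \<U> h' \<psi>"
    proof -
      have "{\<psi>} \<subseteq> \<Gamma>" "finite {\<psi>}" using \<psi> by auto
      from g(1)[of k, unfolded ok_def, THEN conjunct2, THEN conjunct2, THEN spec[of _ "{\<psi>}"],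
          THEN mp, THEN mp, OF this]
      show ?thesis using that by auto
    qed
    have "sat \<U> h \<psi> \<longleftrightarrow> sat \<U> h' \<psi>"
    proof (rule sat_cong)
      fix v assume "v \<in> free_vars \<psi>"
      then have "v < k" using k by blast
      then show "h v = h' v" using h'(1) stable[of v k] by (simp add: h_def)
    qed
    then show ?thesis using h' by blast
  qed
  moreover have "range h \<subseteq> univ \<U>" "\<forall>v. v \<notin> V \<longrightarrow> h v = e v"
    using g(1) unfolding ok_def h_def by blast+
  ultimately show ?thesis by blast
qed

section \<open>Unbounded shattering contradicts NIP\<close>

text \<open>This is \<phi>(z,w) without substitution, so no variable can be captured by a quantifier
  inside \<phi>. The reading is correct when \<open>zs\<close> and \<open>ws\<close> avoid the
  variables x and y.\<close>

definition inst_form :: "('f, 'r) part_form \<Rightarrow> nat list \<Rightarrow> nat list \<Rightarrow> ('f, 'r) fo_form" where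
  "inst_form \<phi> zs ws = exi_list (xvars \<phi> @ yvars \<phi>)
     (Conj (conj_list (map2 (\<lambda>u v. Eql (Var u) (Var v)) (xvars \<phi> @ yvars \<phi>) (zs @ ws))) (the_form \<phi>))"

lemma wf_inst_form: "wf_part_form L \<phi> \<Longrightarrow> wf_form L (inst_form \<phi> zs ws)"
  by (auto simp: inst_form_def wf_part_form_def)

lemma free_vars_inst_form:
  assumes "wf_part_form L \<phi>"
  shows "free_vars (inst_form \<phi> zs ws) \<subseteq> set zs \<union> set ws"
proof
  fix w assume "w \<in> free_vars (inst_form \<phi> zs ws)"
  then have w: "w \<notin> set (xvars \<phi> @ yvars \<phi>)"
    and "w \<in> free_vars (the_form \<phi>) \<or> (\<exists>(u, v)\<in>set (zip (xvars \<phi> @ yvars \<phi>) (zs @ ws)). w = u \<or> w = v)"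
    by (auto simp: inst_form_def simp del: zip_append)
  then obtain u v where "(u, v) \<in> set (zip (xvars \<phi> @ yvars \<phi>) (zs @ ws))" "w = u \<or> w = v"
    using assms by (auto simp: wf_part_form_def simp del: zip_append)
  then have "w = v" "v \<in> set (zs @ ws)" using w by (metis set_zip_leftD, metis set_zip_rightD)
  then show "w \<in> set zs \<union> set ws" by simp
qed

lemma sat_equate_variables:
  assumes "univ \<A> \<noteq> {}" "length us = length vs"
  shows "sat \<A> g (conj_list (map2 (\<lambda>u v. Eql (Var u) (Var v)) us vs)) \<longleftrightarrow>
    (\<forall>i<length us. g (us ! i) = g (vs ! i))"
  using assms(2) by (auto simp: sat_conj_list[OF assms(1)] set_zip)

text \<open>The equations leave a single possible assignment of x and y, and disjointness keeps the
  outer quantifiers from changing the values of \<open>zs\<close> and \<open>ws\<close>.\<close>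

lemma sat_inst_form:
  assumes ne: "univ \<U> \<noteq> {}" and wf: "wf_part_form L \<phi>"
    and len: "length zs = length (xvars \<phi>)" "length ws = length (yvars \<phi>)"
    and dis: "(set zs \<union> set ws) \<inter> (set (xvars \<phi>) \<union> set (yvars \<phi>)) = {}"
    and h: "range h \<subseteq> univ \<U>"
  shows "sat \<U> h (inst_form \<phi> zs ws) \<longleftrightarrow> holds_at \<U> \<phi> (map h zs) (map h ws)"
proof -
  let ?us = "xvars \<phi> @ yvars \<phi>" and ?vs = "zs @ ws"
  define a where "a = (\<lambda>v. the (map_of (zip ?us (map h ?vs)) v))"
  have dist: "distinct ?us" and fv: "free_vars (the_form \<phi>) \<subseteq> set ?us"
    using wf by (auto simp: wf_part_form_def)
  have a: "a (?us ! i) = h (?vs ! i)" if "i < length ?us" for i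
  proof -
    have "map_of (zip ?us (map h ?vs)) (?us ! i) = Some (map h ?vs ! i)"
      using that len dist by (intro map_of_zip_nth) auto
    moreover have "map h ?vs ! i = h (?vs ! i)" using that len by (intro nth_map) simp
    ultimately show ?thesis by (simp only: a_def option.sel)
  qed
  have eqs: "sat \<U> g (conj_list (map2 (\<lambda>u v. Eql (Var u) (Var v)) ?us ?vs)) \<longleftrightarrow>
      (\<forall>i<length ?us. g (?us ! i) = g (?vs ! i))" for g
    by (rule sat_equate_variables[OF ne]) (simp add: len)
  have notin: "?vs ! i \<notin> set ?us" if "i < length ?us" for i
  proof -
    have "?vs ! i \<in> set ?vs" using that len by (intro nth_mem) simp
    then show ?thesis using dis by auto
  qed
  have "sat \<U> h (inst_form \<phi> zs ws) \<longleftrightarrow> (\<exists>g. (\<forall>v\<in>set ?us. g v \<in> univ \<U>) \<and>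
     (\<forall>v. v \<notin> set ?us \<longrightarrow> g v = h v) \<and> (\<forall>i<length ?us. g (?us ! i) = g (?vs ! i)) \<and> sat \<U> g (the_form \<phi>))"
    unfolding inst_form_def sat_exi_list sat.simps eqs by blast
  also have "\<dots> \<longleftrightarrow> sat \<U> a (the_form \<phi>)"
  proof
    assume "\<exists>g. (\<forall>v\<in>set ?us. g v \<in> univ \<U>) \<and> (\<forall>v. v \<notin> set ?us \<longrightarrow> g v = h v) \<and>
      (\<forall>i<length ?us. g (?us ! i) = g (?vs ! i)) \<and> sat \<U> g (the_form \<phi>)"
    then obtain g where g: "\<forall>v. v \<notin> set ?us \<longrightarrow> g v = h v"
      "\<forall>i<length ?us. g (?us ! i) = g (?vs ! i)" "sat \<U> g (the_form \<phi>)" by blast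
    have "a v = g v" if v: "v \<in> free_vars (the_form \<phi>)" for v
    proof -
      obtain i where i: "i < length ?us" "v = ?us ! i"
        using fv v by (metis in_set_conv_nth subsetD)
      have "a v = h (?vs ! i)" using a i by simp
      also have "\<dots> = g (?vs ! i)" using g(1) notin[OF i(1)] by simp
      also have "\<dots> = g v" using g(2) i by simp
      finally show ?thesis .
    qed
    then show "sat \<U> a (the_form \<phi>)" using g(3) sat_cong by metis
  next
    assume s: "sat \<U> a (the_form \<phi>)"
    let ?g = "\<lambda>v. if v \<in> set ?us then a v else h v"
    have "sat \<U> ?g (the_form \<phi>) \<longleftrightarrow> sat \<U> a (the_form \<phi>)"
      using fv by (intro sat_cong) auto
    moreover have "a v \<in> univ \<U>" if v: "v \<in> set ?us" for v
    proof -
      obtain i where "i < length ?us" "v = ?us ! i" using v by (metis in_set_conv_nth)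
      then have "a v = h (?vs ! i)" using a by simp
      then show ?thesis using h by auto
    qed
    moreover have "?g (?us ! i) = ?g (?vs ! i)" if "i < length ?us" for i
    proof -
      have "?us ! i \<in> set ?us" using that by (rule nth_mem)
      then have "?g (?us ! i) = a (?us ! i)" by (simp only: if_True)
      also have "\<dots> = ?g (?vs ! i)" using a[OF that] notin[OF that] by (simp only: if_False)
      finally show ?thesis .
    qed
    ultimately show "\<exists>g. (\<forall>v\<in>set ?us. g v \<in> univ \<U>) \<and> (\<forall>v. v \<notin> set ?us \<longrightarrow> g v = h v) \<and>
      (\<forall>i<length ?us. g (?us ! i) = g (?vs ! i)) \<and> sat \<U> g (the_form \<phi>)"
      using s by (intro exI[of _ ?g] conjI) (blast | simp)+
  qed
  finally show ?thesis by (simp add: holds_at_def a_def)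
qed

text \<open>Together with the cardinality bound in \<open>monster_model\<close> this makes \<kappa>
  uncountable, so countably many parameters are allowed.\<close>

lemma infinite_wf_forms: "infinite {\<psi> :: ('f, 'r) fo_form. wf_form L \<psi>}"
proof -
  define F :: "nat \<Rightarrow> ('f, 'r) fo_form" where "F n = Eql (Var n) (Var n)" for n
  have "inj F" by (auto simp: inj_def F_def)
  moreover have "range F \<subseteq> {\<psi>. wf_form L \<psi>}" by (auto simp: F_def)
  ultimately show ?thesis using range_inj_infinite infinite_super by blast
qed

text \<open>Saturation is used twice. First a sequence of tuples is realized such that every pattern
  on every initial segment has a witness; finite shattering of all sizes makes this finitely
  satisfiable. Then, over this sequence, a witness for each infinite pattern E is realized.\<close>

theorem NIP_bounded_shattering:
  fixes \<U> :: "('f, 'r, 'a) fo_struct"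
  assumes mon: "monster_model L T \<kappa> \<U>" and wf: "wf_part_form L \<phi>" and nip: "NIP \<U> \<phi>"
  shows "\<exists>d. \<forall>a. (\<forall>i<d. a i \<in> xtuples \<phi> (univ \<U>)) \<longrightarrow>
           \<not> shattered (holds_at \<U> \<phi>) (ytuples \<phi> (univ \<U>)) d a"
proof (rule ccontr)
  assume "\<not> ?thesis"
  then have ex: "\<exists>a. (\<forall>i<d. a i \<in> xtuples \<phi> (univ \<U>)) \<and>
      shattered (holds_at \<U> \<phi>) (ytuples \<phi> (univ \<U>)) d a" for d by blast
  have ne: "univ \<U> \<noteq> {}" and sat: "saturated L \<kappa> \<U>"
    using mon by (auto simp: monster_model_def model_of_def is_struct_def)
  have small: "|UNIV :: nat set| <o \<kappa>"
    using mon infinite_wf_forms[of L] unfolding monster_model_def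
    by (metis infinite_iff_card_of_nat ordLeq_ordLess_trans)
  obtain u where u: "u \<in> univ \<U>" using ne by blast
  let ?lx = "length (xvars \<phi>)" and ?ly = "length (yvars \<phi>)"
  obtain n0 where n0: "0 < n0" "\<forall>v\<in>set (xvars \<phi>) \<union> set (yvars \<phi>). v < n0"
    using finite_nat_set_iff_bounded[of "insert 0 (set (xvars \<phi>) \<union> set (yvars \<phi>))"] by auto
  \<comment> \<open>Fresh variables from \<open>n0\<close> on: those of \<open>ws\<close> for the
    witness, then one block of length \<open>?lx\<close> for each tuple of the sequence. They avoid
    0 and the variables x and y.\<close>
  define ws where "ws = map (\<lambda>c. n0 + c) [0..<?ly]"
  define zs where "zs i = map (\<lambda>c. n0 + ?ly + (i * ?lx + c)) [0..<?lx]" for i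
  have len: "length (zs i) = ?lx" "length ws = ?ly" for i by (auto simp: zs_def ws_def)
  have zs0: "0 \<notin> set (zs i)" and ws0: "0 \<notin> set ws" for i using n0 by (auto simp: zs_def ws_def)
  have dis: "(set (zs i) \<union> set ws) \<inter> (set (xvars \<phi>) \<union> set (yvars \<phi>)) = {}" for i
  proof -
    have "n0 \<le> v" if "v \<in> set (zs i) \<union> set ws" for v using that by (auto simp: zs_def ws_def)
    then show ?thesis using n0(2) by (meson disjoint_iff not_less)
  qed
  have zw: "set (zs i) \<inter> set ws = {}" for i by (auto simp: zs_def ws_def)
  have range_subset: "range g \<subseteq> univ \<U>"
    if "\<forall>v\<in>set ws. g v \<in> univ \<U>" "\<forall>v. v \<notin> set ws \<longrightarrow> g v = h v" "range h \<subseteq> univ \<U>" for g h :: "nat \<Rightarrow> 'a"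
  proof (rule image_subsetI)
    show "g v \<in> univ \<U>" for v using that by (cases "v \<in> set ws") auto
  qed
  have tupx: "map h (zs i) \<in> xtuples \<phi> (univ \<U>)" and tupy: "map h ws \<in> ytuples \<phi> (univ \<U>)"
    if "range h \<subseteq> univ \<U>" for h i
    using that len by (auto simp: xtuples_def ytuples_def)
  define P where "P i = inst_form \<phi> (zs i) ws" for i
  define Q where "Q E i = (if i \<in> E then P i else Neg (P i))" for E i
  have satQ: "sat \<U> h (Q E i) \<longleftrightarrow> (holds_at \<U> \<phi> (map h (zs i)) (map h ws) \<longleftrightarrow> i \<in> E)"
    if "range h \<subseteq> univ \<U>" for h E i
    using sat_inst_form[OF ne wf len dis that] by (simp add: Q_def P_def)
  have wfQ: "wf_form L (Q E i)" for E i by (simp add: Q_def P_def wf_inst_form[OF wf])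
  have fvQ: "free_vars (Q E i) \<subseteq> set (zs i) \<union> set ws" for E i
    using free_vars_inst_form[OF wf] by (auto simp: Q_def P_def)
  define S where "S N E = exi_list ws (conj_list (map (Q E) [0..<N]))" for N E
  have satS: "sat \<U> h (S N E) \<longleftrightarrow>
      (\<exists>b\<in>ytuples \<phi> (univ \<U>). \<forall>i<N. holds_at \<U> \<phi> (map h (zs i)) b \<longleftrightarrow> i \<in> E)"
    if h: "range h \<subseteq> univ \<U>" for h N E
  proof
    assume "sat \<U> h (S N E)"
    then obtain g where g: "\<forall>v\<in>set ws. g v \<in> univ \<U>" "\<forall>v. v \<notin> set ws \<longrightarrow> g v = h v"
      "\<forall>i<N. sat \<U> g (Q E i)"
      unfolding S_def sat_exi_list sat_conj_list[OF ne] by auto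
    have rg: "range g \<subseteq> univ \<U>"
      by (rule range_subset[OF g(1,2) h])
    have "map g (zs i) = map h (zs i)" for i using g(2) zw by auto
    then show "\<exists>b\<in>ytuples \<phi> (univ \<U>). \<forall>i<N. holds_at \<U> \<phi> (map h (zs i)) b \<longleftrightarrow> i \<in> E"
      using g(3) satQ[OF rg] tupy[OF rg] by metis
  next
    assume "\<exists>b\<in>ytuples \<phi> (univ \<U>). \<forall>i<N. holds_at \<U> \<phi> (map h (zs i)) b \<longleftrightarrow> i \<in> E"
    then obtain b where b: "b \<in> ytuples \<phi> (univ \<U>)"
      "\<forall>i<N. holds_at \<U> \<phi> (map h (zs i)) b \<longleftrightarrow> i \<in> E" by blast
    define g where "g v = (if v \<in> set ws then b ! (v - n0) else h v)" for v
    have lb: "length b = ?ly" "set b \<subseteq> univ \<U>" using b by (auto simp: ytuples_def)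
    have "g v \<in> univ \<U>" if v: "v \<in> set ws" for v
    proof -
      have "v - n0 < length b" using v lb by (auto simp: ws_def)
      then show ?thesis using lb nth_mem v by (auto simp: g_def)
    qed
    then have rg: "range g \<subseteq> univ \<U>" by (intro range_subset[OF _ _ h]) (auto simp: g_def)
    have "map g (zs i) = map h (zs i)" for i using zw by (auto simp: g_def)
    moreover have "map g ws = b" using lb by (intro nth_equalityI) (auto simp: g_def ws_def)
    ultimately have "\<forall>i<N. sat \<U> g (Q E i)" using b(2) satQ[OF rg] by metis
    then show "sat \<U> h (S N E)"
      unfolding S_def sat_exi_list sat_conj_list[OF ne] using rg
      by (intro exI[of _ g]) (auto simp: g_def)
  qed
  have divlx: "(i * ?lx + c) div ?lx = i" if "c < ?lx" for i c
    using that by (intro div_nat_eqI) (auto simp: algebra_simps)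
  let ?V1 = "\<Union>i. set (zs i)"
  have "\<exists>h. range h \<subseteq> univ \<U> \<and> (\<forall>v. v \<notin> ?V1 \<longrightarrow> h v = u) \<and> (\<forall>\<psi>\<in>range (case_prod S). sat \<U> h \<psi>)"
  proof (rule saturated_countably_many_variables[OF sat ne small])
    show "range (\<lambda>_. u) \<subseteq> univ \<U>" using u by auto
    show "wf_form L \<psi>" if "\<psi> \<in> range (case_prod S)" for \<psi>
      using that wfQ by (auto simp: S_def)
    show "0 \<notin> free_vars \<psi>" if "\<psi> \<in> range (case_prod S)" for \<psi>
      using that fvQ zs0 ws0 by (fastforce simp: S_def)
    show "0 \<notin> ?V1" using zs0 by auto
    fix \<Delta> assume "\<Delta> \<subseteq> range (case_prod S)" "finite \<Delta>"
    then obtain D where D: "finite D" "\<Delta> = case_prod S ` D" by (meson finite_subset_image)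
    obtain N where N: "\<forall>n\<in>fst ` D. n \<le> N"
      using D finite_nat_set_iff_bounded_le by (metis finite_imageI)
    obtain a where a: "\<And>i. i < N \<Longrightarrow> a i \<in> xtuples \<phi> (univ \<U>)"
      "shattered (holds_at \<U> \<phi>) (ytuples \<phi> (univ \<U>)) N a" using ex[of N] by blast
    \<comment> \<open>Block number and position are decoded by division with remainder. Blocks from
      N on get the default u, since \<Delta> concerns only the first N.\<close>
    define h where "h v = (if v \<in> ?V1 \<and> v < n0 + ?ly + N * ?lx
      then a ((v - (n0 + ?ly)) div ?lx) ! ((v - (n0 + ?ly)) mod ?lx) else u)" for v
    have hz: "map h (zs i) = a i" if i: "i < N" for i
    proof (rule nth_equalityI)
      show "length (map h (zs i)) = length (a i)" using a(1)[OF i] len by (simp add: xtuples_def)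
      fix c assume "c < length (map h (zs i))"
      then have c: "c < ?lx" using len by simp
      have "Suc i * ?lx \<le> N * ?lx" using i by (intro mult_le_mono1) simp
      then have "i * ?lx + c < N * ?lx" using c by simp
      moreover have zc: "zs i ! c = n0 + ?ly + (i * ?lx + c)" using c by (simp add: zs_def)
      moreover have "zs i ! c \<in> ?V1" using c len by (metis UN_iff UNIV_I nth_mem)
      ultimately have "h (zs i ! c) = a ((i * ?lx + c) div ?lx) ! ((i * ?lx + c) mod ?lx)"
        unfolding h_def by simp
      also have "(i * ?lx + c) div ?lx = i" using c by (rule divlx)
      also have "(i * ?lx + c) mod ?lx = c" using c by simp
      finally show "map h (zs i) ! c = a i ! c" using c len by simp
    qed
    have rh: "range h \<subseteq> univ \<U>"
    proof
      fix x assume "x \<in> range h"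
      then obtain v where v: "x = h v" by blast
      show "x \<in> univ \<U>"
      proof (cases "v \<in> ?V1 \<and> v < n0 + ?ly + N * ?lx")
        case True
        then obtain i c where ic: "v = n0 + ?ly + (i * ?lx + c)" "c < ?lx" by (auto simp: zs_def)
        have "i < N"
        proof (rule ccontr)
          assume "\<not> i < N"
          then have "N * ?lx \<le> i * ?lx" by (intro mult_le_mono1) simp
          moreover have "i * ?lx + c < N * ?lx" using True ic(1) by simp
          ultimately show False by linarith
        qed
        then have "x = a i ! c" "length (a i) = ?lx" "set (a i) \<subseteq> univ \<U>"
          using True ic v a(1)[of i] divlx[OF ic(2)] by (auto simp: h_def xtuples_def)
        then show ?thesis using ic by auto
      next
        case False
        then show ?thesis using v u by (simp only: h_def) simp
      qed
    qed
    have "sat \<U> h (S n E)" if "(n, E) \<in> D" for n E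
    proof -
      have n: "n \<le> N" using N that by force
      \<comment> \<open>\<open>shattered\<close> speaks of subsets of {..<N} only, so E is cut down
        first.\<close>
      obtain b where "b \<in> ytuples \<phi> (univ \<U>)" "\<forall>i<N. holds_at \<U> \<phi> (a i) b \<longleftrightarrow> i \<in> E \<inter> {..<N}"
        using a(2) unfolding shattered_def by (metis inf_le2)
      then show ?thesis unfolding satS[OF rh] using n hz by (intro bexI[of _ b]) auto
    qed
    then have "\<forall>\<psi>\<in>\<Delta>. sat \<U> h \<psi>" using D by auto
    then show "\<exists>h. range h \<subseteq> univ \<U> \<and> (\<forall>v. v \<notin> ?V1 \<longrightarrow> h v = u) \<and> (\<forall>\<psi>\<in>\<Delta>. sat \<U> h \<psi>)"
      using rh by (intro exI[of _ h]) (auto simp: h_def)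
  qed
  then obtain e where e: "range e \<subseteq> univ \<U>" "\<And>N E. sat \<U> e (S N E)" by auto
  have "\<exists>b\<in>ytuples \<phi> (univ \<U>). \<forall>i. holds_at \<U> \<phi> (map e (zs i)) b \<longleftrightarrow> i \<in> E" for E
  proof -
    \<comment> \<open>The second use of saturation: the sequence is held fixed and only
      \<open>ws\<close> varies.\<close>
    have "\<exists>h. range h \<subseteq> univ \<U> \<and> (\<forall>v. v \<notin> set ws \<longrightarrow> h v = e v) \<and> (\<forall>\<psi>\<in>range (Q E). sat \<U> h \<psi>)"
    proof (rule saturated_countably_many_variables[OF sat ne small e(1) _ _ ws0])
      show "wf_form L \<psi>" if "\<psi> \<in> range (Q E)" for \<psi> using that wfQ by auto
      show "0 \<notin> free_vars \<psi>" if "\<psi> \<in> range (Q E)" for \<psi>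
        using that fvQ zs0 ws0 by fastforce
      fix \<Delta> assume "\<Delta> \<subseteq> range (Q E)" "finite \<Delta>"
      then obtain D where D: "finite D" "\<Delta> = Q E ` D" by (meson finite_subset_image)
      obtain N where N: "\<forall>n\<in>D. n < N" using D finite_nat_set_iff_bounded by blast
      obtain g where g: "\<forall>v\<in>set ws. g v \<in> univ \<U>" "\<forall>v. v \<notin> set ws \<longrightarrow> g v = e v"
        "\<forall>i<N. sat \<U> g (Q E i)"
        using e(2)[of N E] unfolding S_def sat_exi_list sat_conj_list[OF ne] by auto
      have "range g \<subseteq> univ \<U>" by (rule range_subset[OF g(1,2) e(1)])
      then show "\<exists>h. range h \<subseteq> univ \<U> \<and> (\<forall>v. v \<notin> set ws \<longrightarrow> h v = e v) \<and> (\<forall>\<psi>\<in>\<Delta>. sat \<U> h \<psi>)"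
        using g D N by (intro exI[of _ g]) auto
    qed
    then obtain h where h: "range h \<subseteq> univ \<U>" "\<forall>v. v \<notin> set ws \<longrightarrow> h v = e v" "\<forall>i. sat \<U> h (Q E i)" by auto
    have "map h (zs i) = map e (zs i)" for i using h(2) zw by auto
    then show ?thesis using h(3) satQ[OF h(1)] tupy[OF h(1)] by metis
  qed
  then obtain b where "\<And>E. b E \<in> ytuples \<phi> (univ \<U>)"
    "\<And>E i. holds_at \<U> \<phi> (map e (zs i)) (b E) \<longleftrightarrow> i \<in> E" by metis
  then have "\<not> NIP \<U> \<phi>"
    unfolding NIP_def using tupx[OF e(1)] by (auto intro!: exI[of _ "\<lambda>i. map e (zs i)"] exI[of _ b])
  then show False using nip by blast
qed

section \<open>Averages of points of the model\<close>

text \<open>The numbers n w s are rounded up. The errors lie in [0, 1] and sum to at most card S, so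
  n > card S / \<delta> suffices for all T at once. Zero weights stay zero, which matters because
  points of \<open>M\<close> are available only in cells of positive measure.\<close>

lemma rational_weights:
  fixes w :: "'s \<Rightarrow> real"
  assumes S: "finite S" and w: "\<And>s. s \<in> S \<Longrightarrow> 0 \<le> w s" "sum w S = 1" and \<delta>: "0 < \<delta>"
  shows "\<exists>k :: 's \<Rightarrow> nat. 0 < sum k S \<and> (\<forall>s\<in>S. 0 < k s \<longrightarrow> 0 < w s) \<and>
    (\<forall>T\<subseteq>S. \<bar>real (sum k T) / real (sum k S) - sum w T\<bar> < \<delta>)"
proof -
  define c where "c = real (card S)"
  obtain n :: nat where n: "c / \<delta> < n" using reals_Archimedean2 by blast
  have c0: "0 \<le> c" by (simp add: c_def)
  then have n0: "0 < real n" using n \<delta> by (meson divide_nonneg_pos le_less_trans)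
  define k where "k s = nat \<lceil>n * w s\<rceil>" for s
  define r where "r s = k s - n * w s" for s
  have r: "0 \<le> r s" "r s \<le> 1" if "s \<in> S" for s
  proof -
    have "0 \<le> n * w s" using w(1)[OF that] by simp
    then have "real (k s) = of_int \<lceil>n * w s\<rceil>" unfolding k_def by (subst of_nat_nat) auto
    then show "0 \<le> r s" "r s \<le> 1" unfolding r_def by linarith+
  qed
  have sumk: "real (sum k T) = n * sum w T + sum r T" for T
    by (simp add: r_def sum_subtractf sum_distrib_left)
  have sumr: "0 \<le> sum r T \<and> sum r T \<le> c" if "T \<subseteq> S" for T
  proof
    show "0 \<le> sum r T" using r that by (intro sum_nonneg) auto
    have "sum r T \<le> sum r S" using r that S by (intro sum_mono2) auto
    also have "\<dots> \<le> (\<Sum>s\<in>S. 1)" using r by (intro sum_mono) auto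
    finally show "sum r T \<le> c" by (simp add: c_def)
  qed
  have sumw: "0 \<le> sum w T \<and> sum w T \<le> 1" if "T \<subseteq> S" for T
    using w that S sum_mono2[OF S that, of w] by (auto intro: sum_nonneg)
  have N: "real n \<le> real (sum k S)" unfolding sumk using w(2) sumr[of S] by simp
  have "0 < w s" if "s \<in> S" "0 < k s" for s
    using that w(1)[of s] by (cases "w s = 0") (auto simp: k_def)
  moreover have "\<bar>real (sum k T) / real (sum k S) - sum w T\<bar> < \<delta>" if T: "T \<subseteq> S" for T
  proof -
    let ?N = "real (sum k S)"
    have "sum r S * sum w T \<le> c * 1"
      using sumr[OF subset_refl] sumw[OF T] c0 by (intro mult_mono) auto
    moreover have "0 \<le> sum r S * sum w T" using sumr[OF subset_refl] sumw[OF T] by simp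
    ultimately have "\<bar>sum r T - sum r S * sum w T\<bar> \<le> c" using sumr[OF T] by linarith
    moreover have "real (sum k T) - ?N * sum w T = sum r T - sum r S * sum w T"
      unfolding sumk using w(2) by (simp add: algebra_simps)
    ultimately have "\<bar>real (sum k T) - ?N * sum w T\<bar> \<le> c" by simp
    also have "c < \<delta> * real n" using n \<delta> by (simp add: field_simps)
    also have "\<dots> \<le> \<delta> * ?N" using N \<delta> by (intro mult_left_mono) auto
    finally have "\<bar>real (sum k T) - ?N * sum w T\<bar> / ?N < \<delta>"
      using N n0 by (simp add: divide_less_eq)
    also have "\<bar>real (sum k T) - ?N * sum w T\<bar> / ?N = \<bar>(real (sum k T) - ?N * sum w T) / ?N\<bar>"
      by (simp only: abs_divide abs_of_nat)
    also have "(real (sum k T) - ?N * sum w T) / ?N = real (sum k T) / ?N - sum w T"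
    proof -
      have "?N \<noteq> 0" using N n0 by linarith
      then show ?thesis unfolding diff_divide_distrib by (subst nonzero_mult_div_cancel_left) auto
    qed
    finally show ?thesis .
  qed
  moreover have "0 < sum k S" using N n0 by linarith
  ultimately show ?thesis by blast
qed

lemma list_with_multiplicities:
  fixes g :: "'s \<Rightarrow> 'x" and k :: "'s \<Rightarrow> nat"
  assumes "finite S"
  shows "\<exists>l. set l = g ` {s\<in>S. 0 < k s} \<and> length l = sum k S \<and>
    (\<forall>P. (\<Sum>a\<leftarrow>l. of_bool (P a)) = real (sum k {s\<in>S. P (g s)}))"
  using assms
proof (induction S rule: finite_induct)
  case (insert s S)
  then obtain l where l: "set l = g ` {s\<in>S. 0 < k s}" "length l = sum k S"
    "\<And>P. (\<Sum>a\<leftarrow>l. of_bool (P a)) = real (sum k {s\<in>S. P (g s)})" by blast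
  let ?l = "l @ replicate (k s) (g s)"
  have "set ?l = g ` {s'\<in>insert s S. 0 < k s'}" using l(1) by auto
  moreover have "length ?l = sum k (insert s S)" using insert.hyps l(2) by simp
  moreover have "(\<Sum>a\<leftarrow>?l. of_bool (P a)) = real (sum k {s'\<in>insert s S. P (g s')})" for P
  proof -
    have "{s'\<in>insert s S. P (g s')} = (if P (g s) then insert s {s'\<in>S. P (g s')} else {s'\<in>S. P (g s')})"
      by auto
    then show ?thesis using insert.hyps l(3)[of P] by (simp add: sum_list_replicate)
  qed
  ultimately show ?case by blast
qed (intro exI[of _ "[]"], simp)

lemma bool_combs_subset: "A \<in> bool_combs \<U> \<phi> \<Longrightarrow> A \<subseteq> xtuples \<phi> (univ \<U>)"
  by (induction rule: bool_combs.induct) auto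

lemma bool_combs_Int:
  assumes "A \<in> bool_combs \<U> \<phi>" "B \<in> bool_combs \<U> \<phi>"
  shows "A \<inter> B \<in> bool_combs \<U> \<phi>"
proof -
  let ?X = "xtuples \<phi> (univ \<U>)"
  have "A \<inter> B = ?X - ((?X - A) \<union> (?X - B))" using assms[THEN bool_combs_subset] by auto
  then show ?thesis using assms by (simp only: bool_combs.intros)
qed

lemma ytuples_nonempty: "univ \<U> \<noteq> {} \<Longrightarrow> ytuples \<phi> (univ \<U>) \<noteq> {}"
proof -
  assume "univ \<U> \<noteq> {}"
  then obtain u where "u \<in> univ \<U>" by blast
  then have "replicate (length (yvars \<phi>)) u \<in> ytuples \<phi> (univ \<U>)" by (auto simp: ytuples_def)
  then show ?thesis by blast
qed

lemma xtuples_in_bool_combs: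
  assumes "univ \<U> \<noteq> {}"
  shows "xtuples \<phi> (univ \<U>) \<in> bool_combs \<U> \<phi>"
proof -
  obtain b where b: "b \<in> ytuples \<phi> (univ \<U>)" using ytuples_nonempty[OF assms] by blast
  let ?A = "{a \<in> xtuples \<phi> (univ \<U>). holds_at \<U> \<phi> a b}"
  have "?A \<union> (xtuples \<phi> (univ \<U>) - ?A) \<in> bool_combs \<U> \<phi>"
    using b by (intro bool_combs.intros)
  then show ?thesis by (simp add: Un_absorb1)
qed

text \<open>The instances at B cut the tuples into atoms, indexed by the set s of parameters they
  satisfy. Each atom of positive measure contains a tuple from \<open>M\<close>; taken with
  multiplicities that approximate the measures, these tuples serve all b in B at once.\<close>

theorem finitely_satisfiable_approximation:
  fixes \<U> :: "('f, 'r, 'a) fo_struct"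
  assumes ne: "univ \<U> \<noteq> {}" and km: "keisler_measure \<U> \<phi> \<mu>"
    and fs: "finitely_satisfiable \<U> \<phi> M \<mu>"
    and B: "finite B" "B \<subseteq> ytuples \<phi> (univ \<U>)" and \<delta>: "0 < \<delta>"
  shows "\<exists>l. l \<noteq> [] \<and> set l \<subseteq> xtuples \<phi> M \<and>
    (\<forall>b\<in>B. \<bar>avg (\<lambda>a. holds_at \<U> \<phi> a b) l - inst_measure \<U> \<phi> \<mu> b\<bar> < \<delta>)"
proof -
  let ?X = "xtuples \<phi> (univ \<U>)" and ?\<B> = "bool_combs \<U> \<phi>"
  define \<tau> where "\<tau> a = {b\<in>B. holds_at \<U> \<phi> a b}" for a
  define cell where "cell S = {a\<in>?X. \<tau> a \<in> S}" for S
  define w where "w s = \<mu> (cell {s})" for s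
  have atom: "cell {s} \<in> ?\<B>" if s: "s \<subseteq> B" for s
  proof -
    have "{a\<in>?X. \<forall>b\<in>B'. holds_at \<U> \<phi> a b \<longleftrightarrow> b \<in> s} \<in> ?\<B>" if "finite B'" "B' \<subseteq> B" for B'
      using that
    proof (induction B' rule: finite_induct)
      case empty
      then show ?case using xtuples_in_bool_combs[OF ne] by simp
    next
      case (insert b B')
      let ?A = "{a\<in>?X. holds_at \<U> \<phi> a b}"
      have A: "?A \<in> ?\<B>" using insert.prems B by (intro bool_combs.inst) auto
      then have "(if b \<in> s then ?A else ?X - ?A) \<in> ?\<B>" by (simp add: bool_combs.compl)
      moreover have "{a\<in>?X. \<forall>b\<in>B'. holds_at \<U> \<phi> a b \<longleftrightarrow> b \<in> s} \<in> ?\<B>" using insert by blast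
      ultimately have "(if b \<in> s then ?A else ?X - ?A) \<inter> {a\<in>?X. \<forall>b\<in>B'. holds_at \<U> \<phi> a b \<longleftrightarrow> b \<in> s} \<in> ?\<B>"
        by (rule bool_combs_Int)
      also have "(if b \<in> s then ?A else ?X - ?A) \<inter> {a\<in>?X. \<forall>b\<in>B'. holds_at \<U> \<phi> a b \<longleftrightarrow> b \<in> s}
          = {a\<in>?X. \<forall>b'\<in>insert b B'. holds_at \<U> \<phi> a b' \<longleftrightarrow> b' \<in> s}" by auto
      finally show ?case .
    qed
    from this[OF B(1) subset_refl] have "{a\<in>?X. \<forall>b\<in>B. holds_at \<U> \<phi> a b \<longleftrightarrow> b \<in> s} \<in> ?\<B>" .
    also have "{a\<in>?X. \<forall>b\<in>B. holds_at \<U> \<phi> a b \<longleftrightarrow> b \<in> s} = cell {s}"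
      using s by (auto simp: cell_def \<tau>_def)
    finally show ?thesis .
  qed
  have \<mu>nn: "\<And>A. A \<in> ?\<B> \<Longrightarrow> 0 \<le> \<mu> A" and \<mu>1: "\<mu> ?X = 1"
    and \<mu>add: "\<And>A A'. A \<in> ?\<B> \<Longrightarrow> A' \<in> ?\<B> \<Longrightarrow> A \<inter> A' = {} \<Longrightarrow> \<mu> (A \<union> A') = \<mu> A + \<mu> A'"
    using km by (auto simp: keisler_measure_def additive_def)
  have empty: "{} \<in> ?\<B>" using bool_combs.compl[OF xtuples_in_bool_combs[OF ne]] by simp
  have "\<mu> {} = 0" using \<mu>add[OF empty empty] by simp
  have cell: "cell S \<in> ?\<B> \<and> \<mu> (cell S) = sum w S" if "finite S" "S \<subseteq> Pow B" for S
    using that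
  proof (induction S rule: finite_induct)
    case empty
    then show ?case using \<open>{} \<in> ?\<B>\<close> \<open>\<mu> {} = 0\<close> by (simp add: cell_def)
  next
    case (insert s S)
    have "cell (insert s S) = cell {s} \<union> cell S" "cell {s} \<inter> cell S = {}" using insert.hyps by (auto simp: cell_def)
    moreover have "cell {s} \<in> ?\<B>" using atom insert.prems by simp
    ultimately show ?case using insert \<mu>add by (auto simp: w_def intro: bool_combs.union)
  qed
  have finP: "finite (Pow B)" using B by simp
  have inst: "inst_measure \<U> \<phi> \<mu> b = sum w {s\<in>Pow B. b \<in> s}" if "b \<in> B" for b
  proof -
    have "{a\<in>?X. holds_at \<U> \<phi> a b} = cell {s\<in>Pow B. b \<in> s}" using that by (auto simp: cell_def \<tau>_def)
    moreover have "{s\<in>Pow B. b \<in> s} \<subseteq> Pow B" by blast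
    ultimately show ?thesis using cell finite_subset[OF _ finP] by (simp only: inst_measure_def)
  qed
  have "cell (Pow B) = ?X" by (auto simp: cell_def \<tau>_def)
  then have w1: "sum w (Pow B) = 1" using cell[OF finP subset_refl] \<mu>1 by simp
  have w0: "0 \<le> w s" if "s \<in> Pow B" for s using atom \<mu>nn that by (simp add: w_def)
  obtain k :: "'a list set \<Rightarrow> nat" where k: "0 < sum k (Pow B)" "\<forall>s\<in>Pow B. 0 < k s \<longrightarrow> 0 < w s"
    "\<forall>T\<subseteq>Pow B. \<bar>real (sum k T) / real (sum k (Pow B)) - sum w T\<bar> < \<delta>"
    using rational_weights[OF finP w0 w1 \<delta>] by blast
  have "\<forall>s\<in>{s\<in>Pow B. 0 < k s}. \<exists>a. a \<in> xtuples \<phi> M \<and> \<tau> a = s"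
  proof
    fix s assume s: "s \<in> {s\<in>Pow B. 0 < k s}"
    then have "0 < \<mu> (cell {s})" "cell {s} \<in> ?\<B>" using k(2) atom by (auto simp: w_def)
    then have "\<exists>a\<in>xtuples \<phi> M. a \<in> cell {s}" using fs unfolding finitely_satisfiable_def by simp
    then show "\<exists>a. a \<in> xtuples \<phi> M \<and> \<tau> a = s" by (auto simp: cell_def)
  qed
  from bchoice[OF this] obtain g
    where g: "\<And>s. s \<in> Pow B \<Longrightarrow> 0 < k s \<Longrightarrow> g s \<in> xtuples \<phi> M \<and> \<tau> (g s) = s" by auto
  obtain l where l: "set l = g ` {s\<in>Pow B. 0 < k s}" "length l = sum k (Pow B)"
    "\<And>P. (\<Sum>a\<leftarrow>l. of_bool (P a)) = real (sum k {s\<in>Pow B. P (g s)})"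
    using list_with_multiplicities[OF finP, of g k] by blast
  have "\<bar>avg (\<lambda>a. holds_at \<U> \<phi> a b) l - inst_measure \<U> \<phi> \<mu> b\<bar> < \<delta>" if b: "b \<in> B" for b
  proof -
    \<comment> \<open>\<open>g s\<close> is unspecified where k s = 0, so the two index sets may
      differ, but only in vanishing terms.\<close>
    have "sum k {s\<in>Pow B. holds_at \<U> \<phi> (g s) b} = sum k {s\<in>Pow B. b \<in> s}"
    proof (rule sum.mono_neutral_cong)
      show "k s = 0" if "s \<in> {s\<in>Pow B. b \<in> s} - {s\<in>Pow B. holds_at \<U> \<phi> (g s) b}" for s
        using that g[of s] b by (auto simp: \<tau>_def)
      show "k s = 0" if "s \<in> {s\<in>Pow B. holds_at \<U> \<phi> (g s) b} - {s\<in>Pow B. b \<in> s}" for s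
        using that g[of s] b by (auto simp: \<tau>_def)
    qed (use finP in auto)
    then have "avg (\<lambda>a. holds_at \<U> \<phi> a b) l = real (sum k {s\<in>Pow B. b \<in> s}) / real (sum k (Pow B))"
      by (simp only: avg_def l(2,3))
    moreover have "{s\<in>Pow B. b \<in> s} \<subseteq> Pow B" by blast
    ultimately show ?thesis using k(3) inst[OF b] by metis
  qed
  moreover have "l \<noteq> []" using l(2) k(1) by auto
  moreover have "set l \<subseteq> xtuples \<phi> M" using l(1) g by auto
  ultimately show ?thesis by blast
qed

section \<open>Approximation on the space of types\<close>

text \<open>If neither literal for a belonged to p, both extensions would be inconsistent. The parts
  inside p of the two finite witnesses have a common realization b, and b satisfies one of the two
  literals, a contradiction.\<close>

lemma opp_types_complete:
  assumes p: "p \<in> opp_types \<U> \<phi> M" and a: "a \<in> xtuples \<phi> M"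
  shows "(a, False) \<in> p \<longleftrightarrow> (a, True) \<notin> p"
proof -
  have sub: "p \<subseteq> xtuples \<phi> M \<times> UNIV" and cons: "opp_consistent \<U> \<phi> p"
    and max: "\<And>q. p \<subseteq> q \<Longrightarrow> q \<subseteq> xtuples \<phi> M \<times> UNIV \<Longrightarrow> opp_consistent \<U> \<phi> q \<Longrightarrow> q = p"
    using p by (auto simp: opp_types_def)
  have not_both: "\<not> ((a, True) \<in> p \<and> (a, False) \<in> p)"
  proof
    assume "(a, True) \<in> p \<and> (a, False) \<in> p"
    then have "{(a, True), (a, False)} \<subseteq> p" by simp
    moreover have "finite {(a, True), (a, False)}" by simp
    ultimately have "\<exists>b\<in>ytuples \<phi> (univ \<U>). \<forall>(a', s)\<in>{(a, True), (a, False)}. holds_at \<U> \<phi> a' b \<longleftrightarrow> s"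
      using cons unfolding opp_consistent_def by meson
    then show False by auto
  qed
  have "(a, True) \<in> p \<or> (a, False) \<in> p"
  proof (rule ccontr)
    assume neg: "\<not> ?thesis"
    have "\<not> opp_consistent \<U> \<phi> (insert (a, s) p)" for s
    proof
      assume "opp_consistent \<U> \<phi> (insert (a, s) p)"
      then have "insert (a, s) p = p" using sub a by (intro max) auto
      then show False using neg by (cases s) auto
    qed
    then have "\<exists>q. q \<subseteq> insert (a, s) p \<and> finite q \<and>
        \<not> (\<exists>b\<in>ytuples \<phi> (univ \<U>). \<forall>(a', s')\<in>q. holds_at \<U> \<phi> a' b \<longleftrightarrow> s')" for s
      unfolding opp_consistent_def by meson
    then obtain q where q: "\<And>s. q s \<subseteq> insert (a, s) p" "\<And>s. finite (q s)"
      "\<And>s. \<not> (\<exists>b\<in>ytuples \<phi> (univ \<U>). \<forall>(a', s')\<in>q s. holds_at \<U> \<phi> a' b \<longleftrightarrow> s')" by metis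
    let ?r = "(q True - {(a, True)}) \<union> (q False - {(a, False)})"
    have "?r \<subseteq> p" "finite ?r" using q(1)[of True] q(1)[of False] q(2) by auto
    then obtain b where b: "b \<in> ytuples \<phi> (univ \<U>)" "\<forall>(a', s')\<in>?r. holds_at \<U> \<phi> a' b \<longleftrightarrow> s'"
      using cons unfolding opp_consistent_def by meson
    let ?s = "holds_at \<U> \<phi> a b"
    have "case x of (a', s') \<Rightarrow> holds_at \<U> \<phi> a' b \<longleftrightarrow> s'" if x: "x \<in> q ?s" for x
    proof (cases "x = (a, ?s)")
      case False
      then have "x \<in> q ?s - {(a, ?s)}" using x by blast
      moreover have "q s - {(a, s)} \<subseteq> ?r" for s by (cases s) (simp_all only: Un_upper1 Un_upper2)
      ultimately have "x \<in> ?r" by (rule rev_subsetD)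
      then show ?thesis by (rule bspec[OF b(2)])
    qed simp
    with q(3)[of ?s] b(1) show False by blast
  qed
  then show ?thesis using not_both by blast
qed

lemma continuous_map_of_bool:
  assumes "openin X {p\<in>topspace X. P p}" "openin X {p\<in>topspace X. \<not> P p}"
  shows "continuous_map X euclideanreal (\<lambda>p. of_bool (P p))"
  unfolding continuous_map_def
proof (intro conjI allI impI)
  fix V :: "real set"
  have "{p\<in>topspace X. of_bool (P p) \<in> V} =
     (if 1 \<in> V then {p\<in>topspace X. P p} else {}) \<union> (if 0 \<in> V then {p\<in>topspace X. \<not> P p} else {})"
    by (auto simp: of_bool_def split: if_splits)
  then show "openin X {p\<in>topspace X. of_bool (P p) \<in> V}" using assms by (auto intro: openin_Un)
qed simp

text \<open>Since types decide every instance, each literal defines a clopen set.\<close>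

lemma continuous_map_avg:
  assumes ne: "M \<noteq> {}" "univ \<U> \<noteq> {}" and l: "set l \<subseteq> xtuples \<phi> M"
  shows "continuous_map (opp_stone \<U> \<phi> M) euclideanreal (\<lambda>p. avg (\<lambda>a. (a, True) \<in> p) l)"
proof -
  let ?X = "opp_stone \<U> \<phi> M"
  note top = topspace_opp_stone[OF ne, of \<phi>]
  have basic: "openin ?X {p\<in>opp_types \<U> \<phi> M. (a, s) \<in> p}" if "a \<in> xtuples \<phi> M" for a s
    unfolding opp_stone_def using that by (intro topology_generated_by_Basis) auto
  have one: "continuous_map ?X euclideanreal (\<lambda>p. of_bool ((a, True) \<in> p))" if a: "a \<in> xtuples \<phi> M" for a
  proof (rule continuous_map_of_bool)
    show "openin ?X {p\<in>topspace ?X. (a, True) \<in> p}" using basic[OF a] by (simp add: top)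
    have "{p\<in>topspace ?X. (a, True) \<notin> p} = {p\<in>opp_types \<U> \<phi> M. (a, False) \<in> p}"
      using opp_types_complete[OF _ a] unfolding top by blast
    then show "openin ?X {p\<in>topspace ?X. (a, True) \<notin> p}" using basic[OF a] by simp
  qed
  have "continuous_map ?X euclideanreal (\<lambda>p. \<Sum>a\<leftarrow>l. of_bool ((a, True) \<in> p))"
    using l by (induction l) (auto intro!: continuous_map_add one)
  then have "continuous_map ?X euclideanreal (\<lambda>p. (1 / length l) * (\<Sum>a\<leftarrow>l. of_bool ((a, True) \<in> p)))"
    by (intro continuous_map_real_mult) auto
  then show ?thesis by (simp add: avg_def)
qed

lemma avg_opp_tp:
  assumes "set l \<subseteq> xtuples \<phi> M"
  shows "avg (\<lambda>a. (a, True) \<in> opp_tp \<U> \<phi> M b) l = avg (\<lambda>a. holds_at \<U> \<phi> a b) l"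
proof -
  have "map (\<lambda>a. of_bool ((a, True) \<in> opp_tp \<U> \<phi> M b) :: real) l = map (\<lambda>a. of_bool (holds_at \<U> \<phi> a b)) l"
    using assms by (auto simp: opp_tp_def)
  then show ?thesis by (simp only: avg_def)
qed

text \<open>The indices are nonempty lists over \<open>M\<close>, and R is the set of realized
  types. Independence of averages at realized types is independence at tuples of the monster model,
  where bounded shattering applies.\<close>

theorem inst_measure_approximation:
  fixes \<U> :: "('f, 'r, 'a) fo_struct" and \<nu> :: "'a opp_type measure"
  assumes mon: "monster_model L T \<kappa> \<U>" and wf: "wf_part_form L \<phi>" and nip: "NIP \<U> \<phi>"
    and sm: "small_model L \<kappa> \<U> M" and km: "keisler_measure \<U> \<phi> \<mu>"
    and fs: "finitely_satisfiable \<U> \<phi> M \<mu>"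
    and reg: "regular_borel_prob (opp_stone \<U> \<phi> M) \<nu>" and \<epsilon>: "0 < \<epsilon>"
  shows "\<exists>C\<in>sets \<nu>. 1 - \<epsilon> < measure \<nu> C \<and> (\<exists>l. l \<noteq> [] \<and> set l \<subseteq> xtuples \<phi> M \<and>
    (\<forall>b\<in>ytuples \<phi> (univ \<U>). opp_tp \<U> \<phi> M b \<in> C \<longrightarrow>
      \<bar>avg (\<lambda>a. holds_at \<U> \<phi> a b) l - inst_measure \<U> \<phi> \<mu> b\<bar> < \<epsilon>))"
proof -
  let ?X = "opp_stone \<U> \<phi> M" and ?Y = "ytuples \<phi> (univ \<U>)" and ?tp = "opp_tp \<U> \<phi> M"
  let ?H = "holds_at \<U> \<phi>" and ?m = "inst_measure \<U> \<phi> \<mu>"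
  have ne: "M \<noteq> {}" "univ \<U> \<noteq> {}" and MU: "M \<subseteq> univ \<U>"
    using sm by (auto simp: small_model_def elementary_submodel_def is_struct_def)
  define I where "I = {l. l \<noteq> [] \<and> set l \<subseteq> xtuples \<phi> M}"
  define \<psi> where "\<psi> l p = avg (\<lambda>a. (a, True) \<in> p) l" for l :: "'a list list" and p
  have \<psi>tp: "\<psi> l (?tp b) = avg (\<lambda>a. ?H a b) l" if "l \<in> I" for l b
    using that avg_opp_tp by (auto simp: \<psi>_def I_def)
  \<comment> \<open>These sets have nonempty finite intersections by finite satisfiability; along an
    ultrafilter containing all of them the averages converge to \<mu>(\<phi>(x,b)) for every
    b.\<close>
  define Q where "Q = (\<lambda>(b, k :: nat). {l\<in>I. \<bar>avg (\<lambda>a. ?H a b) l - ?m b\<bar> < 1 / (real k + 1)})"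
  define F where "F = (INF x\<in>?Y \<times> UNIV. principal (Q x))"
  have "F \<noteq> bot"
    unfolding F_def
  proof (rule INF_filter_not_bot)
    fix J assume J: "J \<subseteq> ?Y \<times> (UNIV :: nat set)" "finite J"
    obtain K where K: "\<forall>k\<in>snd ` J. k \<le> K"
      using J(2) finite_nat_set_iff_bounded_le by (metis finite_imageI)
    have "fst ` J \<subseteq> ?Y" "finite (fst ` J)" using J by auto
    then obtain l where l: "l \<noteq> []" "set l \<subseteq> xtuples \<phi> M"
      "\<forall>b\<in>fst ` J. \<bar>avg (\<lambda>a. ?H a b) l - ?m b\<bar> < 1 / (real K + 1)"
      using finitely_satisfiable_approximation[OF ne(2) km fs, of "fst ` J" "1 / (real K + 1)"] by auto
    have "l \<in> Q (b, k)" if bk: "(b, k) \<in> J" for b k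
    proof -
      have "k \<le> K" "b \<in> fst ` J" using K bk by force+
      then have "\<bar>avg (\<lambda>a. ?H a b) l - ?m b\<bar> < 1 / (real K + 1)" "1 / (real K + 1) \<le> 1 / (real k + 1)"
        using l(3) by (auto simp: frac_le)
      then show ?thesis using l by (auto simp: Q_def I_def)
    qed
    then have "l \<in> (\<Inter>x\<in>J. Q x)" by auto
    then have "(\<Inter>x\<in>J. Q x) \<noteq> {}" by blast
    then show "(INF x\<in>J. principal (Q x)) \<noteq> bot"
      unfolding INF_principal_finite[OF J(2)] by (simp add: principal_eq_bot_iff)
  qed
  from exists_ultrafilter_le[OF this] obtain U where U: "U \<le> F" "ultrafilter U" by blast
  have nb: "U \<noteq> bot" using U by (simp add: ultrafilter_def)
  have evQ: "\<forall>\<^sub>F l in U. l \<in> Q (b, k)" if "b \<in> ?Y" for b k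
  proof -
    have "F \<le> principal (Q (b, k))" unfolding F_def using that by (intro INF_lower) auto
    then have "U \<le> principal (Q (b, k))" using U(1) by (rule order_trans[rotated])
    then show ?thesis by (simp add: le_principal)
  qed
  obtain b0 where b0: "b0 \<in> ?Y" using ytuples_nonempty[OF ne(2)] by blast
  have evI: "\<forall>\<^sub>F l in U. l \<in> I" using evQ[OF b0, of 0] by eventually_elim (simp add: Q_def)
  have lim: "((\<lambda>l. \<psi> l (?tp b)) \<longlongrightarrow> ?m b) U" if b: "b \<in> ?Y" for b
  proof (rule tendstoI)
    fix e :: real assume "0 < e"
    then obtain k :: nat where k: "1 / (real k + 1) < e" by (metis Suc_eq_plus1 nat_approx_posE of_nat_Suc add.commute)
    from evQ[OF b, of k] show "\<forall>\<^sub>F l in U. dist (\<psi> l (?tp b)) (?m b) < e"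
      by eventually_elim (use k \<psi>tp in \<open>auto simp: Q_def dist_real_def\<close>)
  qed
  \<comment> \<open>An arbitrary realization is used. Independence of the choice follows below from
    uniqueness of limits, since the averages depend only on the type.\<close>
  define f where "f p = ?m (SOME b. b \<in> ?Y \<and> ?tp b = p)" for p
  have limf: "((\<lambda>l. \<psi> l p) \<longlongrightarrow> f p) U" if p: "p \<in> ?tp ` ?Y" for p
  proof -
    let ?b = "SOME b. b \<in> ?Y \<and> ?tp b = p"
    have "\<exists>b. b \<in> ?Y \<and> ?tp b = p" using p by blast
    then have "?b \<in> ?Y \<and> ?tp ?b = p" by (rule someI_ex)
    then show ?thesis using lim[of ?b] by (simp add: f_def)
  qed
  have f: "f (?tp b) = ?m b" if "b \<in> ?Y" for b
    using tendsto_unique[OF nb limf lim[OF that]] that by blast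
  obtain d where d: "\<And>a. (\<forall>i<d. a i \<in> xtuples \<phi> (univ \<U>)) \<Longrightarrow> \<not> shattered ?H ?Y d a"
    using NIP_bounded_shattering[OF mon wf nip] by blast
  have xM: "xtuples \<phi> M \<subseteq> xtuples \<phi> (univ \<U>)" using MU by (auto simp: xtuples_def)
  then have dM: "\<not> shattered ?H ?Y d a" if "\<forall>i<d. a i \<in> xtuples \<phi> M" for a
    using that by (intro d) blast
  have "\<exists>C\<in>sets \<nu>. 1 - \<epsilon> < measure \<nu> C \<and> (\<exists>l\<in>I. \<forall>p\<in>C \<inter> ?tp ` ?Y. \<bar>\<psi> l p - f p\<bar> < \<epsilon>)"
  proof (rule uniform_approximation_off_small_set[OF reg _ _ _ U(2) evI limf _ \<epsilon>])
    fix l and r :: real assume l: "l \<in> I"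
    then have cont: "continuous_map ?X euclideanreal (\<psi> l)"
      unfolding \<psi>_def I_def by (intro continuous_map_avg ne) auto
    show "openin ?X {p\<in>topspace ?X. r < \<psi> l p}"
      using openin_continuous_map_preimage[OF cont, of "{r<..}"] by simp
    show "openin ?X {p\<in>topspace ?X. \<psi> l p < r}"
      using openin_continuous_map_preimage[OF cont, of "{..<r}"] by simp
  next
    fix \<alpha> \<beta> :: real assume "\<alpha> < \<beta>" "\<beta> \<le> \<alpha> + 1"
    from bounded_indep_averages[where d = d and X = "xtuples \<phi> M", OF dM this]
    obtain N where N: "\<And>l. (\<forall>i<N. l i \<noteq> [] \<and> set (l i) \<subseteq> xtuples \<phi> M) \<Longrightarrow> \<not> indep_averages ?H ?Y N \<alpha> \<beta> l"
      by blast
    have "\<not> indep_levels \<psi> (?tp ` ?Y) N \<alpha> \<beta> l" if l: "\<forall>j<N. l j \<in> I" for l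
    proof
      assume lev: "indep_levels \<psi> (?tp ` ?Y) N \<alpha> \<beta> l"
      have "indep_averages ?H ?Y N \<alpha> \<beta> l"
        unfolding indep_averages_def
      proof (intro allI impI)
        fix E assume "E \<subseteq> {..<N}"
        then obtain b where b: "b \<in> ?Y"
          "\<forall>j<N. if j \<in> E then \<beta> < \<psi> (l j) (?tp b) else \<psi> (l j) (?tp b) < \<alpha>"
          using lev unfolding indep_levels_def by blast
        have "if j \<in> E then \<beta> < avg (\<lambda>a. ?H a b) (l j) else avg (\<lambda>a. ?H a b) (l j) < \<alpha>" if "j < N" for j
          using b(2) that \<psi>tp[of "l j" b] l by metis
        then show "\<exists>b\<in>?Y. \<forall>j<N. if j \<in> E then \<beta> < avg (\<lambda>a. ?H a b) (l j) else avg (\<lambda>a. ?H a b) (l j) < \<alpha>"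
          using b(1) by blast
      qed
      then show False using N l by (auto simp: I_def)
    qed
    then show "\<exists>N. \<forall>l. (\<forall>j<N. l j \<in> I) \<longrightarrow> \<not> indep_levels \<psi> (?tp ` ?Y) N \<alpha> \<beta> l" by blast
  next
    show "0 \<le> \<psi> l p \<and> \<psi> l p \<le> 1" for l p by (simp add: \<psi>_def avg_nonneg avg_le_1)
  qed
  then obtain C l where C: "C \<in> sets \<nu>" "1 - \<epsilon> < measure \<nu> C" "l \<in> I"
    "\<forall>p\<in>C \<inter> ?tp ` ?Y. \<bar>\<psi> l p - f p\<bar> < \<epsilon>" by blast
  have "\<bar>avg (\<lambda>a. ?H a b) l - ?m b\<bar> < \<epsilon>" if "b \<in> ?Y" "?tp b \<in> C" for b
  proof -
    have "\<bar>\<psi> l (?tp b) - f (?tp b)\<bar> < \<epsilon>" using C(4) that by blast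
    then show ?thesis by (simp only: \<psi>tp[OF C(3)] f[OF that(1)])
  qed
  then show ?thesis using C(1-3) unfolding I_def by blast
qed

section \<open>Baire-1/2 functions from fast approximation\<close>

text \<open>The approximating sequence must start at 0, so it jumps to g at index 1 and stays there;
  its total variation is |g|.\<close>

lemma DBSC_continuous:
  assumes g: "continuous_map X euclideanreal g" and bd: "\<And>p. p \<in> topspace X \<Longrightarrow> \<bar>g p\<bar> \<le> C"
  shows "DBSC X g"
proof -
  let ?F = "\<lambda>n p. if n = (0 :: nat) then 0 else g p"
  have sums: "(\<lambda>n. \<bar>?F (Suc n) p - ?F n p\<bar>) sums \<bar>g p\<bar>" for p
    using sums_If_finite_set[of "{0}" "\<lambda>_. \<bar>g p\<bar>"] by (simp add: if_distrib cong: if_cong)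
  have "(\<lambda>n. ?F n p) \<longlonglongrightarrow> g p" for p
    by (rule tendsto_eventually) (auto simp: eventually_sequentially intro: exI[of _ 1])
  moreover have "continuous_map X euclideanreal (?F n)" for n using g by (cases n) auto
  ultimately show ?thesis
    unfolding DBSC_def using bd sums_summable[OF sums] sums_unique[OF sums]
    by (intro exI[of _ ?F] exI[of _ C]) auto
qed

text \<open>Clamping the increments to \<open>(1/2)^n\<close> forces uniform convergence without changing the limit at
  points where the increments are already that small.\<close>

lemma baire_half_of_fast_convergence:
  fixes \<psi> :: "nat \<Rightarrow> 'p \<Rightarrow> real"
  assumes cont: "\<And>n. continuous_map X euclideanreal (\<psi> n)" and bd: "\<And>p. \<bar>\<psi> 0 p\<bar> \<le> 1"
  shows "\<exists>f. baire_half X f \<and>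
    (\<forall>p. (\<forall>n. \<bar>\<psi> (Suc n) p - \<psi> n p\<bar> \<le> (1 / 2) ^ n) \<longrightarrow> (\<lambda>n. \<psi> n p) \<longlonglongrightarrow> f p)"
proof -
  define t where "t n p = max (- ((1 / 2) ^ n)) (min ((1 / 2) ^ n) (\<psi> (Suc n) p - \<psi> n p))" for n p
  define g where "g n p = \<psi> 0 p + (\<Sum>i<n. t i p)" for n p
  define f where "f p = \<psi> 0 p + (\<Sum>i. t i p)" for p
  have tle: "\<bar>t n p\<bar> \<le> (1 / 2) ^ n" for n p
    unfolding t_def by (auto simp: abs_le_iff max_def min_def)
  have sm: "summable (\<lambda>n. (1 / 2 :: real) ^ n)" by (rule summable_geometric) simp
  have "uniform_limit UNIV (\<lambda>n p. \<Sum>i<n. t i p) (\<lambda>p. \<Sum>i. t i p) sequentially"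
    by (rule Weierstrass_m_test[OF _ sm]) (use tle in simp)
  then have ul: "uniform_limit UNIV g f sequentially"
    unfolding g_def f_def by (intro uniform_limit_add uniform_limit_const)
  have "DBSC X (g n)" for n
  proof (rule DBSC_continuous)
    have "continuous_map X euclideanreal (t i)" for i
      unfolding t_def by (intro continuous_map_real_max continuous_map_real_min continuous_map_diff cont) auto
    then show "continuous_map X euclideanreal (g n)"
      unfolding g_def by (intro continuous_map_add continuous_map_sum cont) auto
    fix p
    have "\<bar>\<Sum>i<n. t i p\<bar> \<le> (\<Sum>i<n. \<bar>t i p\<bar>)" by (rule sum_abs)
    also have "\<dots> \<le> (\<Sum>i<n. (1 / 2) ^ i)" by (intro sum_mono tle)
    also have "\<dots> \<le> (\<Sum>i. (1 / 2) ^ i)" by (intro sum_le_suminf sm) auto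
    also have "\<dots> = 2" by (simp add: suminf_geometric)
    finally show "\<bar>g n p\<bar> \<le> 3" unfolding g_def using bd[of p] by linarith
  qed
  then have "baire_half X f"
    unfolding baire_half_def using uniform_limit_on_subset[OF ul] by blast
  moreover have "(\<lambda>n. \<psi> n p) \<longlonglongrightarrow> f p" if small: "\<forall>n. \<bar>\<psi> (Suc n) p - \<psi> n p\<bar> \<le> (1 / 2) ^ n" for p
  proof -
    have t: "t n p = \<psi> (Suc n) p - \<psi> n p" for n
      using small[rule_format, of n] unfolding t_def by (auto simp: abs_le_iff)
    have "g n p = \<psi> n p" for n using sum_lessThan_telescope[of "\<lambda>i. \<psi> i p" n] by (simp add: g_def t)
    then show ?thesis using tendsto_uniform_limitI[OF ul, of p] by simp
  qed
  ultimately show ?thesis by blast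
qed

text \<open>The complements have total measure at most \<epsilon> / 2; the spare half makes the
  final inequality strict.\<close>

lemma (in prob_space) measure_INT_gt:
  assumes C: "\<And>n. C n \<in> events" "\<And>n. 1 - \<epsilon> / 2 * (1 / 2) ^ Suc n < prob (C n)" and \<epsilon>: "0 < \<epsilon>"
  shows "1 - \<epsilon> < prob (\<Inter>n :: nat. C n)"
proof -
  let ?D = "\<lambda>n. space M - C n" and ?b = "\<lambda>n. \<epsilon> / 2 * (1 / 2) ^ Suc n :: real"
  have D: "prob (?D n) \<le> ?b n" for n using prob_compl[OF C(1)[of n]] C(2)[of n] by linarith
  have sums: "?b sums (\<epsilon> / 2 * 1)" by (intro sums_mult power_half_series)
  have sumD: "summable (\<lambda>n. prob (?D n))"
    by (rule summable_comparison_test[OF _ sums_summable[OF sums]]) (use D in auto)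
  have "prob (\<Union>n. ?D n) \<le> (\<Sum>n. prob (?D n))"
    using C(1) sumD by (intro finite_measure_subadditive_countably) auto
  also have "\<dots> \<le> \<epsilon> / 2" using suminf_le[OF D sumD sums_summable[OF sums]] sums_unique[OF sums] by simp
  finally have le: "prob (\<Union>n. ?D n) \<le> \<epsilon> / 2" .
  have eq: "(\<Inter>n. C n) = space M - (\<Union>n. ?D n)" using sets.sets_into_space[OF C(1)] by auto
  have "(\<Union>n. ?D n) \<in> events" using C(1) by (intro sets.countable_UN) auto
  from prob_compl[OF this] show ?thesis unfolding eq using le \<epsilon> by linarith
qed

text \<open>Approximations of accuracy \<open>e n\<close> hold simultaneously on the intersection of
  the sets \<open>C n\<close>. There the averages converge to \<mu>(\<phi>(x,b)) with increments
  small enough for the clamped limit to agree with it.\<close>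

theorem inst_measure_baire_half:
  fixes \<U> :: "('f, 'r, 'a) fo_struct" and \<nu> :: "'a opp_type measure"
  assumes mon: "monster_model L T \<kappa> \<U>" and wf: "wf_part_form L \<phi>" and nip: "NIP \<U> \<phi>"
    and sm: "small_model L \<kappa> \<U> M" and km: "keisler_measure \<U> \<phi> \<mu>"
    and fs: "finitely_satisfiable \<U> \<phi> M \<mu>"
    and reg: "regular_borel_prob (opp_stone \<U> \<phi> M) \<nu>" and \<epsilon>: "0 < \<epsilon>"
  shows "\<exists>E\<in>sets \<nu>. 1 - \<epsilon> < measure \<nu> E \<and> (\<exists>f. baire_half (opp_stone \<U> \<phi> M) f \<and>
    (\<forall>b\<in>ytuples \<phi> (univ \<U>). opp_tp \<U> \<phi> M b \<in> E \<longrightarrow> inst_measure \<U> \<phi> \<mu> b = f (opp_tp \<U> \<phi> M b)))"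
proof -
  let ?X = "opp_stone \<U> \<phi> M" and ?Y = "ytuples \<phi> (univ \<U>)" and ?tp = "opp_tp \<U> \<phi> M"
  let ?m = "inst_measure \<U> \<phi> \<mu>"
  interpret prob_space \<nu> using reg by (simp add: regular_borel_prob_def)
  have ne: "M \<noteq> {}" "univ \<U> \<noteq> {}"
    using sm by (auto simp: small_model_def elementary_submodel_def is_struct_def)
  \<comment> \<open>The bound \<epsilon> / 2 limits the measure lost in the intersection. The bound
    1 gives the speed: e n + e (n + 1) is at most 3/4 of (1/2)^n, within the allowed
    increment.\<close>
  define e where "e n = min (\<epsilon> / 2) 1 * (1 / 2) ^ Suc n" for n
  have e: "0 < e n" "e n \<le> \<epsilon> / 2 * (1 / 2) ^ Suc n" "e n \<le> 1 * (1 / 2) ^ Suc n" for n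
    unfolding e_def using \<epsilon> by (simp, (intro mult_right_mono; simp)+)
  have "\<exists>C l. C \<in> sets \<nu> \<and> 1 - e n < measure \<nu> C \<and> l \<noteq> [] \<and> set l \<subseteq> xtuples \<phi> M \<and>
    (\<forall>b\<in>?Y. ?tp b \<in> C \<longrightarrow> \<bar>avg (\<lambda>a. holds_at \<U> \<phi> a b) l - ?m b\<bar> < e n)" for n
    using inst_measure_approximation[OF mon wf nip sm km fs reg e(1)[of n]] by blast
  then obtain C l where C: "\<And>n. C n \<in> sets \<nu>" "\<And>n. 1 - e n < measure \<nu> (C n)"
    and l: "\<And>n. set (l n) \<subseteq> xtuples \<phi> M"
    and app: "\<And>n b. b \<in> ?Y \<Longrightarrow> ?tp b \<in> C n \<Longrightarrow> \<bar>avg (\<lambda>a. holds_at \<U> \<phi> a b) (l n) - ?m b\<bar> < e n"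
    by metis
  define \<psi> where "\<psi> n p = avg (\<lambda>a. (a, True) \<in> p) (l n)" for n p
  have "continuous_map ?X euclideanreal (\<psi> n)" for n
    unfolding \<psi>_def by (rule continuous_map_avg[OF ne l])
  moreover have "\<bar>\<psi> 0 p\<bar> \<le> 1" for p by (simp add: \<psi>_def avg_nonneg avg_le_1)
  ultimately obtain f where f: "baire_half ?X f"
    "\<And>p. (\<forall>n. \<bar>\<psi> (Suc n) p - \<psi> n p\<bar> \<le> (1 / 2) ^ n) \<Longrightarrow> (\<lambda>n. \<psi> n p) \<longlonglongrightarrow> f p"
    using baire_half_of_fast_convergence[of ?X \<psi>] by blast
  let ?E = "\<Inter>n. C n"
  have "1 - \<epsilon> < measure \<nu> ?E"
  proof (rule measure_INT_gt[OF C(1) _ \<epsilon>])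
    show "1 - \<epsilon> / 2 * (1 / 2) ^ Suc n < prob (C n)" for n using C(2)[of n] e(2)[of n] by linarith
  qed
  moreover have "?m b = f (?tp b)" if b: "b \<in> ?Y" "?tp b \<in> ?E" for b
  proof -
    have near: "\<bar>\<psi> n (?tp b) - ?m b\<bar> < e n" for n
      using app[OF b(1), of n] b(2) avg_opp_tp[OF l] by (simp add: \<psi>_def)
    have "\<bar>\<psi> (Suc n) (?tp b) - \<psi> n (?tp b)\<bar> \<le> (1 / 2) ^ n" for n
    proof -
      have "0 \<le> (1 / 2 :: real) ^ n" by simp
      then have "e (Suc n) + e n \<le> (1 / 2) ^ n" using e(3)[of n] e(3)[of "Suc n"] by (simp add: field_simps)
      then show ?thesis using near[of n] near[of "Suc n"] by linarith
    qed
    then have "(\<lambda>n. \<psi> n (?tp b)) \<longlonglongrightarrow> f (?tp b)" by (intro f(2)) blast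
    moreover have "(\<lambda>n. \<psi> n (?tp b)) \<longlonglongrightarrow> ?m b"
    proof (rule LIM_zero_cancel, rule Lim_null_comparison)
      show "\<forall>\<^sub>F n in sequentially. norm (\<psi> n (?tp b) - ?m b) \<le> (1 / 2) ^ Suc n"
        using near e(3) by (intro always_eventually allI) (smt (verit) real_norm_def)
      show "(\<lambda>n. (1 / 2 :: real) ^ Suc n) \<longlonglongrightarrow> 0" by (intro LIMSEQ_Suc LIMSEQ_realpow_zero) auto
    qed
    ultimately show ?thesis by (rule LIMSEQ_unique[symmetric])
  qed
  moreover have "?E \<in> sets \<nu>" using C(1) by auto
  ultimately show ?thesis using f(1) by blast
qed

theorem theorem4p11:
  fixes L :: "('f, 'r) language" and T :: "('f, 'r) fo_form set"
    and \<kappa> :: "'k rel" and \<U> :: "('f, 'r, 'a) fo_struct" and M :: "'a set"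
    and \<phi> :: "('f, 'r) part_form" and \<mu> :: "'a list set \<Rightarrow> real"
    and \<nu> :: "'a opp_type measure" and \<epsilon> :: real
  assumes "complete_theory L T"
    and "monster_model L T \<kappa> \<U>"
    and "wf_part_form L \<phi>" and "NIP \<U> \<phi>"
    and "small_model L \<kappa> \<U> M"
    and "keisler_measure \<U> \<phi> \<mu>" and "finitely_satisfiable \<U> \<phi> M \<mu>"
    and "regular_borel_prob (opp_stone \<U> \<phi> M) \<nu>"
    and "\<epsilon> > 0"
  shows "(\<exists>C\<in>sets \<nu>. measure \<nu> C > 1 - \<epsilon> \<and>
           (\<exists>(m::nat) (k::nat) (\<theta> :: nat \<Rightarrow> 'a list list).
              0 < m \<and> 1 \<le> k \<and> k \<le> m \<and>
              (\<forall>i\<in>{1..k}. \<theta> i \<noteq> [] \<and> set (\<theta> i) \<subseteq> xtuples \<phi> M) \<and>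
              (\<forall>b\<in>ytuples \<phi> (univ \<U>). opp_tp \<U> \<phi> M b \<in> C \<longrightarrow>
                 \<bar>(\<Sum>i=1..k. of_bool (holds_conj \<U> \<phi> (\<theta> i) b)) / real m
                    - inst_measure \<U> \<phi> \<mu> b\<bar> < \<epsilon>)))
       \<and> (countable M \<longrightarrow>
           (\<exists>C\<in>sets \<nu>. measure \<nu> C > 1 - \<epsilon> \<and>
              (\<exists>(n::nat) (a :: nat \<Rightarrow> 'a list).
                 1 \<le> n \<and> (\<forall>i\<in>{1..n}. a i \<in> xtuples \<phi> M) \<and>
                 (\<forall>b\<in>ytuples \<phi> (univ \<U>). opp_tp \<U> \<phi> M b \<in> C \<longrightarrow>
                    \<bar>(1 / real n) * (\<Sum>i=1..n. of_bool (holds_at \<U> \<phi> (a i) b))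
                       - inst_measure \<U> \<phi> \<mu> b\<bar> < \<epsilon>)))
         \<and> (\<exists>E\<in>sets \<nu>. measure \<nu> E > 1 - \<epsilon> \<and>
              (\<exists>f. baire_half (opp_stone \<U> \<phi> M) f \<and>
                 (\<forall>b\<in>ytuples \<phi> (univ \<U>). opp_tp \<U> \<phi> M b \<in> E \<longrightarrow>
                    inst_measure \<U> \<phi> \<mu> b = f (opp_tp \<U> \<phi> M b)))))"
proof -
  let ?Y = "ytuples \<phi> (univ \<U>)"
  note approx = inst_measure_approximation[OF assms(2-9)]
  obtain C l where C: "C \<in> sets \<nu>" "measure \<nu> C > 1 - \<epsilon>" and l: "l \<noteq> []" "set l \<subseteq> xtuples \<phi> M"
    and app: "\<And>b. b \<in> ?Y \<Longrightarrow> opp_tp \<U> \<phi> M b \<in> C \<Longrightarrow>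
      \<bar>avg (\<lambda>a. holds_at \<U> \<phi> a b) l - inst_measure \<U> \<phi> \<mu> b\<bar> < \<epsilon>"
    using approx by blast
  \<comment> \<open>Sums in the theorem start at 1, list positions at 0.\<close>
  define a where "a i = l ! (i - 1)" for i
  let ?n = "length l"
  have n: "1 \<le> ?n" using l(1) by (simp add: Suc_le_eq)
  have a: "a i \<in> xtuples \<phi> M" if "i \<in> {1..?n}" for i
  proof -
    have "i - 1 < ?n" using that by auto
    then show ?thesis using l(2) nth_mem by (auto simp: a_def)
  qed
  have avg: "avg P l = (\<Sum>i=1..?n. of_bool (P (a i))) / ?n" for P
  proof -
    have "(\<Sum>x\<leftarrow>l. of_bool (P x)) = (\<Sum>i<?n. of_bool (P (l ! i)) :: real)"
      by (simp add: sum_list_sum_nth atLeast0LessThan)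
    also have "\<dots> = (\<Sum>i=1..?n. of_bool (P (a i)))"
      by (intro sum.reindex_bij_witness[of _ "\<lambda>i. i - 1" Suc]) (auto simp: a_def)
    finally show ?thesis by (simp only: avg_def)
  qed
  have conj: "holds_conj \<U> \<phi> [a i] b = holds_at \<U> \<phi> (a i) b" for i b by (simp add: holds_conj_def)
  \<comment> \<open>The average already has the required shape: k = m is the length of the list, and
    each conjunction has one member.\<close>
  have i: "\<exists>C\<in>sets \<nu>. measure \<nu> C > 1 - \<epsilon> \<and>
           (\<exists>(m::nat) (k::nat) (\<theta> :: nat \<Rightarrow> 'a list list).
              0 < m \<and> 1 \<le> k \<and> k \<le> m \<and>
              (\<forall>i\<in>{1..k}. \<theta> i \<noteq> [] \<and> set (\<theta> i) \<subseteq> xtuples \<phi> M) \<and>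
              (\<forall>b\<in>?Y. opp_tp \<U> \<phi> M b \<in> C \<longrightarrow>
                 \<bar>(\<Sum>i=1..k. of_bool (holds_conj \<U> \<phi> (\<theta> i) b)) / real m
                    - inst_measure \<U> \<phi> \<mu> b\<bar> < \<epsilon>))"
    using C n a app unfolding avg
    by (intro bexI[of _ C] conjI exI[of _ ?n] exI[of _ "\<lambda>i. [a i]"]) (auto simp: conj)
  have iia: "\<exists>C\<in>sets \<nu>. measure \<nu> C > 1 - \<epsilon> \<and>
              (\<exists>(n::nat) (a :: nat \<Rightarrow> 'a list).
                 1 \<le> n \<and> (\<forall>i\<in>{1..n}. a i \<in> xtuples \<phi> M) \<and>
                 (\<forall>b\<in>?Y. opp_tp \<U> \<phi> M b \<in> C \<longrightarrow>
                    \<bar>(1 / real n) * (\<Sum>i=1..n. of_bool (holds_at \<U> \<phi> (a i) b))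
                       - inst_measure \<U> \<phi> \<mu> b\<bar> < \<epsilon>))"
    using C n a app unfolding avg
    by (intro bexI[of _ C] conjI exI[of _ ?n] exI[of _ a]) auto
  show ?thesis using i iia inst_measure_baire_half[OF assms(2-9)] by (intro conjI impI)
qed

end
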